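(* Let $K$ be the universal Knaster continuum and let $\mathrm{Homeo}(K)$ be its group of homeomorphisms. Then $\mathrm{Homeo}(K)$ is isomorphic as a topological group to a semidirect product $U \rtimes F$, where $U$ is an extremely amenable Polish group and $F$ is the free abelian group on countably (infinitely) many generators with the discrete topology.
   Context: Let $I=[0,1]$. A Knaster continuum is a space of the form $\varprojlim (I,T_n^{n+1})$ where each $T_n^{n+1}:I\to I$ is a continuous open surjection with $T_n^{n+1}(0)=0$. The universal Knaster continuum $K$ is the (unique up to homeomorphism) Knaster continuum which admits a continuous open surjection onto every Knaster continuum. $\mathrm{Homeo}(K)$ carries the topology of uniform convergence, i.e. the topology induced by $d_{\sup}(f,g)=\sup_{x\in K} d_K(f(x),g(x))$ for a compatible metric $d_K$ on $K$; with it $\mathrm{Homeo}(K)$ is a Polish group. A topological group is extremely amenable if every continuous action of it on a (nonempty) compact Hausdorff space has a fixed point. The topology on a semidirect product of two topological groups is the product topology on the underlying product space. *)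

theory Defs
  imports
    "HOL-Analysis.Analysis"
    "HOL-Algebra.Free_Abelian_Groups"
    "HOL-Algebra.Group_Action"
begin

no_notation eq_closure_of (\<open>closure'_of\<index>\<close>)

section \<open>Knaster continua\<close>

abbreviation unit_interval :: "real topology"
  where "unit_interval \<equiv> top_of_set {0..1}"

definition knaster_bonding :: "(nat \<Rightarrow> real \<Rightarrow> real) \<Rightarrow> bool"
  where "knaster_bonding T \<longleftrightarrow>
    (\<forall>n. continuous_map unit_interval unit_interval (T n) \<and>
         open_map unit_interval unit_interval (T n) \<and>
         T n ` {0..1} = {0..1} \<and>
         T n 0 = 0)"

text \<open>\<^term>\<open>T n\<close> is the bonding map from the factor with index \<^term>\<open>Suc n\<close> to the
  factor with index \<^term>\<open>n\<close>.\<close>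

definition interval_inverse_limit :: "(nat \<Rightarrow> real \<Rightarrow> real) \<Rightarrow> (nat \<Rightarrow> real) topology"
  where "interval_inverse_limit T =
    subtopology (product_topology (\<lambda>_. unit_interval) UNIV) {x. \<forall>n. x n = T n (x (Suc n))}"

definition knaster_continuum :: "'a topology \<Rightarrow> bool"
  where "knaster_continuum X \<longleftrightarrow>
    (\<exists>T. knaster_bonding T \<and> X homeomorphic_space interval_inverse_limit T)"

text \<open>Every Knaster continuum is homeomorphic to one whose points are sequences of reals, so
  it is enough to let \<^term>\<open>Y\<close> range over topologies on that type.\<close>

definition universal_knaster_continuum :: "'a topology \<Rightarrow> bool"
  where "universal_knaster_continuum X \<longleftrightarrow>
    knaster_continuum X \<and>
    (\<forall>Y :: (nat \<Rightarrow> real) topology. knaster_continuum Y \<longrightarrow>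
      (\<exists>f. continuous_map X Y f \<and> open_map X Y f \<and> f ` topspace X = topspace Y))"


section \<open>Topological groups\<close>

definition topological_group :: "('g, 'm) monoid_scheme \<Rightarrow> 'g topology \<Rightarrow> bool"
  where "topological_group G \<tau> \<longleftrightarrow>
    group G \<and> topspace \<tau> = carrier G \<and>
    continuous_map (prod_topology \<tau> \<tau>) \<tau> (\<lambda>(x, y). x \<otimes>\<^bsub>G\<^esub> y) \<and>
    continuous_map \<tau> \<tau> (\<lambda>x. inv\<^bsub>G\<^esub> x)"

definition polish_group :: "('g, 'm) monoid_scheme \<Rightarrow> 'g topology \<Rightarrow> bool"
  where "polish_group G \<tau> \<longleftrightarrow>
    topological_group G \<tau> \<and> separable_space \<tau> \<and> completely_metrizable_space \<tau>"

definition topological_group_isomorphic ::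
    "('g, 'm) monoid_scheme \<Rightarrow> 'g topology \<Rightarrow> ('h, 'n) monoid_scheme \<Rightarrow> 'h topology \<Rightarrow> bool"
  where "topological_group_isomorphic G \<tau> H \<sigma> \<longleftrightarrow>
    (\<exists>h. h \<in> iso G H \<and> homeomorphic_map \<tau> \<sigma> h)"

definition continuous_action ::
    "('g, 'm) monoid_scheme \<Rightarrow> 'g topology \<Rightarrow> 'x topology \<Rightarrow> ('g \<Rightarrow> 'x \<Rightarrow> 'x) \<Rightarrow> bool"
  where "continuous_action G \<tau> X \<phi> \<longleftrightarrow>
    group_action G (topspace X) \<phi> \<and>
    continuous_map (prod_topology \<tau> X) X (\<lambda>(g, x). \<phi> g x)"

text \<open>A definition cannot quantify over all types, so the compact spaces below live on the
  type \<^typ>\<open>'g set set\<close>, where \<^typ>\<open>'g\<close> is the type of the group elements. This is no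
  restriction: the closure of an orbit is an invariant compact subspace whose points are
  separated by the families of subsets of the group whose orbit accumulates at them.
  The lemma \<open>extremely_amenable_fixed_point\<close> derives the fixed point property for
  compact Hausdorff spaces on an arbitrary type.\<close>

definition extremely_amenable :: "('g, 'm) monoid_scheme \<Rightarrow> 'g topology \<Rightarrow> bool"
  where "extremely_amenable G \<tau> \<longleftrightarrow>
    (\<forall>(X :: 'g set set topology) \<phi>.
      compact_space X \<and> Hausdorff_space X \<and> topspace X \<noteq> {} \<and> continuous_action G \<tau> X \<phi> \<longrightarrow>
      (\<exists>x \<in> topspace X. \<forall>g \<in> carrier G. \<phi> g x = x))"

lemma continuous_action_translate:
  assumes "continuous_action G \<tau> X \<phi>" "topspace \<tau> = carrier G" "g \<in> carrier G"
  shows "continuous_map X X (\<phi> g)"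
proof -
  have "continuous_map X (prod_topology \<tau> X) (\<lambda>x. (g, x))"
    using assms by (simp add: continuous_map_pairwise o_def)
  then have "continuous_map X X ((\<lambda>(g, x). \<phi> g x) \<circ> (\<lambda>x. (g, x)))"
    using assms(1) continuous_map_compose unfolding continuous_action_def by blast
  then show ?thesis
    by (simp add: o_def)
qed

theorem extremely_amenable_fixed_point:
  fixes G :: "('g, 'm) monoid_scheme" and X :: "'x topology"
  assumes G: "topological_group G \<tau>" and ea: "extremely_amenable G \<tau>"
    and X: "compact_space X" "Hausdorff_space X" "topspace X \<noteq> {}"
    and act: "continuous_action G \<tau> X \<phi>"
  shows "\<exists>x \<in> topspace X. \<forall>g \<in> carrier G. \<phi> g x = x"
proof -
  interpret A: group_action G "topspace X" \<phi>
    using act by (simp add: continuous_action_def)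
  interpret G: group G
    using G by (simp add: topological_group_def)
  have ts: "topspace \<tau> = carrier G"
    using G by (simp add: topological_group_def)
  have closed: "\<phi> g x \<in> topspace X" if "g \<in> carrier G" "x \<in> topspace X" for g x
    using A.element_image that by blast
  have one: "\<phi> \<one>\<^bsub>G\<^esub> x = x" if "x \<in> topspace X" for x
    using that A.id_eq_one by (metis restrict_apply')
  obtain x0 where x0: "x0 \<in> topspace X"
    using X by blast
  define orb where "orb = (\<lambda>A. (\<lambda>g. \<phi> g x0) ` A)"
  define Y where "Y = X closure_of orb (carrier G)"
  have orbX: "orb (carrier G) \<subseteq> topspace X"
    using closed x0 by (auto simp: orb_def)
  have YX: "Y \<subseteq> topspace X"
    by (simp add: Y_def closure_of_subset_topspace)
  have x0Y: "x0 \<in> Y"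
  proof -
    have "x0 \<in> orb (carrier G)"
      using one[OF x0] unfolding orb_def by (metis G.one_closed image_eqI)
    then show ?thesis
      using closure_of_subset[OF orbX] by (auto simp: Y_def)
  qed
  have Yinv: "\<phi> g y \<in> Y" if g: "g \<in> carrier G" and y: "y \<in> Y" for g y
  proof -
    have "\<phi> g ` orb (carrier G) \<subseteq> orb (carrier G)"
    proof
      fix z assume "z \<in> \<phi> g ` orb (carrier G)"
      then obtain h where h: "h \<in> carrier G" "z = \<phi> g (\<phi> h x0)"
        by (auto simp: orb_def)
      then have "z = \<phi> (g \<otimes>\<^bsub>G\<^esub> h) x0"
        using A.composition_rule x0 g by simp
      then show "z \<in> orb (carrier G)"
        using h g by (auto simp: orb_def)
    qed
    moreover have "\<phi> g ` (X closure_of orb (carrier G)) \<subseteq> X closure_of (\<phi> g ` orb (carrier G))"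
      using continuous_action_translate[OF act ts g] by (rule continuous_map_image_closure_subset)
    ultimately show ?thesis
      using y closure_of_mono[of "\<phi> g ` orb (carrier G)" "orb (carrier G)" X]
      unfolding Y_def by (meson image_eqI subsetD)
  qed
  define e where "e = (\<lambda>y. {A. A \<subseteq> carrier G \<and> y \<in> X closure_of orb A})"
  have inj: "inj_on e Y"
  proof (rule inj_onI, rule ccontr)
    fix y z assume yz: "y \<in> Y" "z \<in> Y" "e y = e z" "y \<noteq> z"
    obtain U V where UV: "openin X U" "openin X V" "y \<in> U" "z \<in> V" "disjnt U V"
    proof -
      have "y \<in> topspace X" "z \<in> topspace X"
        using yz YX by auto
      then show thesis
        using X(2) yz(4) that unfolding Hausdorff_space_def by metis
    qed
    define A where "A = {g \<in> carrier G. \<phi> g x0 \<in> U}"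
    have "y \<in> X closure_of orb A"
      unfolding in_closure_of
    proof (intro conjI allI impI)
      show "y \<in> topspace X" using yz YX by auto
      fix T assume "y \<in> T \<and> openin X T"
      then have "y \<in> T \<inter> U" "openin X (T \<inter> U)"
        using UV by auto
      then obtain w where "w \<in> orb (carrier G)" "w \<in> T \<inter> U"
        using yz(1)[unfolded Y_def in_closure_of] by metis
      then show "\<exists>w. w \<in> orb A \<and> w \<in> T"
        by (auto simp: orb_def A_def)
    qed
    then have "A \<in> e z"
      using yz by (auto simp: e_def A_def)
    then have "z \<in> X closure_of orb A"
      by (simp add: e_def)
    then obtain w where "w \<in> orb A" "w \<in> V"
      using UV(2,4) unfolding in_closure_of by metis
    then show False
      using UV by (auto simp: orb_def A_def disjnt_iff)
  qed
  define d where "d = inv_into Y e"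
  have de: "d (e y) = y" if "y \<in> Y" for y
    using inj that by (simp add: d_def)
  define Z where "Z = subtopology X Y"
  have tZ: "topspace Z = Y"
    using YX by (auto simp: Z_def)
  define W where "W = pullback_topology (e ` Y) d Z"
  have tW: "topspace W = e ` Y"
    using de by (auto simp: W_def topspace_pullback_topology tZ)
  have cd: "continuous_map W Z d"
    unfolding continuous_map_def
  proof (intro conjI allI impI)
    show "d \<in> topspace W \<rightarrow> topspace Z"
      using de by (auto simp: tW tZ)
    fix U assume "openin Z U"
    moreover have "{w \<in> topspace W. d w \<in> U} = d -` U \<inter> e ` Y"
      by (auto simp: tW)
    ultimately show "openin W {w \<in> topspace W. d w \<in> U}"
      unfolding W_def openin_pullback_topology by blast
  qed
  have ce: "continuous_map Z W e"
    unfolding continuous_map_def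
  proof (intro conjI allI impI)
    show "e \<in> topspace Z \<rightarrow> topspace W"
      by (auto simp: tW tZ)
    fix U assume "openin W U"
    then obtain V where V: "openin Z V" "U = d -` V \<inter> e ` Y"
      unfolding W_def openin_pullback_topology by blast
    have "{y \<in> topspace Z. e y \<in> U} = V"
      using V de openin_subset[OF V(1)] by (auto simp: tZ)
    then show "openin Z {y \<in> topspace Z. e y \<in> U}"
      using V by simp
  qed
  have "homeomorphic_maps Z W e d"
    using cd ce de by (auto simp: homeomorphic_maps_def tZ tW)
  then have hom: "Z homeomorphic_space W"
    by (auto simp: homeomorphic_space_def)
  have "compact_space Z"
    unfolding Z_def Y_def using X(1)
    by (simp add: closedin_compact_space compact_space_subtopology)
  moreover have "Hausdorff_space Z"
    unfolding Z_def using X(2) by (simp add: Hausdorff_space_subtopology)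
  ultimately have W: "compact_space W" "Hausdorff_space W"
    using hom homeomorphic_compact_space homeomorphic_Hausdorff_space by blast+
  define \<psi> where "\<psi> = (\<lambda>g. \<lambda>w \<in> e ` Y. e (\<phi> g (d w)))"
  have \<psi>e: "\<psi> g (e y) = e (\<phi> g y)" if "y \<in> Y" for g y
    using that de by (simp add: \<psi>_def)
  have comp: "\<psi> (g \<otimes>\<^bsub>G\<^esub> h) w = \<psi> g (\<psi> h w)"
    if "g \<in> carrier G" "h \<in> carrier G" "w \<in> e ` Y" for g h w
    using that A.composition_rule YX Yinv by (auto simp: \<psi>e subset_iff)
  have id: "\<psi> \<one>\<^bsub>G\<^esub> w = w" if "w \<in> e ` Y" for w
    using that one YX by (auto simp: \<psi>e subset_iff)
  have maps: "\<psi> g w \<in> e ` Y" if "g \<in> carrier G" "w \<in> e ` Y" for g w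
    using that Yinv by (auto simp: \<psi>e)
  have Bij: "\<psi> g \<in> Bij (e ` Y)" if g: "g \<in> carrier G" for g
    unfolding Bij_def
  proof (intro IntI CollectI)
    show "\<psi> g \<in> extensional (e ` Y)"
      by (simp add: \<psi>_def)
    have "\<psi> g (\<psi> (inv\<^bsub>G\<^esub> g) w) = w" "\<psi> (inv\<^bsub>G\<^esub> g) (\<psi> g w) = w" if "w \<in> e ` Y" for w
      using comp[of g "inv\<^bsub>G\<^esub> g" w] comp[of "inv\<^bsub>G\<^esub> g" g w] g that id by auto
    then show "bij_betw (\<psi> g) (e ` Y) (e ` Y)"
      using maps g by (intro bij_betwI[where g = "\<psi> (inv\<^bsub>G\<^esub> g)"]) auto
  qed
  have "group_hom G (BijGroup (e ` Y)) \<psi>"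
  proof (intro group_hom.intro group_hom_axioms.intro)
    show "group G" ..
    show "group (BijGroup (e ` Y))"
      by (rule group_BijGroup)
    show "\<psi> \<in> hom G (BijGroup (e ` Y))"
    proof (rule homI)
      fix g h assume gh: "g \<in> carrier G" "h \<in> carrier G"
      show "\<psi> g \<in> carrier (BijGroup (e ` Y))"
        using Bij gh by (simp add: BijGroup_def)
      have "\<psi> (g \<otimes>\<^bsub>G\<^esub> h) = compose (e ` Y) (\<psi> g) (\<psi> h)"
      proof
        fix w show "\<psi> (g \<otimes>\<^bsub>G\<^esub> h) w = compose (e ` Y) (\<psi> g) (\<psi> h) w"
          using comp gh by (cases "w \<in> e ` Y") (auto simp: compose_def \<psi>_def)
      qed
      then show "\<psi> (g \<otimes>\<^bsub>G\<^esub> h) = \<psi> g \<otimes>\<^bsub>BijGroup (e ` Y)\<^esub> \<psi> h"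
        using gh Bij by (simp add: BijGroup_def)
    qed
  qed
  then have "group_action G (topspace W) \<psi>"
    by (simp add: tW group_action_def)
  moreover have "continuous_map (prod_topology \<tau> W) W (\<lambda>(g, w). \<psi> g w)"
  proof -
    have "continuous_map (prod_topology \<tau> W) (prod_topology \<tau> X) (\<lambda>p. (fst p, d (snd p)))"
    proof -
      have "continuous_map (prod_topology \<tau> W) X (\<lambda>p. d (snd p))"
        using continuous_map_compose[OF continuous_map_snd[of \<tau> W] cd]
        by (simp add: Z_def o_def continuous_map_in_subtopology)
      then show ?thesis
        by (simp add: continuous_map_pairwise o_def continuous_map_fst)
    qed
    then have "continuous_map (prod_topology \<tau> W) X
        ((\<lambda>(g, x). \<phi> g x) \<circ> (\<lambda>p. (fst p, d (snd p))))"
      using act continuous_map_compose unfolding continuous_action_def by blast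
    then have "continuous_map (prod_topology \<tau> W) X (\<lambda>p. \<phi> (fst p) (d (snd p)))"
      by (simp add: o_def)
    then have "continuous_map (prod_topology \<tau> W) Z (\<lambda>p. \<phi> (fst p) (d (snd p)))"
      using Yinv de by (auto simp: Z_def continuous_map_in_subtopology tW ts)
    from continuous_map_compose[OF this ce]
    have "continuous_map (prod_topology \<tau> W) W (\<lambda>p. e (\<phi> (fst p) (d (snd p))))"
      by (simp add: o_def)
    then show ?thesis
      by (rule continuous_map_eq) (auto simp: \<psi>_def tW)
  qed
  ultimately have "continuous_action G \<tau> W \<psi>"
    by (simp add: continuous_action_def)
  then obtain w where w: "w \<in> topspace W" "\<forall>g \<in> carrier G. \<psi> g w = w"
    using ea W x0Y tW unfolding extremely_amenable_def by blast
  then obtain y where y: "y \<in> Y" "w = e y"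
    by (auto simp: tW)
  have "\<phi> g y = y" if "g \<in> carrier G" for g
    using w(2) that y Yinv inj by (simp add: \<psi>e inj_on_eq_iff)
  then show ?thesis
    using y YX by blast
qed


section \<open>Semidirect products\<close>

text \<open>The continuity requirement is what makes the product topology on the semidirect product
  a group topology.\<close>

definition continuous_automorphism_action ::
    "('f, 'm) monoid_scheme \<Rightarrow> 'f topology \<Rightarrow> ('u, 'n) monoid_scheme \<Rightarrow> 'u topology \<Rightarrow>
      ('f \<Rightarrow> 'u \<Rightarrow> 'u) \<Rightarrow> bool"
  where "continuous_automorphism_action F \<sigma> U \<tau> \<phi> \<longleftrightarrow>
    \<phi> \<in> hom F (AutoGroup U) \<and>
    continuous_map (prod_topology \<sigma> \<tau>) \<tau> (\<lambda>(a, u). \<phi> a u)"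

definition semidirect_product ::
    "('u, 'm) monoid_scheme \<Rightarrow> ('f, 'n) monoid_scheme \<Rightarrow> ('f \<Rightarrow> 'u \<Rightarrow> 'u) \<Rightarrow> ('u \<times> 'f) monoid"
  where "semidirect_product U F \<phi> =
    \<lparr>carrier = carrier U \<times> carrier F,
     mult = (\<lambda>(u, a) (v, b). (u \<otimes>\<^bsub>U\<^esub> \<phi> a v, a \<otimes>\<^bsub>F\<^esub> b)),
     one = (\<one>\<^bsub>U\<^esub>, \<one>\<^bsub>F\<^esub>)\<rparr>"


section \<open>Homeomorphism groups\<close>

definition homeo_group :: "'a topology \<Rightarrow> ('a \<Rightarrow> 'a) monoid"
  where "homeo_group X =
    BijGroup (topspace X) \<lparr>carrier := {f \<in> Bij (topspace X). homeomorphic_map X X f}\<rparr>"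

text \<open>\<^const>\<open>Metric_space.fdist\<close> is the supremum metric on bounded functions; for compact
  spaces, as here, every homeomorphism is bounded.\<close>

definition homeo_group_topology :: "'a set \<Rightarrow> ('a \<Rightarrow> 'a \<Rightarrow> real) \<Rightarrow> ('a \<Rightarrow> 'a) topology"
  where "homeo_group_topology M d =
    Metric_space.mtopology (carrier (homeo_group (Metric_space.mtopology M d)))
      (Metric_space.fdist M d M)"

end

theory Submission
  imports Defs "HOL-Library.Ramsey" "HOL-Computational_Algebra.Primes"
begin

text \<open>
  The end point of the universal Knaster continuum lies on a dense path component that is a
  one-to-one image of a half-line. The proof moves the whole question to that half-line.

  \<^bold>\<open>Coordinates.\<close> An open self-map of the interval that fixes 0 is a standard tent map after an
  increasing change of variable (\<open>open_map_eq_tent\<close>). Changing the variable in one factor of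
  an inverse limit after the other, every Knaster continuum is described by a divisibility chain
  \<open>1 = D 0, D 1, D 2, \<dots>\<close> and coordinates \<open>p k\<close>, where \<open>p k\<close> is the tent map of degree
  \<open>D (k + 1) / D k\<close> applied to \<open>p (k + 1)\<close> (\<open>knaster_continuum_chain\<close>). If \<open>zigzag t\<close> is the
  distance of \<open>t\<close> to the even integers, the point \<open>ray t\<close> with coordinates \<open>zigzag (t / D k)\<close>
  runs through a dense set that starts at the end point \<open>ray 0\<close>. By compactness a real function on the
  continuum nearly factors through one coordinate (\<open>nearly_factors\<close>), so along the ray it is
  even and nearly periodic with period \<open>2 D k\<close>.

  \<^bold>\<open>Lifts.\<close> An open surjection \<open>f\<close> cannot have a local extremum along the line through a point
  (\<open>no_extremum\<close>). So it maps the end point to the end point (\<open>ray_0\<close>), and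
  \<open>f (ray t) = ray (A t)\<close> for an odd continuous map \<open>A\<close> of the real line that is monotone
  (\<open>lift_mono\<close>). Near periodicity of \<open>ray (A t)\<close> forces \<open>A\<close> to stay within a bounded
  distance of a linear map \<open>t \<mapsto> r t\<close> (\<open>lifts_slope\<close>), and \<open>r\<close> relates the two chains. Applied
  to an open surjection onto the Knaster continuum of the chain of factorials this shows that the
  universal continuum is the one where every positive integer divides some \<open>D k\<close>
  (\<open>universal_knaster_cofinal\<close>).

  \<^bold>\<open>The splitting.\<close> For the universal continuum, a homeomorphism is determined by its lift, and the
  slope of the lift is a homomorphism \<open>deg\<close> to the positive rationals. It is locally constant for
  the uniform topology (\<open>deg_locally_constant\<close>). Multiplication of the ray by a positive rational
  extends to the continuum (\<open>scaling_homeo\<close>), and the positive rationals are free abelian on the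
  primes; so \<open>deg\<close> is a split surjection onto a discrete free abelian group, and its kernel \<open>U\<close>
  is open. It is Polish because the homeomorphism group of a compact metric space is.

  \<^bold>\<open>Extreme amenability.\<close> A homeomorphism in \<open>U\<close> is a uniform limit of homeomorphisms that come
  from an increasing homeomorphism of a single factor, that is, whose lift commutes with
  translation by some \<open>2 D n\<close> (\<open>approximate_by_periodic\<close>). For increasing homeomorphisms of an
  interval, the position of the inverse images of a fine grid determines the homeomorphism up to
  a small left factor. Colouring finite subsets of the interval according to where the
  corresponding homeomorphisms move a base point, Ramsey's theorem produces a point that finitely
  many given group elements move only slightly. Compactness then gives a common fixed point
  (\<open>extremely_amenable_degree_one\<close>).
\<close>


section \<open>Zigzag maps and open maps of the interval\<close>

text \<open>The distance to the even integers. On the unit interval, \<open>\<lambda>x. zigzag (n * x)\<close> is the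
  standard tent map of degree \<open>n\<close>, so one function on the line serves for all tent maps.\<close>

definition zigzag :: "real \<Rightarrow> real"
  where "zigzag t = \<bar>t - 2 * of_int (round (t / 2))\<bar>"

lemma zigzag_nearest: "\<exists>i. zigzag t = \<bar>t - 2 * of_int i\<bar>"
  unfolding zigzag_def by blast

lemma zigzag_le: "zigzag t \<le> \<bar>t - 2 * of_int i\<bar>"
proof -
  have "\<bar>t / 2 - of_int (round (t / 2))\<bar> \<le> \<bar>t / 2 - of_int i\<bar>"
    by (rule round_diff_minimal)
  then show ?thesis
    unfolding zigzag_def by linarith
qed

lemma zigzag_bounds: "0 \<le> zigzag t" "zigzag t \<le> 1"
proof -
  show "0 \<le> zigzag t"
    by (simp add: zigzag_def)
  show "zigzag t \<le> 1"
    using of_int_round_abs_le[of "t / 2"] unfolding zigzag_def by linarith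
qed

lemma zigzag_eqI: "\<bar>t - 2 * of_int i\<bar> \<le> 1 \<Longrightarrow> zigzag t = \<bar>t - 2 * of_int i\<bar>"
proof -
  assume a: "\<bar>t - 2 * of_int i\<bar> \<le> 1"
  obtain k where k: "zigzag t = \<bar>t - 2 * of_int k\<bar>"
    using zigzag_nearest by blast
  show ?thesis
  proof (cases "k = i")
    case False
    then have "\<bar>real_of_int k - of_int i\<bar> \<ge> 1"
      by linarith
    then have "\<bar>t - 2 * of_int k\<bar> \<ge> 1" using a by linarith
    then show ?thesis using a k zigzag_le[of t i] by linarith
  qed (use k in simp)
qed

lemma zigzag_unit: "0 \<le> t \<Longrightarrow> t \<le> 1 \<Longrightarrow> zigzag t = t"
  using zigzag_eqI[of t 0] by simp

lemma zigzag_eq_iff: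
  "zigzag s = zigzag t \<longleftrightarrow> (\<exists>i::int. s = t + 2 * of_int i \<or> s = - t + 2 * of_int i)"
proof
  obtain k where k: "zigzag t = \<bar>t - 2 * of_int k\<bar>"
    using zigzag_nearest by blast
  {
    assume "zigzag s = zigzag t"
    moreover obtain j where j: "zigzag s = \<bar>s - 2 * of_int j\<bar>"
      using zigzag_nearest by blast
    ultimately have "s = t + 2 * of_int (j - k) \<or> s = - t + 2 * of_int (j + k)"
      using k by auto
    then show "\<exists>i::int. s = t + 2 * of_int i \<or> s = - t + 2 * of_int i"
      by blast
  next
    assume "\<exists>i::int. s = t + 2 * of_int i \<or> s = - t + 2 * of_int i"
    then obtain i :: int where "s = t + 2 * of_int i \<or> s = - t + 2 * of_int i"
      by blast
    then have "\<exists>j. \<bar>s - 2 * of_int j\<bar> = \<bar>t - 2 * of_int k\<bar>"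
    proof
      assume "s = t + 2 * of_int i"
      then have "\<bar>s - 2 * of_int (k + i)\<bar> = \<bar>t - 2 * of_int k\<bar>" by simp
      then show ?thesis by blast
    next
      assume "s = - t + 2 * of_int i"
      then have "\<bar>s - 2 * of_int (i - k)\<bar> = \<bar>t - 2 * of_int k\<bar>" by simp
      then show ?thesis by blast
    qed
    then show "zigzag s = zigzag t"
      using zigzag_eqI k zigzag_bounds(2)[of t] by metis
  }
qed

lemma zigzag_shift [simp]: "zigzag (t + 2 * of_int i) = zigzag t"
  and zigzag_minus [simp]: "zigzag (- t) = zigzag t"
  by (auto simp: zigzag_eq_iff intro: exI[of _ 0])

lemma zigzag_0 [simp]: "zigzag 0 = 0" and zigzag_1 [simp]: "zigzag 1 = 1"
  by (auto simp: zigzag_unit)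

lemma zigzag_Lipschitz: "\<bar>zigzag s - zigzag t\<bar> \<le> \<bar>s - t\<bar>"
proof -
  have "zigzag s \<le> zigzag t + \<bar>s - t\<bar>" for s t
  proof -
    obtain i where "zigzag t = \<bar>t - 2 * of_int i\<bar>"
      using zigzag_nearest by blast
    then show ?thesis using zigzag_le[of s i] by linarith
  qed
  from this[of s t] this[of t s] show ?thesis by linarith
qed

lemma continuous_on_zigzag: "continuous_on A zigzag"
proof -
  have "uniformly_continuous_on A zigzag"
    unfolding uniformly_continuous_on_def dist_real_def
    using zigzag_Lipschitz by (metis order_le_less_trans)
  then show ?thesis
    by (rule uniformly_continuous_imp_continuous)
qed

lemma continuous_on_zigzag_compose [continuous_intros]:
  "continuous_on A f \<Longrightarrow> continuous_on A (\<lambda>x. zigzag (f x))"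
  using continuous_on_compose2[OF continuous_on_zigzag[of UNIV]] by blast

text \<open>Multiplication by an integer respects the sign changes and even translations that
  \<open>zigzag\<close> forgets; this is why tent maps commute and their degrees multiply.\<close>

lemma zigzag_mult: "zigzag (of_int j * zigzag t) = zigzag (of_int j * t)"
proof -
  obtain i where i: "zigzag t = \<bar>t - 2 * of_int i\<bar>"
    using zigzag_nearest by blast
  have "of_int j * \<bar>t - 2 * of_int i\<bar> = of_int j * t + 2 * of_int (- j * i) \<or>
        of_int j * \<bar>t - 2 * of_int i\<bar> = - (of_int j * t) + 2 * of_int (j * i)"
    by (simp add: abs_if algebra_simps)
  then show ?thesis
    unfolding zigzag_eq_iff i by blast
qed

lemma zigzag_mult_nat: "zigzag (of_nat j * zigzag t) = zigzag (of_nat j * t)"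
  using zigzag_mult[of "int j"] by simp

text \<open>Closeness on the interval lifts to closeness on the line up to an even translation and
  a sign.\<close>

lemma zigzag_close:
  assumes "\<bar>zigzag s - zigzag t\<bar> < \<epsilon>"
  shows "\<exists>i::int. \<bar>s - t - 2 * of_int i\<bar> < \<epsilon> \<or> \<bar>s + t - 2 * of_int i\<bar> < \<epsilon>"
proof -
  obtain i k where ik: "zigzag s = \<bar>s - 2 * of_int i\<bar>" "zigzag t = \<bar>t - 2 * of_int k\<bar>"
    using zigzag_nearest by metis
  have "\<bar>x - y\<bar> < \<epsilon> \<or> \<bar>x + y\<bar> < \<epsilon>" if "\<bar>\<bar>x\<bar> - \<bar>y\<bar>\<bar> < \<epsilon>" for x y :: real
    using that by linarith
  from this[of "s - 2 * of_int i" "t - 2 * of_int k"]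
  have "\<bar>s - t - 2 * of_int (i - k)\<bar> < \<epsilon> \<or> \<bar>s + t - 2 * of_int (i + k)\<bar> < \<epsilon>"
    using assms unfolding ik of_int_diff of_int_add by (simp add: algebra_simps)
  then show ?thesis by blast
qed

lemma zigzag_small: "zigzag s < \<epsilon> \<Longrightarrow> \<exists>i::int. \<bar>s - 2 * of_int i\<bar> < \<epsilon>"
  using zigzag_nearest[of s] by metis

lemma zigzag_int: "zigzag (of_int i) = (if even i then 0 else 1)"
proof (cases "even i")
  case True
  then obtain j where "i = 2 * j" by blast
  then show ?thesis using zigzag_eqI[of "of_int i" j] by simp
next
  case False
  then obtain j where "i = 2 * j + 1" using oddE by blast
  then show ?thesis using zigzag_eqI[of "of_int i" j] by simp
qed

lemma zigzag_nat: "zigzag (of_nat i) = (if even i then 0 else 1)"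
  using zigzag_int[of "int i"] by simp

lemma zigzag_nat_add:
  assumes "0 \<le> s" "s \<le> 1"
  shows "zigzag (of_nat k + s) = \<bar>s - zigzag (of_nat k)\<bar>"
proof (cases "even k")
  case True
  then obtain j where "k = 2 * j" by blast
  then show ?thesis using zigzag_eqI[of "of_nat k + s" "int j"] assms zigzag_nat[of k]
    by simp
next
  case False
  then obtain j where "k = 2 * j + 1" using oddE by blast
  then show ?thesis using zigzag_eqI[of "of_nat k + s" "int j + 1"] assms zigzag_nat[of k]
    by simp
qed

definition has_no_local_extremum :: "(real \<Rightarrow> real) \<Rightarrow> bool"
  where "has_no_local_extremum \<phi> \<longleftrightarrow>
    (\<forall>J x. openin unit_interval J \<and> x \<in> J \<longrightarrow>
      (\<phi> x < 1 \<longrightarrow> (\<exists>y\<in>J. \<phi> y > \<phi> x)) \<and> (\<phi> x > 0 \<longrightarrow> (\<exists>y\<in>J. \<phi> y < \<phi> x)))"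

text \<open>The image of an open set is open in the interval, and an open subset of the interval
  can contain its maximum only if that is 1, its minimum only if that is 0.\<close>

lemma open_map_no_local_extremum:
  assumes "continuous_map unit_interval unit_interval f" "open_map unit_interval unit_interval f"
  shows "has_no_local_extremum f"
  unfolding has_no_local_extremum_def
proof (intro allI impI)
  fix J x
  assume J: "openin unit_interval J \<and> x \<in> J"
  then have "openin unit_interval (f ` J)" "f x \<in> f ` J"
    using assms(2) by (auto simp: open_map_def)
  then have "f x \<in> {0..1}" and
    "\<exists>e>0. \<forall>v\<in>{0..1}. dist v (f x) < e \<longrightarrow> v \<in> f ` J"
    unfolding openin_euclidean_subtopology_iff by blast+
  then obtain e where fx: "0 \<le> f x" "f x \<le> 1" and e: "e > 0"
    "\<And>v. 0 \<le> v \<Longrightarrow> v \<le> 1 \<Longrightarrow> \<bar>v - f x\<bar> < e \<Longrightarrow> v \<in> f ` J"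
    by (auto simp: dist_real_def)
  show "(f x < 1 \<longrightarrow> (\<exists>y\<in>J. f y > f x)) \<and> (f x > 0 \<longrightarrow> (\<exists>y\<in>J. f y < f x))"
  proof (intro conjI impI)
    assume "f x < 1"
    then have "min 1 (f x + e / 2) \<in> f ` J"
      using e fx by (intro e(2)) (auto simp: min_def)
    then obtain y where "y \<in> J" "f y = min 1 (f x + e / 2)" by force
    then show "\<exists>y\<in>J. f y > f x"
      using e(1) \<open>f x < 1\<close> by (intro bexI[of _ y]) auto
  next
    assume "f x > 0"
    then have "max 0 (f x - e / 2) \<in> f ` J"
      using e fx by (intro e(2)) (auto simp: max_def)
    then obtain y where "y \<in> J" "f y = max 0 (f x - e / 2)" by force
    then show "\<exists>y\<in>J. f y < f x"
      using e(1) \<open>f x > 0\<close> by (intro bexI[of _ y]) auto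
  qed
qed

lemma openin_unit_Ioo: "0 \<le> a \<Longrightarrow> b \<le> 1 \<Longrightarrow> openin unit_interval {a<..<b::real}"
proof -
  assume "0 \<le> a" "b \<le> 1"
  then have "{a<..<b} = {0..1} \<inter> {a<..<b}" by auto
  then show ?thesis by (metis open_greaterThanLessThan openin_open_Int)
qed

lemma openin_unit_Ioc:
  assumes "0 \<le> a" shows "openin unit_interval {a<..1::real}"
proof -
  have "{a<..1} = {0..1} \<inter> {a<..}" using assms by auto
  then show ?thesis by (metis open_greaterThan openin_open_Int)
qed

text \<open>Take the first point \<open>t'\<close> after \<open>t\<close> with value 1; it exists because otherwise the maximum to
  the right of \<open>t\<close> would be a local maximum below 1. A failure of monotonicity before \<open>t'\<close> would
  produce a local minimum with positive value or a local maximum with value below 1.\<close>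

lemma first_rise:
  assumes cont: "continuous_on {0..1} \<phi>" and rng: "\<And>x. x \<in> {0..1} \<Longrightarrow> 0 \<le> \<phi> x \<and> \<phi> x \<le> 1"
    and ext: "has_no_local_extremum \<phi>" and t: "0 \<le> t" "t < 1" "\<phi> t = 0"
  shows "\<exists>t'. t < t' \<and> t' \<le> 1 \<and> \<phi> t' = 1 \<and> strict_mono_on {t..t'} \<phi>"
proof -
  have up: "\<exists>y\<in>J. \<phi> y > \<phi> x" if "openin unit_interval J" "x \<in> J" "\<phi> x < 1" for J x
    using ext that unfolding has_no_local_extremum_def by blast
  have down: "\<exists>y\<in>J. \<phi> y < \<phi> x" if "openin unit_interval J" "x \<in> J" "\<phi> x > 0" for J x
    using ext that unfolding has_no_local_extremum_def by blast
  have contI: "continuous_on {a..b} \<phi>" if "0 \<le> a" "b \<le> 1" for a b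
    using cont continuous_on_subset that by (metis atLeastatMost_subset_iff)
  define S where "S = {x \<in> {t..1}. \<phi> x = 1}"
  have "S \<noteq> {}"
  proof
    assume S: "S = {}"
    obtain x where x: "x \<in> {t..1}" "\<And>y. y \<in> {t..1} \<Longrightarrow> \<phi> y \<le> \<phi> x"
      using continuous_attains_sup[of "{t..1}" \<phi>] contI[of t 1] t by auto
    define z where "z = (if x = t then 1 else x)"
    have z: "z \<in> {t<..1}" using x t by (auto simp: z_def)
    have "\<phi> z = \<phi> x"
    proof (cases "x = t")
      case True
      then have "\<phi> 1 \<le> 0" "\<phi> 1 \<ge> 0" using x(2)[of 1] t rng[of 1] by auto
      then show ?thesis using True t z_def by auto
    qed (simp add: z_def)
    moreover have "\<phi> z < 1" using z S rng[of z] t unfolding S_def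
      by (smt (verit, best) atLeastAtMost_iff empty_iff greaterThanAtMost_iff mem_Collect_eq)
    ultimately obtain y where "y \<in> {t<..1}" "\<phi> y > \<phi> z"
      using up[OF openin_unit_Ioc[of t], of z] z t by blast
    then show False
      using x(2)[of y] \<open>\<phi> z = \<phi> x\<close> by auto
  qed
  have "closed S"
  proof -
    have "S = {t..1} \<inter> \<phi> -` {1}" by (auto simp: S_def)
    moreover have "closed ({t..1} \<inter> \<phi> -` {1})"
      using contI[of t 1] t by (intro continuous_closed_preimage) auto
    ultimately show ?thesis by simp
  qed
  moreover have "bounded S"
    unfolding S_def by (rule bounded_subset[OF bounded_closed_interval[of t 1]]) auto
  ultimately have "compact S"
    by (simp add: compact_eq_bounded_closed)
  from compact_attains_inf[OF this \<open>S \<noteq> {}\<close>]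
  obtain t' where t': "t' \<in> S" "\<And>s. s \<in> S \<Longrightarrow> t' \<le> s"
    by blast
  have tt': "t < t'" "t' \<le> 1" "\<phi> t' = 1"
  proof -
    have t'S: "t \<le> t'" "t' \<le> 1" "\<phi> t' = 1" using t'(1) by (simp_all add: S_def)
    moreover have "t \<noteq> t'" using t'S(3) t(3) by force
    ultimately show "t < t'" "t' \<le> 1" "\<phi> t' = 1" by linarith+
  qed
  have below: "\<phi> x < 1" if "x \<in> {t..<t'}" for x
  proof -
    have "x \<notin> S" using t'(2)[of x] that by force
    then have "\<phi> x \<noteq> 1" using that tt' by (simp add: S_def)
    moreover have "\<phi> x \<le> 1" using rng[of x] that tt' t by simp
    ultimately show ?thesis by simp
  qed
  have pos: "\<phi> z > 0" if z: "t < z" "z \<le> t'" for z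
  proof (rule ccontr)
    assume "\<not> 0 < \<phi> z"
    then have z0: "\<phi> z = 0" using rng[of z] z tt' t by auto
    have "z \<noteq> t'" using z0 tt' by auto
    then have "z < t'" using z by auto
    obtain w where w: "w \<in> {t..z}" "\<And>y. y \<in> {t..z} \<Longrightarrow> \<phi> y \<le> \<phi> w"
      using continuous_attains_sup[of "{t..z}" \<phi>] contI[of t z] t tt' z by auto
    \<comment> \<open>If the maximum is attained at an end, where \<open>\<phi>\<close> vanishes, then \<open>\<phi>\<close> vanishes on the whole
    interval and the midpoint is an interior maximum.\<close>
    define v where "v = (if w = t \<or> w = z then (t + z) / 2 else w)"
    have v: "v \<in> {t<..<z}" using w z by (auto simp: v_def)
    then have "\<phi> v = \<phi> w"
      using w(2)[of v] rng[of v] z0 t tt' z by (auto simp: v_def split: if_splits)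
    moreover have "\<phi> v < 1" using below[of v] v \<open>z < t'\<close> by auto
    ultimately obtain y where "y \<in> {t<..<z}" "\<phi> y > \<phi> v"
      using up[OF openin_unit_Ioo[of t z], of v] v t tt' z by auto
    then show False
      using w(2)[of y] \<open>\<phi> v = \<phi> w\<close> by auto
  qed
  have "\<phi> x < \<phi> y" if xy: "x \<in> {t..t'}" "y \<in> {t..t'}" "x < y" for x y
  proof (rule ccontr)
    assume neg: "\<not> \<phi> x < \<phi> y"
    then have "y \<noteq> t'" using below[of x] xy tt' by auto
    then have yt: "y < t'" using xy by auto
    obtain z where z: "z \<in> {x..t'}" "\<And>w. w \<in> {x..t'} \<Longrightarrow> \<phi> z \<le> \<phi> w"
      using continuous_attains_inf[of "{x..t'}" \<phi>] contI[of x t'] t tt' xy by auto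
    \<comment> \<open>By assumption \<open>\<phi> y \<le> \<phi> x\<close>, so a minimum at the left end \<open>x\<close> is also attained at \<open>y\<close>.\<close>
    define v where "v = (if z = x then y else z)"
    have "\<phi> z < 1" using z(2)[of y] below[of y] yt xy by auto
    then have "z \<noteq> t'" using tt' by auto
    then have v: "v \<in> {x<..<t'}" using z xy yt by (auto simp: v_def)
    have vz: "\<phi> v = \<phi> z" using z(2)[of y] neg xy by (auto simp: v_def)
    have "\<phi> v > 0" using pos[of v] v xy by auto
    then obtain y' where "y' \<in> {x<..<t'}" "\<phi> y' < \<phi> v"
      using down[OF openin_unit_Ioo[of x t'], of v] v xy t tt' by auto
    then show False
      using z(2)[of y'] vz by auto
  qed
  then have "strict_mono_on {t..t'} \<phi>"
    by (auto simp: strict_mono_on_def)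
  then show ?thesis using tt' by blast
qed

text \<open>An open map climbs from one end of the range to the other along monotone pieces. Each piece
  has length at least \<open>\<delta>\<close> by uniform continuity, so finitely many pieces exhaust the interval, and
  straightening the reflections turns them into one increasing function.\<close>

lemma lift_from:
  assumes cont: "continuous_on {0..1} f" and rng: "\<And>x. x \<in> {0..1} \<Longrightarrow> 0 \<le> f x \<and> f x \<le> 1"
    and ext: "has_no_local_extremum f"
    and \<delta>: "\<delta> > 0" "\<And>x y. x \<in> {0..1} \<Longrightarrow> y \<in> {0..1} \<Longrightarrow> \<bar>x - y\<bar> < \<delta> \<Longrightarrow> \<bar>f x - f y\<bar> < 1"
  shows "0 \<le> t \<Longrightarrow> t \<le> 1 \<Longrightarrow> f t = zigzag (of_nat k) \<Longrightarrow> 1 - t < of_nat r * \<delta> \<Longrightarrow>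
    \<exists>n h. continuous_on {t..1} h \<and> strict_mono_on {t..1} h \<and> h t = of_nat k \<and>
      h 1 = of_nat n \<and> (\<forall>x\<in>{t..1}. f x = zigzag (h x))"
proof (induction r arbitrary: t k)
  case (Suc r)
  show ?case
  proof (cases "t = 1")
    case True
    then show ?thesis
      using Suc.prems by (intro exI[of _ k] exI[of _ "\<lambda>_. of_nat k"]) (auto simp: strict_mono_on_def)
  next
    case False
    \<comment> \<open>Measured from the current end of the range, so that upward and downward pieces are alike.\<close>
    define \<phi> where "\<phi> x = \<bar>f x - zigzag (of_nat k)\<bar>" for x
    have \<phi>01: "\<phi> x = (if even k then f x else 1 - f x)" if "x \<in> {0..1}" for x
      using rng[OF that] by (simp add: \<phi>_def zigzag_nat)
    have "continuous_on {0..1} \<phi>"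
      unfolding \<phi>_def by (intro continuous_intros cont)
    moreover have "0 \<le> \<phi> x \<and> \<phi> x \<le> 1" if "x \<in> {0..1}" for x
      using rng[OF that] \<phi>01[OF that] by simp
    moreover have "has_no_local_extremum \<phi>"
      unfolding has_no_local_extremum_def
    proof (intro allI impI)
      fix J x assume J: "openin unit_interval J \<and> x \<in> J"
      then have sub: "J \<subseteq> {0..1}" using openin_subset[of unit_interval J] by simp
      have e: "f x < 1 \<Longrightarrow> \<exists>y\<in>J. f y > f x" "f x > 0 \<Longrightarrow> \<exists>y\<in>J. f y < f x"
        using J ext[unfolded has_no_local_extremum_def, rule_format, of J x] by simp_all
      have x: "x \<in> {0..1}" using J sub by blast
      show "(\<phi> x < 1 \<longrightarrow> (\<exists>y\<in>J. \<phi> y > \<phi> x)) \<and> (\<phi> x > 0 \<longrightarrow> (\<exists>y\<in>J. \<phi> y < \<phi> x))"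
      proof (intro conjI impI)
        assume "\<phi> x < 1"
        then obtain y where "y \<in> J" "if even k then f y > f x else f y < f x"
          using e \<phi>01[OF x] by (cases "even k") auto
        then show "\<exists>y\<in>J. \<phi> y > \<phi> x"
          using \<phi>01[OF x] \<phi>01[of y] sub by (intro bexI[of _ y]) (auto split: if_splits)
      next
        assume "\<phi> x > 0"
        then obtain y where "y \<in> J" "if even k then f y < f x else f y > f x"
          using e \<phi>01[OF x] by (cases "even k") auto
        then show "\<exists>y\<in>J. \<phi> y < \<phi> x"
          using \<phi>01[OF x] \<phi>01[of y] sub by (intro bexI[of _ y]) (auto split: if_splits)
      qed
    qed
    moreover have "\<phi> t = 0" using Suc.prems by (simp add: \<phi>_def)
    ultimately obtain t' where t': "t < t'" "t' \<le> 1" "\<phi> t' = 1" "strict_mono_on {t..t'} \<phi>"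
      using first_rise[of \<phi> t] Suc.prems False by auto
    have ft': "f t' = zigzag (of_nat (Suc k))"
      using \<phi>01[of t'] t' Suc.prems by (auto simp: zigzag_nat simp del: of_nat_Suc split: if_splits)
    then have "\<bar>f t - f t'\<bar> = 1"
      using Suc.prems by (auto simp: zigzag_nat simp del: of_nat_Suc)
    then have "t' - t \<ge> \<delta>"
      using \<delta>(2)[of t t'] t' Suc.prems by fastforce
    then have "1 - t' < of_nat r * \<delta>"
      using Suc.prems(4) by (simp add: algebra_simps)
    then obtain n h where h: "continuous_on {t'..1} h" "strict_mono_on {t'..1} h"
      "h t' = of_nat (Suc k)" "h 1 = of_nat n" "\<forall>x\<in>{t'..1}. f x = zigzag (h x)"
      using Suc.IH[of t' "Suc k"] t' Suc.prems ft' by auto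
    define g where "g x = (if x \<le> t' then of_nat k + \<phi> x else h x)" for x
    have "continuous_on ({t..t'} \<union> {t'..1}) g"
      unfolding g_def
    proof (rule continuous_on_cases)
      show "continuous_on {t..t'} (\<lambda>x. of_nat k + \<phi> x)"
        unfolding \<phi>_def using cont continuous_on_subset[OF cont, of "{t..t'}"] t' Suc.prems
        by (intro continuous_intros) auto
    qed (use h t' in auto)
    moreover have "{t..t'} \<union> {t'..1} = {t..1}" using t' by auto
    moreover have "g x < g y" if xy: "x \<in> {t..1}" "y \<in> {t..1}" "x < y" for x y
    proof -
      have l: "x \<le> t' \<Longrightarrow> g x \<le> of_nat k + 1" "x < t' \<Longrightarrow> g x < of_nat k + 1" if "x \<in> {t..1}" for x
        using that t' strict_mono_onD[OF t'(4), of x t'] by (cases "x = t'"; auto simp: g_def)+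
      have u: "t' < y \<Longrightarrow> g y > of_nat k + 1" if "y \<in> {t..1}" for y
        using that t' strict_mono_onD[OF h(2), of t' y] h(3) by (auto simp: g_def)
      consider "y \<le> t'" | "x \<le> t'" "t' < y" | "t' < x" by linarith
      then show ?thesis
      proof cases
        case 1
        then show ?thesis using strict_mono_onD[OF t'(4), of x y] xy by (auto simp: g_def)
      next
        case 2
        then show ?thesis using l[of x] u[of y] xy by auto
      next
        case 3
        then show ?thesis using strict_mono_onD[OF h(2), of x y] xy by (auto simp: g_def)
      qed
    qed
    moreover have "f x = zigzag (g x)" if x: "x \<in> {t..1}" for x
    proof (cases "x \<le> t'")
      case True
      have "x \<in> {0..1}" using x Suc.prems by auto
      then have "\<phi> x = (if even k then f x else 1 - f x)" "0 \<le> \<phi> x" "\<phi> x \<le> 1"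
        using \<phi>01[of x] rng[of x] by auto
      then show ?thesis
        using True zigzag_nat_add[of "\<phi> x" k] rng[OF \<open>x \<in> {0..1}\<close>]
        by (auto simp: g_def zigzag_nat split: if_splits)
    qed (use h x in \<open>auto simp: g_def\<close>)
    moreover have "g t = of_nat k" using t' \<open>\<phi> t = 0\<close> by (simp add: g_def)
    moreover have "g 1 = of_nat n" using t' h by (auto simp: g_def)
    ultimately show ?thesis
      by (intro exI[of _ n] exI[of _ g]) (auto simp: strict_mono_on_def)
  qed
qed auto

definition increasing_homeo :: "(real \<Rightarrow> real) \<Rightarrow> bool"
  where "increasing_homeo g \<longleftrightarrow>
    continuous_on {0..1} g \<and> strict_mono_on {0..1} g \<and> g 0 = 0 \<and> g 1 = 1"

lemma increasing_homeo_image: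
  assumes "increasing_homeo g" shows "g ` {0..1} = {0..1}"
proof
  have mono: "g x \<le> g y" if "x \<in> {0..1}" "y \<in> {0..1}" "x \<le> y" for x y
    using that assms unfolding increasing_homeo_def strict_mono_on_def by (metis order_le_less)
  show "g ` {0..1} \<subseteq> {0..1}"
    using mono[of 0] mono[of _ 1] assms unfolding increasing_homeo_def by auto
  show "{0..1} \<subseteq> g ` {0..1}"
  proof
    fix y :: real assume "y \<in> {0..1}"
    then have "\<exists>x\<ge>0. x \<le> 1 \<and> g x = y"
      using assms unfolding increasing_homeo_def by (intro IVT') auto
    then show "y \<in> g ` {0..1}" by force
  qed
qed

lemma increasing_homeo_inj: "increasing_homeo g \<Longrightarrow> inj_on g {0..1}"
  unfolding increasing_homeo_def using strict_mono_on_imp_inj_on by blast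

lemma increasing_homeo_homeomorphic_map:
  assumes "increasing_homeo g" shows "homeomorphic_map unit_interval unit_interval g"
proof (rule continuous_imp_homeomorphic_map)
  show "continuous_map unit_interval unit_interval g"
    using assms increasing_homeo_image[OF assms] unfolding increasing_homeo_def
    by (auto simp: continuous_map_subtopology_eu)
qed (use increasing_homeo_image[OF assms] increasing_homeo_inj[OF assms] in
     \<open>auto simp: compact_space_subtopology Hausdorff_space_subtopology\<close>)

text \<open>The normal form of the bonding maps: \<open>n\<close> is the number of monotone pieces and \<open>g\<close> is the
  straightened map divided by \<open>n\<close>.\<close>

lemma open_map_eq_tent:
  assumes f: "continuous_map unit_interval unit_interval f" "open_map unit_interval unit_interval f"
    and f0: "f 0 = 0"
  shows "\<exists>n g. n > 0 \<and> increasing_homeo g \<and> (\<forall>x\<in>{0..1}. f x = zigzag (of_nat n * g x))"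
proof -
  have cont: "continuous_on {0..1} f" and rng: "0 \<le> f x \<and> f x \<le> 1" if "x \<in> {0..1}" for x
    using f(1) that by (auto simp: continuous_map_subtopology_eu)
  then have "uniformly_continuous_on {0..1} f"
    using compact_uniformly_continuous[of "{0..1}" f] cont[of 0] by auto
  then obtain \<delta> where \<delta>: "\<delta> > 0" "\<And>x y. x \<in> {0..1} \<Longrightarrow> y \<in> {0..1} \<Longrightarrow> \<bar>x - y\<bar> < \<delta> \<Longrightarrow> \<bar>f x - f y\<bar> < 1"
    unfolding uniformly_continuous_on_def dist_real_def by (metis abs_minus_commute zero_less_one)
  obtain r :: nat where "1 < of_nat r * \<delta>"
    using reals_Archimedean3[OF \<delta>(1)] by blast
  then obtain n h where h: "continuous_on {0..1} h" "strict_mono_on {0..1} h" "h 0 = 0"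
    "h 1 = of_nat n" "\<forall>x\<in>{0..1}. f x = zigzag (h x)"
    using lift_from[OF cont[of 0] rng open_map_no_local_extremum[OF f] \<delta>, of 0 0 r] f0 by auto
  have n: "n > 0"
    using strict_mono_onD[OF h(2), of 0 1] h by auto
  have "increasing_homeo (\<lambda>x. h x / of_nat n)"
    unfolding increasing_homeo_def
    using h n by (auto intro!: continuous_intros simp: strict_mono_on_def divide_strict_right_mono)
  then show ?thesis
    using h(5) n by (intro exI[of _ n] exI[of _ "\<lambda>x. h x / of_nat n"]) auto
qed


section \<open>Divisibility chains and the ray\<close>

lemma compactin_increasing_cover:
  assumes "compactin Z S" "\<And>k::nat. openin Z (A k)" "\<And>k. A k \<subseteq> A (Suc k)" "S \<subseteq> (\<Union>k. A k)"
  shows "\<exists>k. S \<subseteq> A k"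
proof -
  obtain \<F> where F: "finite \<F>" "\<F> \<subseteq> range A" "S \<subseteq> \<Union>\<F>"
    using assms(1,2,4) unfolding compactin_def by (metis (no_types, lifting) imageE)
  obtain I where I: "finite I" "\<F> = A ` I"
    using F finite_subset_image by metis
  have mono: "A i \<subseteq> A j" if "i \<le> j" for i j
    using that assms(3) by (metis lift_Suc_mono_le)
  obtain n where "\<forall>i\<in>I. i \<le> n"
    using I(1) finite_nat_set_iff_bounded_le by blast
  then have "S \<subseteq> A n"
    using F(3) I mono by blast
  then show ?thesis by blast
qed

lemma compactin_real_image:
  assumes "compactin X S" "continuous_map X euclideanreal g"
  shows "compact (g ` S)"
  using image_compactin[OF assms] by simp

lemma continuous_map_attains_sup:
  assumes "compactin X S" "S \<noteq> {}" "continuous_map X euclideanreal g"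
  shows "\<exists>x\<in>S. \<forall>y\<in>S. g y \<le> (g x :: real)"
  using compact_attains_sup[OF compactin_real_image[OF assms(1,3)]] assms(2) by auto

text \<open>The inverse limit of tent maps of degrees \<open>D (k + 1) / D k\<close>, described by its coordinate
  functions on an arbitrary compact space. In this way the same facts apply to an abstract metric
  space and to a concrete space of sequences.\<close>

locale knaster_chain =
  fixes X :: "'a topology" and D :: "nat \<Rightarrow> nat" and p :: "nat \<Rightarrow> 'a \<Rightarrow> real"
  assumes compact: "compact_space X"
    and D_0: "D 0 = 1" and D_dvd_Suc: "D k dvd D (Suc k)" and D_pos: "0 < D k"
    and p_continuous: "continuous_map X euclideanreal (p k)"
    and p_range: "x \<in> topspace X \<Longrightarrow> p k x \<in> {0..1}"
    and p_Suc: "x \<in> topspace X \<Longrightarrow> p k x = zigzag (real (D (Suc k) div D k) * p (Suc k) x)"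
    and p_inj: "\<lbrakk>x \<in> topspace X; y \<in> topspace X; \<And>k. p k x = p k y\<rbrakk> \<Longrightarrow> x = y"
    and p_surj: "\<lbrakk>\<And>k. c k \<in> {0..1}; \<And>k. c k = zigzag (real (D (Suc k) div D k) * c (Suc k))\<rbrakk>
      \<Longrightarrow> \<exists>x\<in>topspace X. \<forall>k. p k x = c k"
begin

lemma D_dvd: "j \<le> k \<Longrightarrow> D j dvd D k"
proof (induction k rule: dec_induct)
  case (step n)
  from step.IH D_dvd_Suc[of n] show ?case
    by (rule dvd_trans)
qed simp

lemma D_mono: "j \<le> k \<Longrightarrow> D j \<le> D k"
  using D_dvd D_pos dvd_imp_le by blast

lemma real_D_div: "j \<le> k \<Longrightarrow> real (D k div D j) = D k / D j"
  using D_dvd real_of_nat_div by blast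

lemma p_le:
  assumes "x \<in> topspace X" "j \<le> k"
  shows "p j x = zigzag (D k / D j * p k x)"
  using assms(2)
proof (induction k rule: dec_induct)
  case base
  then show ?case
    using p_range[OF assms(1), of j] D_pos[of j] by (simp add: zigzag_unit)
next
  case (step n)
  have "p j x = zigzag (real (D n div D j) * zigzag (D (Suc n) / D n * p (Suc n) x))"
    using step p_Suc[OF assms(1), of n] real_D_div[of n "Suc n"] real_D_div[of j n] by simp
  also have "\<dots> = zigzag (D n / D j * (D (Suc n) / D n * p (Suc n) x))"
    unfolding zigzag_mult_nat using real_D_div[OF step.hyps(1)] by simp
  finally show ?case
    using D_pos[of n] by (simp add: field_simps)
qed

lemma p_eq_mono:
  assumes "x \<in> topspace X" "y \<in> topspace X" "j \<le> k" "p k x = p k y"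
  shows "p j x = p j y"
  using p_le[OF assms(1,3)] p_le[OF assms(2,3)] assms(4) by simp

lemma p_inj_eventually:
  assumes "x \<in> topspace X" "y \<in> topspace X" "\<And>k. k \<ge> n \<Longrightarrow> p k x = p k y"
  shows "x = y"
proof (rule p_inj[OF assms(1,2)])
  show "p k x = p k y" for k
    using assms(3)[of "max k n"] by (intro p_eq_mono[OF assms(1,2), of k "max k n"]) auto
qed

text \<open>Points may be prescribed by angles: the values \<open>\<theta> k\<close> only have to be compatible up to sign
  and even translation.\<close>

lemma exists_point:
  assumes "\<And>k. zigzag (\<theta> k) = zigzag (D (Suc k) / D k * \<theta> (Suc k))"
  shows "\<exists>x\<in>topspace X. \<forall>k. p k x = zigzag (\<theta> k)"
proof (rule p_surj)
  show "zigzag (\<theta> k) \<in> {0..1}" for k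
    using zigzag_bounds by simp
  show "zigzag (\<theta> k) = zigzag (real (D (Suc k) div D k) * zigzag (\<theta> (Suc k)))" for k
    unfolding zigzag_mult_nat using assms[of k] real_D_div[of k "Suc k"] by simp
qed

lemma Hausdorff: "Hausdorff_space X"
proof (rule Hausdorff_space_injective_preimage)
  show "Hausdorff_space (product_topology (\<lambda>_::nat. euclideanreal) UNIV)"
    by (simp add: Hausdorff_space_product_topology)
  show "continuous_map X (product_topology (\<lambda>_::nat. euclideanreal) UNIV) (\<lambda>x k. p k x)"
    by (simp add: continuous_map_componentwise_UNIV p_continuous)
  show "inj_on (\<lambda>x k. p k x) (topspace X)"
    by (intro inj_onI p_inj) (auto dest: fun_cong)
qed

text \<open>The space is compact, so its topology is the coarsest one that makes the coordinates
  continuous.\<close>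

lemma continuous_map_into:
  assumes "g \<in> topspace Z \<rightarrow> topspace X" "\<And>k. continuous_map Z euclideanreal (\<lambda>z. p k (g z))"
  shows "continuous_map Z X g"
proof -
  let ?Y = "product_topology (\<lambda>_::nat. euclideanreal) UNIV" and ?\<Phi> = "\<lambda>x k. p k x"
  have inj: "inj_on ?\<Phi> (topspace X)"
    by (intro inj_onI p_inj) (auto dest: fun_cong)
  have "continuous_map X ?Y ?\<Phi>"
    by (simp add: continuous_map_componentwise_UNIV p_continuous)
  then have cl: "closed_map X ?Y ?\<Phi>"
    using continuous_imp_closed_map compact by (simp add: continuous_imp_closed_map Hausdorff_space_product_topology)
  have c: "continuous_map Z ?Y (\<lambda>z. ?\<Phi> (g z))"
    using assms(2) by (simp add: continuous_map_componentwise_UNIV)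
  show ?thesis
    unfolding continuous_map_closedin
  proof (intro conjI ballI allI impI)
    fix C assume C: "closedin X C"
    then have "closedin Z {z \<in> topspace Z. ?\<Phi> (g z) \<in> ?\<Phi> ` C}"
      using cl c closedin_continuous_map_preimage unfolding closed_map_def by blast
    moreover have "{z \<in> topspace Z. ?\<Phi> (g z) \<in> ?\<Phi> ` C} = {z \<in> topspace Z. g z \<in> C}"
      using inj_on_image_mem_iff[OF inj] closedin_subset[OF C] assms(1) by (auto simp: Pi_iff)
    ultimately show "closedin Z {z \<in> topspace Z. g z \<in> C}" by simp
  qed (use assms(1) in auto)
qed

text \<open>The pairs of points at which \<open>g\<close> differs by at least \<open>\<epsilon>\<close> form a compact set, and the pairs
  separated by the \<open>k\<close>-th coordinate form open sets that increase with \<open>k\<close> and cover it.\<close>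

lemma nearly_factors:
  assumes g: "continuous_map X euclideanreal g" and \<epsilon>: "0 < \<epsilon>"
  shows "\<exists>k. \<forall>l\<ge>k. \<forall>x\<in>topspace X. \<forall>y\<in>topspace X. p l x = p l y \<longrightarrow> \<bar>g x - g y\<bar> < (\<epsilon>::real)"
proof -
  let ?Z = "prod_topology X X"
  have c: "continuous_map ?Z euclideanreal (\<lambda>z. h (fst z) - h (snd z))"
    if "continuous_map X euclideanreal h" for h :: "'a \<Rightarrow> real"
    using continuous_map_compose[OF continuous_map_fst that] continuous_map_compose[OF continuous_map_snd that]
    by (intro continuous_map_diff) (simp_all add: o_def)
  define S where "S = {z \<in> topspace ?Z. \<bar>g (fst z) - g (snd z)\<bar> \<in> {\<epsilon>..}}"
  define A where "A k = {z \<in> topspace ?Z. p k (fst z) - p k (snd z) \<in> - {0}}" for k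
  have "closedin ?Z S"
    unfolding S_def using continuous_map_real_abs[OF c[OF g]]
    by (rule closedin_continuous_map_preimage) simp
  then have "compactin ?Z S"
    using closedin_compact_space compact compact_space_prod_topology by blast
  moreover have "openin ?Z (A k)" for k
    unfolding A_def using c[OF p_continuous] by (rule openin_continuous_map_preimage) (simp add: open_Compl)
  moreover have "A k \<subseteq> A (Suc k)" for k
  proof
    fix z assume z: "z \<in> A k"
    then have "p (Suc k) (fst z) \<noteq> p (Suc k) (snd z)"
      using p_eq_mono[of "fst z" "snd z" k "Suc k"] by (auto simp: A_def)
    then show "z \<in> A (Suc k)" using z by (simp add: A_def)
  qed
  moreover have "S \<subseteq> (\<Union>k. A k)"
  proof
    fix z assume z: "z \<in> S"
    then have "fst z \<noteq> snd z" "fst z \<in> topspace X" "snd z \<in> topspace X"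
      using \<epsilon> by (auto simp: S_def)
    then obtain k where "p k (fst z) \<noteq> p k (snd z)"
      using p_inj by blast
    then have "z \<in> A k" using z by (simp add: S_def A_def)
    then show "z \<in> (\<Union>k. A k)" by blast
  qed
  ultimately have "\<exists>k. S \<subseteq> A k"
    by (rule compactin_increasing_cover)
  then obtain k where k: "S \<subseteq> A k" ..
  show ?thesis
  proof (intro exI allI ballI impI)
    fix l x y assume l: "k \<le> l" "x \<in> topspace X" "y \<in> topspace X" "p l x = p l y"
    then have "p k x = p k y"
      using p_eq_mono by blast
    then have "(x, y) \<notin> A k"
      by (simp add: A_def)
    then have "(x, y) \<notin> S" using k by blast
    then show "\<bar>g x - g y\<bar> < \<epsilon>" using l by (auto simp: S_def)
  qed
qed

text \<open>A path with dense image that starts at the end point \<open>ray 0\<close>. It is defined on the whole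
  line, as an even function, because lifts of maps are odd functions on the line.\<close>

definition ray :: "real \<Rightarrow> 'a"
  where "ray t = (THE x. x \<in> topspace X \<and> (\<forall>k. p k x = zigzag (t / D k)))"

lemma ray: "ray t \<in> topspace X" "p k (ray t) = zigzag (t / D k)"
proof -
  have "\<exists>x\<in>topspace X. \<forall>k. p k x = zigzag (t / D k)"
    using D_pos by (intro exists_point) (simp add: field_simps)
  then have "\<exists>!x. x \<in> topspace X \<and> (\<forall>k. p k x = zigzag (t / D k))"
    using p_inj by metis
  from theI'[OF this] show "ray t \<in> topspace X" "p k (ray t) = zigzag (t / D k)"
    unfolding ray_def by blast+
qed

lemma eq_rayI: "x \<in> topspace X \<Longrightarrow> (\<And>k. k \<ge> n \<Longrightarrow> p k x = zigzag (t / D k)) \<Longrightarrow> x = ray t"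
  using p_inj_eventually ray by metis

lemma ray_minus: "ray (- t) = ray t"
  by (rule eq_rayI[of _ 0]) (simp_all add: ray)

lemma ray_abs: "ray \<bar>t\<bar> = ray t"
  by (simp add: abs_if ray_minus)

lemma continuous_ray: "continuous_map euclideanreal X ray"
proof (rule continuous_map_into)
  fix k
  have "continuous_on UNIV (\<lambda>t. zigzag (t / D k))"
    using D_pos by (intro continuous_intros) auto
  then show "continuous_map euclideanreal euclideanreal (\<lambda>z. p k (ray z))"
    by (simp add: ray)
qed (simp add: ray)

lemma p_ray_small: "0 \<le> t \<Longrightarrow> t \<le> real (D k) \<Longrightarrow> p k (ray t) = t / D k"
  using D_pos by (simp add: ray zigzag_unit)

lemma p_ray_p: "x \<in> topspace X \<Longrightarrow> p k (ray (D k * p k x)) = p k x"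
  using p_range[of x k] D_pos[of k] by (simp add: ray zigzag_unit)

lemma p_ray_shift: "p k (ray (t + 2 * real (D k) * real_of_int j)) = p k (ray t)"
proof -
  have "(t + 2 * real (D k) * real_of_int j) / D k = t / D k + 2 * real_of_int j"
    using D_pos[of k] by (simp add: field_simps)
  then show ?thesis by (simp add: ray)
qed

text \<open>A point outside a closed set is separated from it by a single coordinate, and the ray attains
  every value of that coordinate.\<close>

lemma ray_dense:
  assumes "closedin X C" "\<And>t. t \<ge> 0 \<Longrightarrow> ray t \<in> C" "x \<in> topspace X"
  shows "x \<in> C"
proof (rule ccontr)
  assume x: "x \<notin> C"
  define A where "A k = {y \<in> topspace X. p k y \<in> - {p k x}}" for k
  have "compactin X C"
    using assms closedin_compact_space compact by blast
  moreover have "openin X (A k)" for k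
    unfolding A_def using p_continuous by (rule openin_continuous_map_preimage) (simp add: open_Compl)
  moreover have "A k \<subseteq> A (Suc k)" for k
    using p_eq_mono[OF _ assms(3), of _ k "Suc k"] unfolding A_def by auto
  moreover have "C \<subseteq> (\<Union>k. A k)"
    using p_inj[OF _ assms(3)] x closedin_subset[OF assms(1)] unfolding A_def by blast
  ultimately have "\<exists>k. C \<subseteq> A k"
    by (rule compactin_increasing_cover)
  then obtain k where "C \<subseteq> A k" ..
  moreover have "ray (D k * p k x) \<in> C"
    using assms(2,3) p_range[of x k] by simp
  ultimately show False
    using p_ray_p[OF assms(3)] by (auto simp: A_def)
qed

lemma ray_inj:
  assumes "0 \<le> s" "0 \<le> t" "s \<le> real (D k)" "t \<le> real (D k)" "ray s = ray t"
  shows "s = t"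
proof -
  have "s / D k = t / D k"
    unfolding p_ray_small[OF assms(1,3), symmetric] p_ray_small[OF assms(2,4), symmetric] assms(5) ..
  then show ?thesis using D_pos[of k] by simp
qed

text \<open>The line through \<open>y\<close>: lift the coordinates of \<open>y\<close> to compatible angles \<open>\<theta> k\<close> and move all of
  them at once. Measured in the \<open>n\<close>-th coordinate, the line passes through \<open>y\<close> at parameter
  \<open>p n y\<close>.\<close>

lemma sheet:
  assumes y: "y \<in> topspace X"
  shows "\<exists>\<mu>. continuous_map euclideanreal X \<mu> \<and> \<mu> (p n y) = y \<and> (\<forall>v. p n (\<mu> v) = zigzag v)"
proof -
  have "\<exists>\<theta>::nat \<Rightarrow> real. \<forall>k. zigzag (\<theta> k) = p k y \<and>
      (\<exists>i. real (D (Suc k)) / real (D k) * \<theta> (Suc k) = \<theta> k + 2 * real_of_int i)"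
  proof (rule dependent_nat_choice[where P = "\<lambda>k t. zigzag t = p k y" and
        Q = "\<lambda>k t s. \<exists>i. real (D (Suc k)) / real (D k) * s = t + 2 * real_of_int i"])
    show "\<exists>t. zigzag t = p 0 y"
      using p_range[OF y, of 0] by (intro exI[of _ "p 0 y"]) (simp add: zigzag_unit)
    fix t k assume t: "zigzag t = p k y"
    have q: "zigzag (p (Suc k) y) = p (Suc k) y"
      using p_range[OF y, of "Suc k"] by (simp add: zigzag_unit)
    have "zigzag (D (Suc k) / D k * p (Suc k) y) = zigzag t"
      using p_le[OF y, of k "Suc k"] t by simp
    then obtain i :: int where "D (Suc k) / D k * p (Suc k) y = t + 2 * of_int i \<or>
        D (Suc k) / D k * p (Suc k) y = - t + 2 * of_int i"
      unfolding zigzag_eq_iff by blast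
    then show "\<exists>s. zigzag s = p (Suc k) y \<and> (\<exists>i::int. D (Suc k) / D k * s = t + 2 * of_int i)"
    proof
      assume "D (Suc k) / D k * p (Suc k) y = - t + 2 * of_int i"
      then have "D (Suc k) / D k * (- p (Suc k) y) = t + 2 * of_int (- i)" by simp
      then show ?thesis using q zigzag_minus by metis
    qed (use q in blast)
  qed
  then obtain \<theta> where \<theta>: "\<And>k. zigzag (\<theta> k) = p k y"
    "\<And>k. \<exists>i::int. D (Suc k) / D k * \<theta> (Suc k) = \<theta> k + 2 * of_int i"
    by blast
  have "\<exists>x\<in>topspace X. \<forall>k. p k x = zigzag (\<theta> k + s / D k)" for s
  proof (rule exists_point)
    fix k
    obtain i :: int where "D (Suc k) / D k * \<theta> (Suc k) = \<theta> k + 2 * of_int i"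
      using \<theta>(2) by blast
    then have "D (Suc k) / D k * (\<theta> (Suc k) + s / D (Suc k)) = (\<theta> k + s / D k) + 2 * of_int i"
      using D_pos[of "Suc k"] by (simp add: distrib_left)
    then show "zigzag (\<theta> k + s / D k) = zigzag (D (Suc k) / D k * (\<theta> (Suc k) + s / D (Suc k)))"
      by simp
  qed
  then obtain line where line: "\<And>s. line s \<in> topspace X" "\<And>s k. p k (line s) = zigzag (\<theta> k + s / D k)"
    by metis
  have "continuous_map euclideanreal X line"
  proof (rule continuous_map_into)
    fix k
    have "continuous_on UNIV (\<lambda>t. zigzag (\<theta> k + t / D k))"
      using D_pos by (intro continuous_intros) auto
    then show "continuous_map euclideanreal euclideanreal (\<lambda>z. p k (line z))"
      by (simp add: line)
  qed (simp add: line)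
  then have cont: "continuous_map euclideanreal X (\<lambda>v. line (c * (v - p n y)))" for c
  proof -
    have "continuous_map euclideanreal euclideanreal (\<lambda>v. c * (v - p n y))"
      by (simp add: continuous_intros)
    from continuous_map_compose[OF this \<open>continuous_map euclideanreal X line\<close>]
    show ?thesis by (simp add: o_def)
  qed
  have line0: "line 0 = y"
    using p_inj[OF line(1) y] line(2) \<theta>(1) by simp
  have "zigzag (\<theta> n) = zigzag (p n y)"
    using p_range[OF y, of n] \<theta>(1)[of n] by (simp add: zigzag_unit)
  then obtain i :: int where "\<theta> n = p n y + 2 * of_int i \<or> \<theta> n = - p n y + 2 * of_int i"
    unfolding zigzag_eq_iff by blast
  then obtain \<sigma> :: real where \<sigma>: "\<sigma> = 1 \<or> \<sigma> = -1" "\<theta> n = \<sigma> * p n y + 2 * of_int i"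
  proof
    assume "\<theta> n = p n y + 2 * of_int i"
    then show thesis by (intro that[of 1]) simp_all
  next
    assume "\<theta> n = - p n y + 2 * of_int i"
    then show thesis by (intro that[of "-1"]) simp_all
  qed
  have "p n (line (\<sigma> * D n * (v - p n y))) = zigzag v" for v
  proof -
    have "\<sigma> * D n * (v - p n y) / D n = \<sigma> * (v - p n y)"
      using D_pos[of n] by simp
    then have "p n (line (\<sigma> * D n * (v - p n y))) = zigzag (\<theta> n + \<sigma> * (v - p n y))"
      by (simp only: line(2))
    also have "\<theta> n + \<sigma> * (v - p n y) = \<sigma> * v + 2 * of_int i"
      using \<sigma>(2) by (simp add: algebra_simps)
    also have "zigzag (\<sigma> * v + 2 * of_int i) = zigzag (\<sigma> * v)"
      by (rule zigzag_shift)
    also have "\<dots> = zigzag v" using \<sigma>(1) by (elim disjE) simp_all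
    finally show ?thesis .
  qed
  note proj = this
  show ?thesis
  proof (intro exI conjI allI)
    show "continuous_map euclideanreal X (\<lambda>v. line (\<sigma> * D n * (v - p n y)))"
      by (rule cont)
    show "line (\<sigma> * D n * (p n y - p n y)) = y"
      by (simp add: line0)
    show "p n (line (\<sigma> * D n * (v - p n y))) = zigzag v" for v
      by (rule proj)
  qed
qed

end


section \<open>Open maps between Knaster continua\<close>

lemma first_hit:
  fixes v :: "real \<Rightarrow> real"
  assumes "continuous_on {0..t0} v" "v 0 < \<eta>" "\<eta> \<le> v t0" "0 \<le> t0"
  shows "\<exists>\<rho>. 0 < \<rho> \<and> \<rho> \<le> t0 \<and> v \<rho> = \<eta> \<and> (\<forall>t\<in>{0..\<rho>}. v t \<le> \<eta>)"
proof -
  define S where "S = {0..t0} \<inter> v -` {\<eta>}"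
  have "\<exists>x\<ge>0. x \<le> t0 \<and> v x = \<eta>"
    using assms by (intro IVT') auto
  then have ne: "S \<noteq> {}" by (auto simp: S_def)
  have "closed S"
    unfolding S_def using assms(1) by (intro continuous_closed_preimage) auto
  moreover have "bounded S"
    unfolding S_def by (rule bounded_subset[OF bounded_closed_interval[of 0 t0]]) auto
  ultimately have "compact S"
    by (simp add: compact_eq_bounded_closed)
  from compact_attains_inf[OF this ne] obtain \<rho> where \<rho>: "\<rho> \<in> S" "\<And>s. s \<in> S \<Longrightarrow> \<rho> \<le> s"
    by blast
  have \<rho>0: "0 \<le> \<rho>" "\<rho> \<le> t0" "v \<rho> = \<eta>" using \<rho>(1) by (simp_all add: S_def)
  moreover have "\<rho> \<noteq> 0" using \<rho>0(3) assms(2) by force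
  moreover have "v t \<le> \<eta>" if t: "t \<in> {0..\<rho>}" for t
  proof (rule ccontr)
    assume "\<not> v t \<le> \<eta>"
    then have "\<exists>x\<ge>0. x \<le> t \<and> v x = \<eta>"
      using assms(2) t \<rho>0(2) by (intro IVT') (auto intro: continuous_on_subset[OF assms(1)])
    then obtain x where x: "0 \<le> x" "x \<le> t" "v x = \<eta>" by blast
    then have "x \<in> S" using t \<rho>0(2) by (simp add: S_def)
    then have "x = t" using \<rho>(2)[of x] x t by simp
    then show False using x(3) \<open>\<not> v t \<le> \<eta>\<close> by simp
  qed
  ultimately show ?thesis by (intro exI[of _ \<rho>]) simp
qed

text \<open>The chains in which every prime occurs infinitely often.\<close>

locale knaster_cofinal = knaster_chain +
  assumes cofinal: "0 < m \<Longrightarrow> \<exists>k. m dvd D k"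
begin

lemma cofinal_ge: "0 < m \<Longrightarrow> \<exists>k\<ge>n. m dvd D k"
proof -
  assume "0 < m"
  then obtain k where "m dvd D k" using cofinal by blast
  then have "m dvd D (max n k)" using D_dvd[of k "max n k"] dvd_trans by simp
  then show ?thesis by (intro exI[of _ "max n k"]) simp
qed

lemma unbounded: "\<exists>k\<ge>n. B < real (D k)"
proof -
  obtain m :: nat where m: "B < real m" using reals_Archimedean2 by blast
  obtain k where k: "k \<ge> n" "Suc m dvd D k" using cofinal_ge[of "Suc m" n] by blast
  then have "Suc m \<le> D k" using D_pos dvd_imp_le by blast
  then show ?thesis using k m by (intro exI[of _ k]) simp
qed

lemma ray_eq_iff: "0 \<le> s \<Longrightarrow> 0 \<le> t \<Longrightarrow> ray s = ray t \<longleftrightarrow> s = t"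
  proof
  assume st: "0 \<le> s" "0 \<le> t" and eq: "ray s = ray t"
  obtain k where "max s t < D k" using unbounded by blast
  then show "s = t" using ray_inj[OF st _ _ eq, of k] by simp
qed simp

text \<open>Some quotient \<open>D k / D n\<close> is even, and a tent map of even degree maps both end points of the
  interval to 0; so \<open>ray 0\<close> is the only point that is an end point in every coordinate.\<close>

lemma p_in_01_imp_ray_0:
  assumes y: "y \<in> topspace X" and "\<And>n. p n y = 0 \<or> p n y = 1"
  shows "y = ray 0"
proof (rule eq_rayI[OF y, of 0])
  fix n
  obtain k where k: "k \<ge> n" "2 * D n dvd D k" using cofinal_ge[of "2 * D n" n] D_pos by auto
  then obtain j where j: "D k = 2 * D n * j" by blast
  have "p n y = zigzag (D k / D n * p k y)"
    using p_le[OF y k(1)] .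
  moreover have "D k / D n * p k y = 0 \<or> D k / D n * p k y = real (2 * j)"
    using assms(2)[of k] j D_pos[of n] by auto
  ultimately show "p n y = zigzag (0 / D n)"
    using zigzag_nat[of "2 * j"] by auto
qed

text \<open>Whenever \<open>D n * p n\<close> passes from one integer to the next, \<open>p 0\<close> passes between 0 and 1. By
  uniform continuity of \<open>p 0\<close> along \<open>\<gamma>\<close> this happens a bounded number of times, with a bound that
  depends on the path but not on \<open>n\<close>.\<close>

lemma level_bounded:
  assumes \<gamma>: "continuous_map euclideanreal X \<gamma>" and \<gamma>0: "\<gamma> 0 = ray 0" and T: "0 \<le> T"
  shows "\<exists>B. \<forall>n. \<forall>t\<in>{0..T}. D n * p n (\<gamma> t) \<le> B"
proof -
  have in_X: "\<gamma> t \<in> topspace X" for t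
    using \<gamma> by (auto simp: continuous_map_def)
  have cont: "continuous_on S (\<lambda>t. p n (\<gamma> t))" for n S
    using continuous_map_compose[OF \<gamma> p_continuous[of n]] by (auto simp: o_def intro: continuous_on_subset[OF _ subset_UNIV])
  have "uniformly_continuous_on {0..T} (\<lambda>t. p 0 (\<gamma> t))"
    using cont by (intro compact_uniformly_continuous) auto
  then have "\<exists>\<delta>>0. \<forall>s\<in>{0..T}. \<forall>t\<in>{0..T}. dist t s < \<delta> \<longrightarrow> dist (p 0 (\<gamma> t)) (p 0 (\<gamma> s)) < 1"
    unfolding uniformly_continuous_on_def by (metis zero_less_one)
  then obtain \<delta> where \<delta>: "\<delta> > 0"
    "\<And>s t. s \<in> {0..T} \<Longrightarrow> t \<in> {0..T} \<Longrightarrow> \<bar>t - s\<bar> < \<delta> \<Longrightarrow> \<bar>p 0 (\<gamma> t) - p 0 (\<gamma> s)\<bar> < 1"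
    unfolding dist_real_def by blast
  \<comment> \<open>The position on the line, as seen at level \<open>n\<close>.\<close>
  define w where "w n t = D n * p n (\<gamma> t)" for n t
  have p0: "p 0 (\<gamma> t) = zigzag (w n t)" for n t
    using p_le[OF in_X, of 0 n t] by (simp add: w_def D_0)
  have step: "w n t < w n s + 2" if st: "s \<in> {0..T}" "t \<in> {0..T}" "\<bar>t - s\<bar> < \<delta>" for n s t
  proof (rule ccontr)
    assume "\<not> w n t < w n s + 2"
    then have big: "w n s + 2 \<le> w n t" by simp
    define i where "i = \<lceil>w n s\<rceil>"
    have i: "w n s \<le> of_int i" "of_int i + 1 \<le> w n t"
      using big unfolding i_def by linarith+
    have "connected (w n ` closed_segment s t)"
      unfolding w_def by (intro connected_continuous_image continuous_intros cont) simp
    then have sub: "{w n s..w n t} \<subseteq> w n ` closed_segment s t"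
      by (intro connected_contains_Icc) auto
    have "of_int i \<in> {w n s..w n t}" "of_int i + 1 \<in> {w n s..w n t}"
      using i by auto
    then obtain s' t' where s't': "s' \<in> closed_segment s t" "t' \<in> closed_segment s t"
      "w n s' = of_int i" "w n t' = of_int (i + 1)"
      using sub by (metis (no_types, lifting) imageE of_int_1 of_int_add subsetD)
    have "s' \<in> {0..T}" "t' \<in> {0..T}" "\<bar>t' - s'\<bar> < \<delta>"
      using s't'(1,2) st by (auto simp: closed_segment_eq_real_ivl split: if_splits)
    then have "\<bar>zigzag (of_int (i + 1)) - zigzag (of_int i)\<bar> < 1"
      using \<delta>(2) p0 s't'(3,4) by metis
    then show False
      unfolding zigzag_int by (auto split: if_splits)
  qed
  have bound: "w n t \<le> 2 * real r" if "t \<in> {0..T}" "t < real r * (\<delta> / 2)" for n r t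
    using that
  proof (induction r arbitrary: t)
    case (Suc r)
    show ?case
    proof (cases "t < \<delta> / 2")
      case True
      then have "w n t < w n 0 + 2"
        using Suc.prems T \<delta>(1) by (intro step) auto
      also have "w n 0 = 0" by (simp add: w_def \<gamma>0 ray)
      finally show ?thesis by simp
    next
      case False
      then have "w n t < w n (t - \<delta> / 2) + 2"
        using Suc.prems \<delta>(1) by (intro step) auto
      also have "w n (t - \<delta> / 2) \<le> 2 * real r"
        using Suc.prems False \<delta>(1) by (intro Suc.IH) (auto simp: algebra_simps)
      finally show ?thesis by simp
    qed
  qed auto
  obtain r :: nat where r: "T < real r * (\<delta> / 2)"
    using reals_Archimedean3[of "\<delta> / 2"] \<delta>(1) by auto
  show ?thesis
  proof (intro exI allI ballI)
    fix n t assume "t \<in> {0..T}"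
    then show "D n * p n (\<gamma> t) \<le> 2 * real r"
      using bound[of t r n] r unfolding w_def by simp
  qed
qed

text \<open>On a compact part of the path, a coordinate \<open>p n\<close> of high level stays below 1 by
  \<open>level_bounded\<close>; there the path has not yet been reflected, and \<open>D n * p n\<close> is its position on
  the half-line. The odd extension to the line is chosen for the sake of later comparisons under
  translations.\<close>

lemma path_lift:
  assumes \<gamma>: "continuous_map euclideanreal X \<gamma>" and \<gamma>0: "\<gamma> 0 = ray 0" and even: "\<And>t. \<gamma> (- t) = \<gamma> t"
  shows "\<exists>A. continuous_on UNIV A \<and> (\<forall>t. A (- t) = - A t) \<and> (\<forall>t\<ge>0. 0 \<le> A t) \<and> (\<forall>t. \<gamma> t = ray (A t))"
proof -
  have in_X: "\<gamma> t \<in> topspace X" for t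
    using \<gamma> by (auto simp: continuous_map_def)
  have cont: "continuous_on S (\<lambda>t. p n (\<gamma> t))" for n S
    using continuous_map_compose[OF \<gamma> p_continuous[of n]] by (auto simp: o_def intro: continuous_on_subset[OF _ subset_UNIV])
  have eq: "\<exists>n. \<forall>t\<in>{0..T}. \<gamma> t = ray (D n * p n (\<gamma> t))" if T: "0 \<le> T" for T
  proof -
    obtain B where B: "\<And>n t. t \<in> {0..T} \<Longrightarrow> D n * p n (\<gamma> t) \<le> B"
      using level_bounded[OF \<gamma> \<gamma>0 T] by blast
    obtain n where n: "B < D n" using unbounded by blast
    have "\<gamma> t = ray (D n * p n (\<gamma> t))" if t: "t \<in> {0..T}" for t
    proof (rule eq_rayI[OF in_X, of n])
      fix k assume k: "k \<ge> n"
      have p: "0 \<le> p k (\<gamma> t)" "p k (\<gamma> t) \<le> 1" using p_range[OF in_X, of k t] by auto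
      have "D k * p k (\<gamma> t) / D n \<le> 1"
        using B[OF t, of k] n D_pos[of n] by (simp add: divide_le_eq)
      then have "p n (\<gamma> t) = D k * p k (\<gamma> t) / D n"
        using p_le[OF in_X k, of t] p(1) by (simp add: zigzag_unit)
      then have "D n * p n (\<gamma> t) / D k = p k (\<gamma> t)"
        using D_pos[of n] D_pos[of k] by simp
      then show "p k (\<gamma> t) = zigzag (D n * p n (\<gamma> t) / D k)"
        using p by (simp add: zigzag_unit)
    qed
    then show ?thesis by blast
  qed
  have nonneg: "0 \<le> D n * p n (\<gamma> t)" for n t
    using p_range[OF in_X, of n t] by simp
  have "\<exists>s\<ge>0. \<gamma> t = ray s" if "0 \<le> t" for t
    using eq[OF that] nonneg[of _ t] that by fastforce
  then obtain a where a: "\<And>t. 0 \<le> t \<Longrightarrow> 0 \<le> a t" "\<And>t. 0 \<le> t \<Longrightarrow> \<gamma> t = ray (a t)"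
    by metis
  define A where "A t = (if 0 \<le> t then a t else - a (- t))" for t
  have a0: "a 0 = 0" using a[of 0] \<gamma>0 ray_eq_iff[of "a 0" 0] by simp
  have "continuous_on {- real n<..<real n} A" for n
  proof -
    obtain m where m: "\<And>t. t \<in> {0..real n} \<Longrightarrow> \<gamma> t = ray (D m * p m (\<gamma> t))"
      using eq[of "real n"] by (metis of_nat_0_le_iff)
    define W where "W t = D m * p m (\<gamma> t)" for t
    have aW: "a t = W t" if "t \<in> {0..real n}" for t
    proof -
      have "ray (a t) = ray (W t)" using a(2)[of t] m[OF that] that by (simp add: W_def)
      then show ?thesis using ray_eq_iff[of "a t" "W t"] a(1)[of t] nonneg[of m t] that by (simp add: W_def)
    qed
    have W0: "W 0 = 0" using aW[of 0] a0 by simp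
    have Wc: "continuous_on S W" for S unfolding W_def by (intro continuous_intros cont)
    have "continuous_on ({0..} \<union> {..0}) (\<lambda>t. if 0 \<le> t then W t else - W t)"
      by (rule continuous_on_cases) (auto intro!: continuous_intros Wc simp: W0)
    then have "continuous_on {- real n<..<real n} (\<lambda>t. if 0 \<le> t then W t else - W t)"
      by (rule continuous_on_subset) auto
    moreover have "(if 0 \<le> t then W t else - W t) = A t" if "t \<in> {- real n<..<real n}" for t
      using that aW[of t] aW[of "- t"] even[of t] by (simp add: A_def W_def)
    ultimately show ?thesis by (rule continuous_on_eq)
  qed
  then have "continuous_on (\<Union>n. {- real n<..<real n}) A"
    by (intro continuous_on_open_UN) auto
  moreover have "(\<Union>n. {- real n<..<real n}) = UNIV"
  proof -
    have "x \<in> (\<Union>n. {- real n<..<real n})" for x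
    proof -
      obtain n :: nat where "\<bar>x\<bar> < real n" using reals_Archimedean2 by blast
      then have "x \<in> {- real n<..<real n}" by auto
      then show ?thesis by blast
    qed
    then show ?thesis by blast
  qed
  moreover have "A (- t) = - A t" for t
    using a0 by (simp add: A_def)
  moreover have "\<gamma> t = ray (A t)" for t
    using a(2)[of t] a(2)[of "- t"] even[of t] by (simp add: A_def ray_minus)
  moreover have "0 \<le> A t" if "t \<ge> 0" for t using a(1) that by (simp add: A_def)
  ultimately show ?thesis by (intro exI[of _ A]) simp
qed

end

locale knaster_open_map = S: knaster_chain X D p + T: knaster_cofinal Y E q
  for X :: "'a topology" and D p and Y :: "'b topology" and E q +
  fixes f :: "'a \<Rightarrow> 'b"
  assumes f_continuous: "continuous_map X Y f" and f_open: "open_map X Y f"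
    and f_onto: "f ` topspace X = topspace Y"
begin

lemma f_in: "x \<in> topspace X \<Longrightarrow> f x \<in> topspace Y"
  using f_onto by blast

lemma continuous_level: "continuous_map X euclideanreal (\<lambda>x. q n (f x))"
  using continuous_map_compose[OF f_continuous T.p_continuous] by (simp add: o_def)

text \<open>Suppose \<open>c = 1\<close>, so that the level \<open>q n (f x)\<close> is larger at \<open>x0\<close> than on the boundary
  \<open>C - U\<close>. Restrict attention to the closed set \<open>P\<close> of points of \<open>C\<close> that \<open>f\<close> maps to the line
  through \<open>f x0\<close>, and choose \<open>x1\<close> in \<open>P\<close> with maximal level. Then \<open>x1\<close> lies in \<open>U\<close>, and the open
  set \<open>f ` U\<close> contains points of the line slightly above \<open>f x1\<close>, which is impossible. The case
  \<open>c = -1\<close> treats minima in the same way.\<close>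

lemma no_extremum:
  assumes C: "closedin X C" and U: "openin X U" "U \<subseteq> C" "x0 \<in> U" and c: "c = 1 \<or> c = (-1::real)"
    and g0: "0 < q n (f x0)" "q n (f x0) < 1"
    and gC: "\<And>x. x \<in> C \<Longrightarrow> c * q n (f x) < (1 + c) / 2"
    and gU: "\<And>x. x \<in> C - U \<Longrightarrow> c * q n (f x) < c * q n (f x0)"
  shows False
proof -
  define g where "g x = q n (f x)" for x
  have CX: "C \<subseteq> topspace X" using closedin_subset[OF C] .
  have x0: "x0 \<in> topspace X" using U CX by blast
  obtain \<mu> where \<mu>: "continuous_map euclideanreal Y \<mu>" "\<mu> (g x0) = f x0" "\<And>v. q n (\<mu> v) = zigzag v"
    using T.sheet[OF f_in[OF x0], of n] unfolding g_def by blast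
  define P where "P = C \<inter> {x \<in> topspace X. f x = \<mu> (g x)}"
  have contg: "continuous_map X euclideanreal g"
    unfolding g_def by (rule continuous_level)
  have "continuous_map X Y (\<lambda>x. \<mu> (g x))"
    using continuous_map_compose[OF contg \<mu>(1)] by (simp add: o_def)
  then have "closedin X P"
    unfolding P_def by (intro closedin_Int C closedin_continuous_maps_eq[OF T.Hausdorff f_continuous])
  then have "compactin X P"
    using closedin_compact_space S.compact by blast
  moreover have "x0 \<in> P" using U x0 \<mu>(2) by (auto simp: P_def)
  moreover have "continuous_map X euclideanreal (\<lambda>x. c * g x)"
    using contg by (intro continuous_intros) auto
  ultimately obtain x1 where x1: "x1 \<in> P" "\<And>x. x \<in> P \<Longrightarrow> c * g x \<le> c * g x1"
    using continuous_map_attains_sup[of X P "\<lambda>x. c * g x"] by blast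
  have ge: "c * g x0 \<le> c * g x1" using x1(2) \<open>x0 \<in> P\<close> by blast
  have "x1 \<in> C" using x1(1) by (simp add: P_def)
  have "x1 \<in> U"
    using gU[of x1] ge \<open>x1 \<in> C\<close> unfolding g_def by fastforce
  have less: "c * g x1 < (1 + c) / 2" using gC[OF \<open>x1 \<in> C\<close>] by (simp add: g_def)
  have v1: "0 < g x1" "g x1 < 1"
    using c ge less g0 unfolding g_def by auto
  have "openin Y (f ` U)" using f_open U(1) by (simp add: open_map_def)
  then have "openin euclideanreal {v \<in> topspace euclideanreal. \<mu> v \<in> f ` U}"
    using \<mu>(1) openin_continuous_map_preimage by blast
  then have "open {v. \<mu> v \<in> f ` U}" by simp
  moreover have "\<mu> (g x1) \<in> f ` U"
  proof -
    have "f x1 = \<mu> (g x1)" using x1(1) by (simp add: P_def)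
    then show ?thesis using \<open>x1 \<in> U\<close> by (metis imageI)
  qed
  ultimately obtain e where e: "e > 0" "\<And>v. dist v (g x1) < e \<Longrightarrow> \<mu> v \<in> f ` U"
    unfolding open_dist by blast
  define \<delta> where "\<delta> = min (e / 2) (min (g x1) (1 - g x1))"
  have \<delta>: "0 < \<delta>" "\<delta> < e" "\<delta> \<le> g x1" "\<delta> \<le> 1 - g x1"
    using e(1) v1 unfolding \<delta>_def by auto
  define v where "v = g x1 + c * \<delta>"
  have v: "0 \<le> v" "v \<le> 1" "dist v (g x1) < e"
    using c \<delta> v1 by (auto simp: v_def dist_real_def)
  then obtain x2 where x2: "x2 \<in> U" "f x2 = \<mu> v"
    using e(2)[OF v(3)] by (metis imageE)
  have "g x2 = v"
    using \<mu>(3)[of v] v by (simp add: g_def x2 zigzag_unit)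
  then have "x2 \<in> P" using x2 U CX by (auto simp: P_def)
  then have "c * v \<le> c * g x1" using x1(2) \<open>g x2 = v\<close> by blast
  moreover have "c * v = c * g x1 + \<delta>" using c by (auto simp: v_def)
  ultimately show False using \<delta>(1) by simp
qed

lemma continuous_level_ray: "continuous_on A (\<lambda>t. q n (f (S.ray t)))"
  using continuous_map_compose[OF S.continuous_ray continuous_level[of n]]
  by (auto simp: o_def intro: continuous_on_subset[OF _ subset_UNIV])

text \<open>The points whose \<open>k\<close>-th coordinate is at most \<open>\<rho> / D k\<close> form a closed set that consists of
  the initial segment of the ray and, for large \<open>k\<close>, of nearby folded copies of it. On all of them
  the level is close to that on the segment, by \<open>nearly_factors\<close>. The only boundary is the part
  with coordinate equal to \<open>\<rho> / D k\<close>; at \<open>ray 0\<close> there is none, and therefore \<open>s = 0\<close> is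
  allowed.\<close>

lemma no_extremum_on_ray:
  assumes m: "\<rho> \<le> real (D m)" and s: "0 \<le> s" "s < \<rho>" and c: "c = 1 \<or> c = (-1::real)"
    and g0: "0 < q n (f (S.ray s))" "q n (f (S.ray s)) < 1"
    and gC: "\<And>t. t \<in> {0..\<rho>} \<Longrightarrow> c * q n (f (S.ray t)) < (1 + c) / 2"
    and g\<rho>: "c * q n (f (S.ray \<rho>)) < c * q n (f (S.ray s))"
  shows False
proof -
  define u where "u t = q n (f (S.ray t))" for t
  have "continuous_on {0..\<rho>} (\<lambda>t. c * u t)"
    unfolding u_def by (intro continuous_intros continuous_level_ray)
  then have "\<exists>t1\<in>{0..\<rho>}. \<forall>t\<in>{0..\<rho>}. c * u t \<le> c * u t1"
    using s by (intro continuous_attains_sup) auto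
  then obtain t1 where t1: "t1 \<in> {0..\<rho>}" "\<And>t. t \<in> {0..\<rho>} \<Longrightarrow> c * u t \<le> c * u t1"
    by blast
  define \<epsilon> where "\<epsilon> = min ((1 + c) / 2 - c * u t1) (c * u s - c * u \<rho>)"
  have \<epsilon>: "\<epsilon> > 0" using gC[OF t1(1)] g\<rho> by (simp add: \<epsilon>_def u_def)
  obtain k0 where k0: "\<And>l x y. l \<ge> k0 \<Longrightarrow> x \<in> topspace X \<Longrightarrow> y \<in> topspace X \<Longrightarrow> p l x = p l y \<Longrightarrow>
      \<bar>q n (f x) - q n (f y)\<bar> < \<epsilon>"
    using S.nearly_factors[OF continuous_level[of n] \<epsilon>] by blast
  define k where "k = max k0 m"
  have Dk: "0 < D k" "\<rho> \<le> D k"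
    using S.D_pos[of k] m S.D_mono[of m k] by (auto simp: k_def)
  define C where "C = {x \<in> topspace X. p k x \<in> {..\<rho> / D k}}"
  define U where "U = {x \<in> topspace X. p k x \<in> {..<\<rho> / D k}}"
  have near: "c * q n (f x) < c * u (D k * p k x) + \<epsilon>" if "x \<in> topspace X" for x
  proof -
    have "\<bar>q n (f x) - u (D k * p k x)\<bar> < \<epsilon>"
      unfolding u_def using k0[OF _ that S.ray(1), of k "D k * p k x"] S.p_ray_p[OF that, of k]
      by (simp add: k_def)
    then show ?thesis using c by (auto simp: abs_less_iff)
  qed
  have t: "D k * p k x \<in> {0..\<rho>}" if "x \<in> C" for x
    using that S.p_range[of x k] Dk by (auto simp: C_def pos_le_divide_eq mult.commute)
  show False
  proof (rule no_extremum[of C U "S.ray s" c n])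
    show "closedin X C"
      unfolding C_def using S.p_continuous by (rule closedin_continuous_map_preimage) simp
    show "openin X U"
      unfolding U_def using S.p_continuous by (rule openin_continuous_map_preimage) simp
    show "U \<subseteq> C" by (auto simp: U_def C_def)
    have "p k (S.ray s) = s / D k" using s Dk by (intro S.p_ray_small) auto
    then show "S.ray s \<in> U"
      using s Dk by (simp add: U_def S.ray(1) divide_strict_right_mono)
    show "c * q n (f x) < (1 + c) / 2" if "x \<in> C" for x
    proof -
      have "\<epsilon> \<le> (1 + c) / 2 - c * u t1" by (simp add: \<epsilon>_def)
      moreover have "x \<in> topspace X" using that by (simp add: C_def)
      ultimately show ?thesis using near[of x] t1(2)[OF t[OF that]] by linarith
    qed
    show "c * q n (f x) < c * q n (f (S.ray s))" if "x \<in> C - U" for x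
    proof -
      have "D k * p k x = \<rho>"
        using that Dk by (auto simp: C_def U_def field_simps)
      then show ?thesis
        using near[of x] that unfolding \<epsilon>_def C_def u_def by auto
    qed
  qed (use g0 c in auto)
qed

text \<open>Otherwise some level of the image of the end point is strictly between 0 and 1. Follow the ray
  until this level has changed by a small amount \<open>\<eta>\<close>: the end point is then an extremum in the sense
  of \<open>no_extremum_on_ray\<close>.\<close>

lemma ray_0: "f (S.ray 0) = T.ray 0"
proof (rule ccontr)
  assume neq: "f (S.ray 0) \<noteq> T.ray 0"
  have fr: "f (S.ray t) \<in> topspace Y" for t using f_in S.ray(1) by blast
  obtain n where "q n (f (S.ray 0)) \<noteq> 0" "q n (f (S.ray 0)) \<noteq> 1"
    using T.p_in_01_imp_ray_0[OF fr[of 0]] neq by blast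
  then have u0: "0 < q n (f (S.ray 0))" "q n (f (S.ray 0)) < 1"
    using T.p_range[OF fr[of 0], of n] by auto
  define u where "u t = q n (f (S.ray t))" for t
  obtain x where x: "x \<in> topspace X" "f x = T.ray 0" using f_onto T.ray(1) by (metis imageE)
  obtain k where k: "\<And>x y. x \<in> topspace X \<Longrightarrow> y \<in> topspace X \<Longrightarrow> p k x = p k y \<Longrightarrow>
      \<bar>q n (f x) - q n (f y)\<bar> < u 0"
    using S.nearly_factors[OF continuous_level[of n], of "u 0"] u0(1) unfolding u_def by blast
  define t0 where "t0 = D k * p k x"
  have t0: "0 \<le> t0" "t0 \<le> D k"
    using S.p_range[OF x(1), of k] S.D_pos[of k] by (auto simp: t0_def mult_le_cancel_left2)
  have "\<bar>q n (f (S.ray t0)) - q n (f x)\<bar> < u 0"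
    unfolding t0_def by (rule k[OF S.ray(1) x(1) S.p_ray_p[OF x(1)]])
  then have ut0: "u t0 < u 0"
    by (simp add: x T.ray(2) u_def)
  define \<eta> where "\<eta> = min (u 0 - u t0) (min (u 0) (1 - u 0)) / 2"
  have \<eta>: "0 < \<eta>" "\<eta> \<le> u 0 - u t0" "\<eta> < u 0" "\<eta> < 1 - u 0"
    using u0 ut0 unfolding \<eta>_def by (auto simp: u_def[symmetric])
  have "\<exists>\<rho>. 0 < \<rho> \<and> \<rho> \<le> t0 \<and> \<bar>u \<rho> - u 0\<bar> = \<eta> \<and> (\<forall>t\<in>{0..\<rho>}. \<bar>u t - u 0\<bar> \<le> \<eta>)"
    using t0 \<eta> unfolding u_def by (intro first_hit continuous_intros continuous_level_ray) auto
  then obtain \<rho> where \<rho>: "0 < \<rho>" "\<rho> \<le> t0" "\<bar>u \<rho> - u 0\<bar> = \<eta>" "\<And>t. t \<in> {0..\<rho>} \<Longrightarrow> \<bar>u t - u 0\<bar> \<le> \<eta>"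
    by blast
  \<comment> \<open>The end point is a maximum if the level has dropped, a minimum if it has risen.\<close>
  define c :: real where "c = (if u \<rho> < u 0 then 1 else -1)"
  show False
  proof (rule no_extremum_on_ray[of \<rho> k 0 c n])
    show "\<rho> \<le> D k" using \<rho>(2) t0(2) by simp
    show "c * q n (f (S.ray t)) < (1 + c) / 2" if "t \<in> {0..\<rho>}" for t
      using \<rho>(4)[OF that] \<eta> unfolding u_def c_def by auto
    show "c * q n (f (S.ray \<rho>)) < c * q n (f (S.ray 0))"
      using \<rho>(3) \<eta>(1) unfolding u_def c_def by auto
  qed (use \<rho> u0 in \<open>auto simp: c_def\<close>)
qed

lemma lift_exists:
  "\<exists>A. continuous_on UNIV A \<and> (\<forall>t. A (- t) = - A t) \<and> (\<forall>t\<ge>0. 0 \<le> A t) \<and> (\<forall>t. f (S.ray t) = T.ray (A t))"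
proof (rule T.path_lift)
  show "continuous_map euclideanreal Y (\<lambda>t. f (S.ray t))"
    using continuous_map_compose[OF S.continuous_ray f_continuous] by (simp add: o_def)
qed (simp_all add: ray_0 S.ray_minus)

text \<open>If \<open>A\<close> is bounded, the image of the ray, hence by density the image of \<open>f\<close>, lies in a proper
  initial arc of the target.\<close>

lemma onto_unbounded:
  assumes A: "\<And>t. f (S.ray t) = T.ray (A t)" and B: "\<And>t. \<bar>A t\<bar> \<le> B"
  shows False
proof -
  have "0 \<le> B" using B[of 0] by simp
  obtain n where n: "B + 1 < E n" using T.unbounded by blast
  define C where "C = {x \<in> topspace X. q n (f x) \<in> {..B / E n}}"
  obtain x where x: "x \<in> topspace X" "f x = T.ray (B + 1)"
    using f_onto T.ray(1) by (metis imageE)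
  have "x \<in> C"
  proof (rule S.ray_dense[OF _ _ x(1)])
    show "closedin X C"
      unfolding C_def using continuous_level by (rule closedin_continuous_map_preimage) simp
    fix t :: real
    have "q n (f (S.ray t)) = q n (T.ray \<bar>A t\<bar>)" by (simp add: A T.ray_abs)
    also have "\<dots> = \<bar>A t\<bar> / E n"
      using n B[of t] by (intro T.p_ray_small) auto
    also have "\<dots> \<le> B / E n" using B[of t] by (simp add: divide_right_mono)
    finally show "S.ray t \<in> C" by (simp add: C_def S.ray(1))
  qed
  then have "q n (T.ray (B + 1)) \<le> B / E n" by (simp add: C_def x)
  moreover have "q n (T.ray (B + 1)) = (B + 1) / E n"
    using n \<open>0 \<le> B\<close> by (intro T.p_ray_small) auto
  ultimately show False using T.D_pos[of n] by (simp add: divide_le_cancel)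
qed

text \<open>If the chain stabilizes, the source is an arc, and its image cannot leave a bounded part of the
  ray.\<close>

lemma D_unbounded: "\<exists>k. B \<le> real (D k)"
proof (rule ccontr)
  assume "\<not> (\<exists>k. B \<le> real (D k))"
  then have less: "real (D k) < B" for k by (simp add: not_le)
  have "D k \<le> nat \<lceil>B\<rceil>" for k using less[of k] by linarith
  then obtain k where k: "\<And>j. D j \<le> D k"
    using ex_has_greatest_nat[of "\<lambda>_. True" 0 D "Suc (nat \<lceil>B\<rceil>)"] by (auto simp: less_Suc_eq_le)
  have Dj: "D j = D k" if "k \<le> j" for j using S.D_mono[OF that] k[of j] by simp
  have x_eq: "x = S.ray (D k * p k x)" if x: "x \<in> topspace X" for x
  proof (rule S.eq_rayI[OF x, of k])
    fix j assume j: "k \<le> j"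
    have "p k x = p j x"
      using S.p_le[OF x j] S.p_range[OF x, of j] S.D_pos[of k] by (simp add: Dj[OF j] zigzag_unit)
    then show "p j x = zigzag (D k * p k x / D j)"
      using S.p_range[OF x, of j] S.D_pos[of k] by (simp add: Dj[OF j] zigzag_unit)
  qed
  obtain A where A: "continuous_on UNIV A" "\<And>t. f (S.ray t) = T.ray (A t)"
    using lift_exists by blast
  have "bounded (A ` {0..real (D k)})"
    by (intro compact_imp_bounded compact_continuous_image continuous_on_subset[OF A(1)]) auto
  then obtain M where M: "\<And>t. t \<in> {0..real (D k)} \<Longrightarrow> \<bar>A t\<bar> \<le> M"
    by (metis (no_types, lifting) bounded_real imageI)
  \<comment> \<open>The points \<open>ray t\<close> and \<open>ray (D k * p k (ray t))\<close> coincide, and the latter parameter stays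
    in \<open>[0, D k]\<close>.\<close>
  define A' where "A' t = A (D k * p k (S.ray t))" for t
  have "f (S.ray t) = T.ray (A' t)" for t
    unfolding A'_def using x_eq[OF S.ray(1), of t] A(2) by metis
  moreover have "\<bar>A' t\<bar> \<le> M" for t
    unfolding A'_def using S.p_range[OF S.ray(1), of k t]
    by (intro M) (auto simp: mult_le_cancel_left2)
  ultimately show False by (rule onto_unbounded)
qed

text \<open>If \<open>A\<close> drops between \<open>s\<close> and \<open>t\<close>, then its maximum over \<open>[0, t]\<close> is larger than \<open>A t\<close>, which
  \<open>no_extremum_on_ray\<close> excludes at a level \<open>n\<close> that is not yet reflected.\<close>

lemma lift_mono:
  assumes A: "continuous_on UNIV A" "\<And>t. A (- t) = - A t" "\<And>t. t \<ge> 0 \<Longrightarrow> 0 \<le> A t"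
    "\<And>t. f (S.ray t) = T.ray (A t)"
  shows "mono A"
proof -
  have pos: "A s \<le> A t" if st: "0 \<le> s" "s \<le> t" for s t
  proof (rule ccontr)
    assume "\<not> A s \<le> A t"
    then have neg: "A t < A s" by simp
    obtain m where m: "t \<le> D m" using D_unbounded by blast
    have "continuous_on {0..t} A" using A(1) continuous_on_subset by blast
    then have "\<exists>r\<in>{0..t}. \<forall>s\<in>{0..t}. A s \<le> A r"
      using st by (intro continuous_attains_sup) auto
    then obtain r where r: "r \<in> {0..t}" "\<And>s. s \<in> {0..t} \<Longrightarrow> A s \<le> A r"
      by blast
    have rs: "A s \<le> A r" using r(2)[of s] st by simp
    have At: "0 \<le> A t" using A(3)[of t] st by simp
    obtain n where n: "A r < E n" using T.unbounded by blast
    have q: "q n (f (S.ray x)) = A x / E n" if "x \<in> {0..t}" for x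
      unfolding A(4) using that r(2)[OF that] A(3)[of x] n by (intro T.p_ray_small) auto
    have En: "0 < real (E n)" using T.D_pos by simp
    show False
    proof (rule no_extremum_on_ray[of t m r 1 n])
      show "r < t" using r(1) rs neg by (cases "r = t") auto
      show "1 * q n (f (S.ray x)) < (1 + 1) / 2" if "x \<in> {0..t}" for x
        using q[OF that] r(2)[OF that] n En by (simp add: divide_less_eq)
    qed (use q[OF r(1)] q[of t] rs neg At n r(1) st m En in \<open>auto simp: divide_strict_right_mono\<close>)
  qed
  show ?thesis
  proof (rule monoI)
    fix s t :: real assume st: "s \<le> t"
    consider "0 \<le> s" | "s < 0" "0 \<le> t" | "t < 0" by linarith
    then show "A s \<le> A t"
    proof cases
      case 1 then show ?thesis using pos st by blast
    next
      case 2
      have "A s = - A (- s)" using A(2)[of s] by simp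
      also have "\<dots> \<le> 0" using A(3)[of "- s"] 2 by simp
      also have "\<dots> \<le> A t" using A(3)[of t] 2 by simp
      finally show ?thesis .
    next
      case 3
      have "A (- t) \<le> A (- s)" using pos[of "- t" "- s"] 3 st by simp
      then show ?thesis by (simp add: A(2))
    qed
  qed
qed

end


section \<open>Slopes of lifted maps\<close>

text \<open>Two monotone lifts of nearby paths stay together. If the difference grew to \<open>4 * \<epsilon>\<close> at
  time \<open>t\<close>, the lifts would be near reflections of each other, so \<open>u + v\<close> would be within \<open>\<epsilon>\<close> of an
  even integer \<open>2 * k\<close>. Go back to the time \<open>s\<close> at which \<open>u + v = 2 * k - \<epsilon>\<close>: since both functions
  are monotone, the difference has changed by less than \<open>2 * \<epsilon>\<close> since then, so at time \<open>s\<close> neither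
  the sum nor the difference is within \<open>\<epsilon>\<close> of an even integer.\<close>

lemma mono_lifts_close:
  fixes u v :: "real \<Rightarrow> real"
  assumes cont: "continuous_on UNIV u" "continuous_on UNIV v" and mono: "mono u" "mono v"
    and \<epsilon>: "0 < \<epsilon>" "7 * \<epsilon> \<le> 2" and start: "\<bar>u 0\<bar> < \<epsilon>" "\<bar>v 0\<bar> < \<epsilon>"
    and close: "\<And>t. 0 \<le> t \<Longrightarrow> \<bar>zigzag (u t) - zigzag (v t)\<bar> < \<epsilon>" and t1: "0 \<le> t1"
  shows "\<bar>u t1 - v t1\<bar> \<le> 4 * \<epsilon>"
proof (rule ccontr)
  assume "\<not> \<bar>u t1 - v t1\<bar> \<le> 4 * \<epsilon>"
  moreover have "continuous_on {0..t1} (\<lambda>t. \<bar>u t - v t\<bar>)"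
    by (intro continuous_intros continuous_on_subset[OF cont(1)] continuous_on_subset[OF cont(2)]) auto
  ultimately have "\<exists>t\<ge>0. t \<le> t1 \<and> \<bar>u t - v t\<bar> = 4 * \<epsilon>"
    using start t1 by (intro IVT') auto
  then obtain t where t: "0 \<le> t" "\<bar>u t - v t\<bar> = 4 * \<epsilon>" by blast
  \<comment> \<open>The bound \<open>7 * \<epsilon> \<le> 2\<close> keeps such values away from the nonzero even integers as well.\<close>
  have far: "\<not> \<bar>d - 2 * of_int i\<bar> < \<epsilon>" if "2 * \<epsilon> \<le> \<bar>d\<bar>" "\<bar>d\<bar> \<le> 6 * \<epsilon>" for d and i :: int
  proof (cases "i = 0")
    case False
    then have "1 \<le> \<bar>real_of_int i\<bar>" by linarith
    then show ?thesis using that \<epsilon> by linarith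
  qed (use that \<epsilon> in simp)
  obtain k :: int where k: "\<bar>u t + v t - 2 * of_int k\<bar> < \<epsilon>"
    using zigzag_close[OF close[OF t(1)]] far[of "u t - v t"] t(2) \<epsilon>(1) by auto
  have ut: "u 0 \<le> u t" "v 0 \<le> v t" using mono t(1) by (auto dest: monoD)
  show False
  proof (cases "k \<le> 0")
    case True
    then have "real_of_int k \<le> 0" by simp
    then show ?thesis using k ut start t(2) by linarith
  next
    case False
    then have k1: "1 \<le> real_of_int k" by linarith
    have "continuous_on {0..t} (\<lambda>t. u t + v t)"
      by (intro continuous_intros continuous_on_subset[OF cont(1)] continuous_on_subset[OF cont(2)]) auto
    then have "\<exists>s\<ge>0. s \<le> t \<and> u s + v s = 2 * of_int k - \<epsilon>"
      using start t(1) k k1 \<epsilon> by (intro IVT') auto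
    then obtain s where s: "0 \<le> s" "s \<le> t" "u s + v s = 2 * of_int k - \<epsilon>" by blast
    have us: "u s \<le> u t" "v s \<le> v t" using mono s(2) by (auto dest: monoD)
    have w: "2 * \<epsilon> \<le> \<bar>u s - v s\<bar>" "\<bar>u s - v s\<bar> \<le> 6 * \<epsilon>"
      using us t(2) s(3) k by linarith+
    obtain i :: int where i: "\<bar>u s + v s - 2 * of_int i\<bar> < \<epsilon>"
      using zigzag_close[OF close[OF s(1)]] far[OF w] by auto
    have "i \<noteq> k" using i s(3) \<epsilon> by auto
    then have "1 \<le> \<bar>real_of_int k - of_int i\<bar>" by linarith
    then show False using i s(3) \<epsilon> by linarith
  qed
qed

definition has_slope :: "(real \<Rightarrow> real) \<Rightarrow> real \<Rightarrow> bool"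
  where "has_slope A q \<longleftrightarrow> (\<exists>B. \<forall>t. \<bar>A t - q * t\<bar> \<le> B)"

lemma has_slope_unique:
  assumes "has_slope A q" "has_slope A r" shows "q = r"
proof (rule ccontr)
  assume neq: "q \<noteq> r"
  obtain B C where B: "\<And>t. \<bar>A t - q * t\<bar> \<le> B" and C: "\<And>t. \<bar>A t - r * t\<bar> \<le> C"
    using assms unfolding has_slope_def by blast
  define t where "t = (B + C + 1) / (q - r)"
  have "(q - r) * t = B + C + 1" using neq by (simp add: t_def)
  then show False using B[of t] C[of t] by (simp add: algebra_simps)
qed

lemma has_slope_bounded_diff:
  assumes "has_slope A q" "\<And>t. \<bar>A t - A' t\<bar> \<le> C" shows "has_slope A' q"
proof -
  obtain B where B: "\<And>t. \<bar>A t - q * t\<bar> \<le> B"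
    using assms(1) unfolding has_slope_def by blast
  have "\<bar>A' t - q * t\<bar> \<le> B + C" for t
    using B[of t] assms(2)[of t] by linarith
  then show ?thesis unfolding has_slope_def by blast
qed

lemma has_slope_compose:
  assumes "has_slope A q" "has_slope A' r" shows "has_slope (\<lambda>t. A (A' t)) (q * r)"
proof -
  obtain B C where B: "\<And>t. \<bar>A t - q * t\<bar> \<le> B" and C: "\<And>t. \<bar>A' t - r * t\<bar> \<le> C"
    using assms unfolding has_slope_def by blast
  have "\<bar>A (A' t) - q * r * t\<bar> \<le> B + \<bar>q\<bar> * C" for t
  proof -
    have "A (A' t) - q * r * t = (A (A' t) - q * A' t) + q * (A' t - r * t)"
      by (simp add: algebra_simps)
    also have "\<bar>\<dots>\<bar> \<le> \<bar>A (A' t) - q * A' t\<bar> + \<bar>q\<bar> * \<bar>A' t - r * t\<bar>"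
      by (metis abs_mult abs_triangle_ineq)
    also have "\<dots> \<le> B + \<bar>q\<bar> * C"
      using B[of "A' t"] C[of t] by (intro add_mono mult_left_mono) auto
    finally show ?thesis .
  qed
  then show ?thesis unfolding has_slope_def by blast
qed

lemma has_slope_linear: "has_slope (\<lambda>t. q * t) q"
  unfolding has_slope_def by (intro exI[of _ 0]) simp

lemma has_slope_quasi_periodic:
  assumes cont: "continuous_on UNIV A" and d: "0 < d"
    and per: "\<And>t (j::int). \<bar>A (t + 2 * d * of_int j) - A t - 2 * e * of_int j\<bar> \<le> \<epsilon>"
  shows "has_slope A (e / d)"
proof -
  have "bounded (A ` {0..2 * d})"
    by (intro compact_imp_bounded compact_continuous_image continuous_on_subset[OF cont]) auto
  then obtain M where M: "\<And>t. t \<in> {0..2 * d} \<Longrightarrow> \<bar>A t\<bar> \<le> M"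
    by (metis (no_types, lifting) bounded_real imageI)
  have "\<bar>A t - e / d * t\<bar> \<le> M + \<epsilon> + 2 * \<bar>e\<bar>" for t
  proof -
    define j where "j = \<lfloor>t / (2 * d)\<rfloor>"
    define s where "s = t - 2 * d * of_int j"
    have "of_int j \<le> t / (2 * d)" "t / (2 * d) < of_int j + 1"
      unfolding j_def by linarith+
    then have s: "0 \<le> s" "s \<le> 2 * d"
      using d by (simp_all add: s_def field_simps)
    have t: "t = s + 2 * d * of_int j" by (simp add: s_def)
    have 1: "e / d * t = e / d * s + 2 * e * of_int j"
      unfolding t using d by (simp add: field_simps)
    have "\<bar>e / d * s\<bar> = \<bar>e\<bar> * (s / d)" using s d by (simp add: abs_mult)
    also have "\<dots> \<le> \<bar>e\<bar> * 2" using s d by (intro mult_left_mono) (auto simp: divide_le_eq)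
    finally have 2: "\<bar>e / d * s\<bar> \<le> 2 * \<bar>e\<bar>" by simp
    have 3: "\<bar>A t - A s - 2 * e * of_int j\<bar> \<le> \<epsilon>" using per[of s j] by (simp add: t)
    have "\<bar>A s\<bar> \<le> M" using M s by simp
    then show ?thesis using 1 2 3 by linarith
  qed
  then show ?thesis unfolding has_slope_def by blast
qed

context knaster_open_map
begin

definition lifts :: "(real \<Rightarrow> real) \<Rightarrow> bool"
  where "lifts A \<longleftrightarrow> continuous_on UNIV A \<and> (\<forall>t. A (- t) = - A t) \<and> mono A \<and>
    (\<forall>t. f (S.ray t) = T.ray (A t))"

lemma ex_lifts: "\<exists>A. lifts A"
  using lift_exists lift_mono unfolding lifts_def by metis

text \<open>By \<open>nearly_factors\<close>, the level \<open>q n\<close> along \<open>f (ray t)\<close> has near period \<open>2 D N\<close>, and the error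
  is the same for all multiples of the period. By \<open>mono_lifts_close\<close> the translates of \<open>A\<close> therefore
  differ from \<open>A\<close> by nearly constant amounts \<open>2 E n * K j\<close>; since the error does not accumulate, the
  integers \<open>K j\<close> are additive in \<open>j\<close>.\<close>

lemma lifts_quasi_periodic:
  assumes A: "lifts A" and \<epsilon>: "0 < \<epsilon>"
  shows "\<exists>N k::nat. \<forall>t (j::int).
    \<bar>A (t + 2 * real (D N) * of_int j) - A t - 2 * (real (E n) * real k) * of_int j\<bar> \<le> \<epsilon>"
proof -
  have cont: "continuous_on UNIV A" and odd: "A (- t) = - A t" and mono: "mono A"
    and lift: "f (S.ray t) = T.ray (A t)" for t
    using A unfolding lifts_def by blast+
  have En: "0 < real (E n)" using T.D_pos by simp
  \<comment> \<open>The factor 4 comes from \<open>mono_lifts_close\<close>; the bound \<open>1 / 8\<close> makes \<open>6 * \<eta>\<close> smaller than 2,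
    the gap between even integers.\<close>
  define \<eta> where "\<eta> = min (\<epsilon> / (4 * E n)) (1 / 8)"
  have \<eta>: "0 < \<eta>" "\<eta> \<le> 1 / 8" "4 * \<eta> * E n \<le> \<epsilon>"
  proof -
    show "0 < \<eta>" "\<eta> \<le> 1 / 8" using \<epsilon> En by (auto simp: \<eta>_def)
    have "\<eta> \<le> \<epsilon> / (4 * E n)" by (simp add: \<eta>_def)
    then show "4 * \<eta> * E n \<le> \<epsilon>" using En by (simp add: field_simps)
  qed
  obtain N where N: "\<And>x y. x \<in> topspace X \<Longrightarrow> y \<in> topspace X \<Longrightarrow> p N x = p N y \<Longrightarrow>
      \<bar>q n (f x) - q n (f y)\<bar> < \<eta>"
    using S.nearly_factors[OF continuous_level[of n] \<eta>(1)] by blast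
  define d where "d = 2 * real (D N)"
  have d: "0 < d" using S.D_pos by (simp add: d_def)
  define u where "u t = A t / E n" for t
  have zu: "zigzag (u t) = q n (f (S.ray t))" for t
    by (simp add: u_def lift T.ray(2))
  have u0: "u 0 = 0" using odd[of 0] by (simp add: u_def)
  have per: "\<bar>zigzag (u (t + d * of_int j)) - zigzag (u t)\<bar> < \<eta>" for t and j :: int
    unfolding zu d_def by (intro N S.ray(1)) (use S.p_ray_shift[of N t j] in simp)
  have "\<exists>k::int. \<bar>u (d * of_int j) - 2 * of_int k\<bar> < \<eta>" for j :: int
    using per[of 0 j] u0 zigzag_bounds(1)[of "u (d * of_int j)"] by (intro zigzag_small) auto
  then obtain K :: "int \<Rightarrow> int" where K: "\<And>j. \<bar>u (d * of_int j) - 2 * of_int (K j)\<bar> < \<eta>"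
    by metis
  have uc: "continuous_on S u" for S
    unfolding u_def using En by (intro continuous_intros continuous_on_subset[OF cont]) auto
  have um: "mono u"
  proof (rule monoI)
    fix s t :: real assume "s \<le> t"
    then have "A s \<le> A t" by (rule monoD[OF mono])
    then show "u s \<le> u t" using En by (simp add: u_def divide_right_mono)
  qed
  have near: "\<bar>u t - (u (t + d * of_int j) - 2 * of_int (K j))\<bar> \<le> 4 * \<eta>" if t: "0 \<le> t" for t and j :: int
  proof (rule mono_lifts_close[OF uc _ um _ \<eta>(1) _ _ _ _ t])
    show "continuous_on UNIV (\<lambda>t. u (t + d * of_int j) - 2 * of_int (K j))"
      by (intro continuous_intros continuous_on_compose2[OF uc[of UNIV]]) auto
    show "mono (\<lambda>t. u (t + d * of_int j) - 2 * of_int (K j))"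
    proof (rule monoI)
      fix s t :: real assume "s \<le> t"
      then have "u (s + d * of_int j) \<le> u (t + d * of_int j)" by (intro monoD[OF um]) simp
      then show "u (s + d * of_int j) - 2 * of_int (K j) \<le> u (t + d * of_int j) - 2 * of_int (K j)"
        by simp
    qed
    show "\<bar>zigzag (u t) - zigzag (u (t + d * of_int j) - 2 * of_int (K j))\<bar> < \<eta>" for t
      using per[of t j] zigzag_shift[of "u (t + d * of_int j)" "- K j"] by (simp add: abs_minus_commute)
    show "\<bar>u (0 + d * of_int j) - 2 * of_int (K j)\<bar> < \<eta>" using K[of j] by simp
    show "\<bar>u 0\<bar> < \<eta>" using u0 \<eta>(1) by simp
    show "7 * \<eta> \<le> 2" using \<eta>(2) by simp
  qed
  have K_add: "K (j + 1) = K j + K 1" for j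
  proof -
    have "\<bar>u d - (u (d * of_int (j + 1)) - 2 * of_int (K j))\<bar> \<le> 4 * \<eta>"
      using near[of d j] d by (simp add: algebra_simps)
    moreover have "\<bar>u d - 2 * of_int (K 1)\<bar> < \<eta>" using K[of 1] by simp
    moreover have "\<bar>u (d * of_int (j + 1)) - 2 * of_int (K (j + 1))\<bar> < \<eta>" by (rule K)
    moreover have "\<bar>a + b - c\<bar> < 1"
      if "\<bar>x - (y - 2 * b)\<bar> \<le> 4 * \<eta>" "\<bar>x - 2 * a\<bar> < \<eta>" "\<bar>y - 2 * c\<bar> < \<eta>" for a b c x y
      using that \<eta>(2) by linarith
    ultimately have "\<bar>real_of_int (K 1) + of_int (K j) - of_int (K (j + 1))\<bar> < 1" by blast
    then show ?thesis by linarith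
  qed
  have K0: "K 0 = 0"
  proof -
    have "\<bar>2 * real_of_int (K 0)\<bar> < \<eta>" using K[of 0] u0 by simp
    then show ?thesis using \<eta>(2) by linarith
  qed
  have K_mult: "K j = j * K 1" for j
  proof (induction j rule: int_induct[of _ 0])
    case (step1 i) then show ?case using K_add[of i] by (simp add: algebra_simps)
  next
    case (step2 i) then show ?case using K_add[of "i - 1"] by (simp add: algebra_simps)
  qed (simp add: K0)
  have "0 \<le> u d" using monoD[OF um, of 0 d] d u0 by simp
  moreover have "\<bar>u d - 2 * of_int (K 1)\<bar> < \<eta>" using K[of 1] by simp
  ultimately have "0 \<le> K 1" using \<eta>(2) by linarith
  then obtain k :: nat where k: "K 1 = int k" using nonneg_int_cases by blast
  have pos: "\<bar>A (t + d * of_int j) - A t - 2 * (real (E n) * real k) * of_int j\<bar> \<le> \<epsilon>" if "0 \<le> t" for t and j :: int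
  proof -
    have "A (t + d * of_int j) - A t - 2 * (real (E n) * real k) * of_int j =
        E n * - (u t - (u (t + d * of_int j) - 2 * of_int (K j)))"
      using En by (simp add: u_def K_mult[of j] k field_simps)
    then have "\<bar>A (t + d * of_int j) - A t - 2 * (real (E n) * real k) * of_int j\<bar> =
        E n * \<bar>u t - (u (t + d * of_int j) - 2 * of_int (K j))\<bar>"
      using En by (simp add: abs_mult)
    also have "\<dots> \<le> E n * (4 * \<eta>)" using near[OF that, of j] En by simp
    also have "\<dots> \<le> \<epsilon>" using \<eta>(3) by (simp add: mult_ac)
    finally show ?thesis .
  qed
  have "\<bar>A (t + d * of_int j) - A t - 2 * (real (E n) * real k) * of_int j\<bar> \<le> \<epsilon>" for t and j :: int
  proof (cases "0 \<le> t")
    case False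
    have "- t + d * of_int (- j) = - (t + d * of_int j)" by simp
    then have "A (t + d * of_int j) = - A (- t + d * of_int (- j))"
      by (simp only: odd minus_minus)
    moreover have "A t = - A (- t)" using odd[of t] by simp
    ultimately show ?thesis using pos[of "- t" "- j"] False by simp
  qed (use pos in blast)
  then show ?thesis unfolding d_def by blast
qed

text \<open>The slope is rational with denominators from the source and numerators from the target, for
  every level \<open>n\<close> of the target. It is positive because \<open>A\<close> is unbounded.\<close>

lemma lifts_slope:
  assumes A: "lifts A"
  shows "\<exists>r>0. has_slope A r \<and> (\<forall>n. \<forall>\<epsilon>>0. \<exists>N k::nat. r * real (D N) = real (E n) * real k \<and>
    (\<forall>t (j::int). \<bar>A (t + 2 * real (D N) * of_int j) - A t - 2 * (real (E n) * real k) * of_int j\<bar> \<le> \<epsilon>))"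
proof -
  have cont: "continuous_on UNIV A" using A by (simp add: lifts_def)
  have slope: "has_slope A (real (E n) * real k / real (D N))"
    if "\<And>t (j::int). \<bar>A (t + 2 * real (D N) * of_int j) - A t - 2 * (real (E n) * real k) * of_int j\<bar> \<le> \<epsilon>"
    for n N k \<epsilon>
    using has_slope_quasi_periodic[OF cont _ that] S.D_pos by simp
  obtain N k where "\<And>t (j::int).
      \<bar>A (t + 2 * real (D N) * of_int j) - A t - 2 * (real (E 0) * real k) * of_int j\<bar> \<le> 1"
    using lifts_quasi_periodic[OF A, of 1 0] by auto
  then have slope0: "has_slope A (real (E 0) * real k / real (D N))" by (rule slope)
  define r where "r = real (E 0) * real k / real (D N)"
  have "r \<noteq> 0"
  proof
    assume "r = 0"
    then obtain B where "\<And>t. \<bar>A t\<bar> \<le> B"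
      using slope0 unfolding has_slope_def r_def[symmetric] by auto
    then show False using onto_unbounded[of A B] A unfolding lifts_def by blast
  qed
  moreover have "0 \<le> r" by (simp add: r_def)
  ultimately have "0 < r" by simp
  have main: "\<exists>N k::nat. r * real (D N) = real (E n) * real k \<and>
    (\<forall>t (j::int). \<bar>A (t + 2 * real (D N) * of_int j) - A t - 2 * (real (E n) * real k) * of_int j\<bar> \<le> \<epsilon>)"
    if \<epsilon>: "0 < \<epsilon>" for n \<epsilon>
  proof -
    obtain N k where Nk: "\<And>t (j::int).
      \<bar>A (t + 2 * real (D N) * of_int j) - A t - 2 * (real (E n) * real k) * of_int j\<bar> \<le> \<epsilon>"
      using lifts_quasi_periodic[OF A \<epsilon>, of n] by auto
    from slope[OF this] have "r = real (E n) * real k / real (D N)"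
      unfolding r_def by (rule has_slope_unique[OF slope0])
    then have "r * real (D N) = real (E n) * real k" using S.D_pos[of N] by simp
    with Nk show ?thesis by (intro exI[of _ N] exI[of _ k]) simp
  qed
  have "has_slope A r" using slope0 by (simp only: r_def)
  moreover have "\<forall>n. \<forall>\<epsilon>>0. \<exists>N k::nat. r * real (D N) = real (E n) * real k \<and>
    (\<forall>t (j::int). \<bar>A (t + 2 * real (D N) * of_int j) - A t - 2 * (real (E n) * real k) * of_int j\<bar> \<le> \<epsilon>)"
    by (intro allI impI) (rule main)
  ultimately show ?thesis
    using \<open>0 < r\<close> by (intro exI[of _ r] conjI)
qed

text \<open>The fixed slope \<open>r\<close> satisfies \<open>r * D N = E n * k\<close> for every \<open>n\<close>; comparing \<open>n = 0\<close> with an \<open>n\<close>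
  for which \<open>E n\<close> has many divisors, these divisors must appear in \<open>D N\<close>.\<close>

lemma source_cofinal:
  assumes m: "0 < m" shows "\<exists>k. m dvd D k"
proof -
  obtain A where "lifts A" using ex_lifts by blast
  from lifts_slope[OF this] obtain r where r: "0 < r" and
    all: "\<forall>n. \<forall>\<epsilon>>0. \<exists>N k::nat. r * real (D N) = real (E n) * real k \<and>
    (\<forall>t (j::int). \<bar>A (t + 2 * real (D N) * of_int j) - A t - 2 * (real (E n) * real k) * of_int j\<bar> \<le> \<epsilon>)"
    by (elim exE conjE)
  have rk: "\<exists>N k::nat. r * real (D N) = real (E n) * real k" for n
    using all[rule_format, OF zero_less_one, of n] by (elim exE conjE) (intro exI)
  obtain N0 k0 :: nat where 0: "r * real (D N0) = real k0"
    using rk[of 0] T.D_0 by auto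
  have "0 < r * real (D N0)" using r S.D_pos[of N0] by simp
  then have "0 < k0" using 0 by simp
  then obtain n where "k0 * m dvd E n" using T.cofinal[of "k0 * m"] m by auto
  then obtain e where e: "E n = k0 * m * e" by blast
  obtain N k :: nat where Nk: "r * real (D N) = real (E n) * real k" using rk by blast
  have "real k0 * real (D N) = real (E n) * real k * real (D N0)"
    unfolding 0[symmetric] Nk[symmetric] by (simp add: mult_ac)
  then have "k0 * D N = E n * k * D N0"
    by (metis of_nat_eq_iff of_nat_mult)
  then have "k0 * D N = k0 * (m * (e * k * D N0))" by (simp add: e mult_ac)
  then have "D N = m * (e * k * D N0)" using \<open>0 < k0\<close> by simp
  then show ?thesis by (metis dvd_triv_left)
qed

end


section \<open>Knaster continua as divisibility chains\<close>

lemma topspace_interval_inverse_limit: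
  "topspace (interval_inverse_limit T) = {x. \<forall>n. x n \<in> {0..1} \<and> x n = T n (x (Suc n))}"
proof -
  have "topspace (product_topology (\<lambda>_::nat. unit_interval) UNIV) = {x. \<forall>n. x n \<in> {0..1}}"
    by (auto simp: PiE_iff)
  then show ?thesis
    unfolding interval_inverse_limit_def topspace_subtopology by blast
qed

lemma continuous_map_interval_inverse_limit_proj:
  "continuous_map (interval_inverse_limit T) unit_interval (\<lambda>x. x n)"
  unfolding interval_inverse_limit_def
  using continuous_map_from_subtopology[OF continuous_map_product_projection[of n UNIV "\<lambda>_. unit_interval"]]
  by simp

lemma compact_interval_inverse_limit:
  assumes T: "\<And>n. continuous_map unit_interval unit_interval (T n)"
  shows "compact_space (interval_inverse_limit T)"
proof -
  let ?P = "product_topology (\<lambda>_::nat. unit_interval) UNIV"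
  have proj: "continuous_map ?P unit_interval (\<lambda>x. x n)" for n
    by (rule continuous_map_product_projection) simp
  have "closedin ?P {x \<in> topspace ?P. x n = T n (x (Suc n))}" for n
  proof (rule closedin_continuous_maps_eq)
    show "continuous_map ?P unit_interval (\<lambda>x. T n (x (Suc n)))"
      using continuous_map_compose[OF proj T] by (simp add: o_def)
  qed (use proj in \<open>auto simp: Hausdorff_space_subtopology\<close>)
  then have "closedin ?P (\<Inter>n. {x \<in> topspace ?P. x n = T n (x (Suc n))})"
    by (intro closedin_INT) auto
  moreover have "compact_space ?P"
    by (simp add: compact_space_product_topology compact_space_subtopology)
  ultimately have "compactin ?P (\<Inter>n. {x \<in> topspace ?P. x n = T n (x (Suc n))})"
    by (rule closedin_compact_space[rotated])
  then have "compact_space (subtopology ?P (\<Inter>n. {x \<in> topspace ?P. x n = T n (x (Suc n))}))"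
    by (rule compact_space_subtopology)
  moreover have "subtopology ?P (\<Inter>n. {x \<in> topspace ?P. x n = T n (x (Suc n))}) = interval_inverse_limit T"
  proof -
    have "(\<Inter>n. {x \<in> topspace ?P. x n = T n (x (Suc n))}) = topspace ?P \<inter> {x. \<forall>n. x n = T n (x (Suc n))}"
      by auto
    then show ?thesis
      unfolding interval_inverse_limit_def by (metis subtopology_restrict)
  qed
  ultimately show ?thesis by simp
qed

text \<open>Each change of variable \<open>g k\<close> is absorbed into the next bonding map, which stays open and
  again has the normal form of \<open>open_map_eq_tent\<close>.\<close>

lemma knaster_bonding_conjugates:
  assumes "knaster_bonding T"
  shows "\<exists>g d. (\<forall>k. increasing_homeo (g k)) \<and>
    (\<forall>k. 0 < d k \<and> (\<forall>x\<in>{0..1}. g k (T k x) = zigzag (real (d k) * g (Suc k) x)))"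
proof -
  have "\<exists>g. \<forall>k. increasing_homeo (g k) \<and>
      (\<exists>n>0. \<forall>x\<in>{0..1}. g k (T k x) = zigzag (real n * g (Suc k) x))"
  proof (rule dependent_nat_choice[where P = "\<lambda>_. increasing_homeo" and
        Q = "\<lambda>k g g'. \<exists>n>0. \<forall>x\<in>{0..1}. g (T k x) = zigzag (real n * g' x)"])
    show "\<exists>g. increasing_homeo g"
      by (intro exI[of _ "\<lambda>x. x"]) (simp add: increasing_homeo_def strict_mono_on_def)
    fix g k assume g: "increasing_homeo g"
    have T: "continuous_map unit_interval unit_interval (T k)" "open_map unit_interval unit_interval (T k)"
      "T k 0 = 0"
      using assms by (simp_all add: knaster_bonding_def)
    have h: "homeomorphic_map unit_interval unit_interval g"
      using g by (rule increasing_homeo_homeomorphic_map)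
    have "continuous_map unit_interval unit_interval (\<lambda>x. g (T k x))"
      using continuous_map_compose[OF T(1) homeomorphic_imp_continuous_map[OF h]] by (simp only: o_def)
    moreover have "open_map unit_interval unit_interval (\<lambda>x. g (T k x))"
      using open_map_compose[OF T(2) homeomorphic_imp_open_map[OF h]] by (simp only: o_def)
    moreover have "g (T k 0) = 0" using T(3) g by (simp add: increasing_homeo_def)
    ultimately obtain n g' where "n > 0" "increasing_homeo g'"
      "\<forall>x\<in>{0..1}. g (T k x) = zigzag (real n * g' x)"
      using open_map_eq_tent[of "\<lambda>x. g (T k x)"] by auto
    then show "\<exists>g'. increasing_homeo g' \<and> (\<exists>n>0. \<forall>x\<in>{0..1}. g (T k x) = zigzag (real n * g' x))"
      by blast
  qed
  then obtain g where g: "\<And>k. increasing_homeo (g k)"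
    "\<And>k. \<exists>n>0. \<forall>x\<in>{0..1}. g k (T k x) = zigzag (real n * g (Suc k) x)"
    by blast
  have "\<forall>k. \<exists>n. 0 < n \<and> (\<forall>x\<in>{0..1}. g k (T k x) = zigzag (real n * g (Suc k) x))"
    by (rule allI) (rule g(2))
  then have "\<exists>d. \<forall>k. 0 < d k \<and> (\<forall>x\<in>{0..1}. g k (T k x) = zigzag (real (d k) * g (Suc k) x))"
    by (rule choice)
  then obtain d where "\<forall>k. 0 < d k \<and> (\<forall>x\<in>{0..1}. g k (T k x) = zigzag (real (d k) * g (Suc k) x))" ..
  moreover have "\<forall>k. increasing_homeo (g k)" by (rule allI) (rule g(1))
  ultimately show ?thesis by (intro exI[of _ g] exI[of _ d] conjI)
qed

lemma knaster_continuum_chain: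
  assumes "knaster_continuum X"
  shows "\<exists>D p. knaster_chain X D p"
proof -
  obtain T where T: "knaster_bonding T" "X homeomorphic_space interval_inverse_limit T"
    using assms unfolding knaster_continuum_def by blast
  let ?L = "interval_inverse_limit T"
  obtain \<Psi> where \<Psi>: "homeomorphic_map X ?L \<Psi>"
    using T(2) unfolding homeomorphic_space by blast
  have Tc: "continuous_map unit_interval unit_interval (T n)" and TI: "T n ` {0..1} = {0..1}" for n
    using T(1) by (simp_all add: knaster_bonding_def)
  obtain g d where g: "\<And>k. increasing_homeo (g k)" and d: "\<And>k. 0 < d k"
    and gd: "\<And>k x. x \<in> {0..1} \<Longrightarrow> g k (T k x) = zigzag (real (d k) * g (Suc k) x)"
    using knaster_bonding_conjugates[OF T(1)] by blast
  have \<Psi>_bij: "\<Psi> ` topspace X = topspace ?L" "inj_on \<Psi> (topspace X)"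
    using \<Psi> by (simp_all add: homeomorphic_imp_surjective_map homeomorphic_imp_injective_map)
  have \<Psi>_in: "\<Psi> x k \<in> {0..1}" "\<Psi> x k = T k (\<Psi> x (Suc k))" if "x \<in> topspace X" for x k
  proof -
    have "\<Psi> x \<in> topspace ?L" using \<Psi>_bij(1) that by blast
    then show "\<Psi> x k \<in> {0..1}" "\<Psi> x k = T k (\<Psi> x (Suc k))"
      unfolding topspace_interval_inverse_limit by blast+
  qed
  define D where "D k = (\<Prod>i<k. d i)" for k
  define p where "p k x = g k (\<Psi> x k)" for k x
  have D_pos: "0 < D k" for k
    using d by (simp add: D_def prod_pos)
  have D_div: "D (Suc k) div D k = d k" for k
    using D_pos[of k] by (simp add: D_def)
  have "knaster_chain X D p"
  proof
    show "compact_space X"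
      using T(2) compact_interval_inverse_limit[of T] Tc homeomorphic_compact_space by blast
    show "continuous_map X euclideanreal (p k)" for k
    proof -
      have 1: "continuous_map X unit_interval (\<lambda>x. \<Psi> x k)"
        using continuous_map_compose[OF homeomorphic_imp_continuous_map[OF \<Psi>]
            continuous_map_interval_inverse_limit_proj[of T k]] by (simp add: o_def)
      have 2: "continuous_map unit_interval euclideanreal (g k)"
        using g[of k] by (simp add: increasing_homeo_def)
      have "p k = (\<lambda>x. g k (\<Psi> x k))" by (simp add: fun_eq_iff p_def)
      with continuous_map_compose[OF 1 2] show ?thesis
        by (simp add: o_def)
    qed
    show "p k x \<in> {0..1}" if "x \<in> topspace X" for k x
      using \<Psi>_in(1)[OF that, of k] increasing_homeo_image[OF g[of k]] unfolding p_def by blast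
    show "p k x = zigzag (real (D (Suc k) div D k) * p (Suc k) x)" if "x \<in> topspace X" for k x
    proof -
      have "p k x = g k (T k (\<Psi> x (Suc k)))"
        unfolding p_def using \<Psi>_in(2)[OF that, of k] by (rule arg_cong)
      then show ?thesis
        using gd[OF \<Psi>_in(1)[OF that]] by (simp only: D_div p_def)
    qed
    show "x = y" if xy: "x \<in> topspace X" "y \<in> topspace X" "\<And>k. p k x = p k y" for x y
    proof -
      have "\<Psi> x k = \<Psi> y k" for k
        using inj_onD[OF increasing_homeo_inj[OF g[of k]]] xy(3)[of k] \<Psi>_in(1)[OF xy(1), of k]
          \<Psi>_in(1)[OF xy(2), of k] unfolding p_def by blast
      then have "\<Psi> x = \<Psi> y" by blast
      then show ?thesis using inj_onD[OF \<Psi>_bij(2)] xy(1,2) by blast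
    qed
    show "\<exists>x\<in>topspace X. \<forall>k. p k x = c k"
      if c: "\<And>k. c k \<in> {0..1}" "\<And>k. c k = zigzag (real (D (Suc k) div D k) * c (Suc k))" for c
    proof -
      have "\<exists>y\<in>{0..1}. g k y = c k" for k
        using c(1)[of k] increasing_homeo_image[OF g[of k]] by (metis imageE)
      then obtain y where y: "\<And>k. y k \<in> {0..1}" "\<And>k. g k (y k) = c k" by metis
      have "y k = T k (y (Suc k))" for k
      proof (rule inj_onD[OF increasing_homeo_inj[OF g[of k]]])
        show "g k (y k) = g k (T k (y (Suc k)))"
          using c(2)[of k] y(2) gd[OF y(1), of k "Suc k"] by (simp only: D_div)
        show "T k (y (Suc k)) \<in> {0..1}" using TI[of k] y(1) by blast
      qed (rule y)
      then have "y \<in> topspace ?L"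
        using y(1) unfolding topspace_interval_inverse_limit by blast
      then obtain x where "x \<in> topspace X" "\<Psi> x = y" using \<Psi>_bij(1) by (metis imageE)
      then show ?thesis using y(2) by (auto simp: p_def)
    qed
  qed (use D_pos in \<open>auto simp: D_def\<close>)
  then show ?thesis by blast
qed

text \<open>The quotients of consecutive factorials are \<open>Suc n\<close>, so these bonding maps give the Knaster
  continuum of the chain of factorials, in which every positive integer divides a member.\<close>

definition factorial_tent :: "nat \<Rightarrow> real \<Rightarrow> real"
  where "factorial_tent n x = zigzag (real (Suc n) * x)"

text \<open>A point \<open>v\<close> close to \<open>zigzag t\<close> is \<open>zigzag\<close> of a point equally close to \<open>t\<close>, on the same side of
  the same even integer. If that point leaves \<open>[0, n]\<close>, reflecting it at the end brings it back
  without increasing the distance.\<close>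

lemma tent_open_map:
  assumes n: "0 < n"
  shows "open_map unit_interval unit_interval (\<lambda>x. zigzag (real n * x))"
  unfolding open_map_def
proof (intro allI impI)
  fix U assume U: "openin unit_interval U"
  then have UI: "U \<subseteq> {0..1}" using openin_subset[OF U] by simp
  show "openin unit_interval ((\<lambda>x. zigzag (real n * x)) ` U)"
    unfolding openin_euclidean_subtopology_iff
  proof (intro conjI ballI)
    show "(\<lambda>x. zigzag (real n * x)) ` U \<subseteq> {0..1}" using zigzag_bounds by auto
    fix w assume "w \<in> (\<lambda>x. zigzag (real n * x)) ` U"
    then obtain x where x: "x \<in> U" "w = zigzag (real n * x)" by blast
    obtain e where e: "e > 0" "\<And>y. y \<in> {0..1} \<Longrightarrow> \<bar>y - x\<bar> < e \<Longrightarrow> y \<in> U"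
      using U x(1) unfolding openin_euclidean_subtopology_iff dist_real_def by blast
    obtain i where i: "w = \<bar>real n * x - 2 * of_int i\<bar>" using zigzag_nearest x(2) by blast
    have nx: "0 \<le> real n * x" "real n * x \<le> real n"
      using UI x(1) by (auto simp: mult_le_cancel_left2)
    have "v \<in> (\<lambda>x. zigzag (real n * x)) ` U" if v: "v \<in> {0..1}" "dist v w < real n * e" for v
    proof -
      define t where "t = (if real n * x - 2 * of_int i \<ge> 0 then 2 * of_int i + v else 2 * of_int i - v)"
      have t: "\<bar>t - real n * x\<bar> = \<bar>v - w\<bar>" unfolding t_def i by auto
      have "\<bar>t - 2 * of_int i\<bar> = v" using v(1) by (auto simp: t_def)
      then have zt: "zigzag t = v" using zigzag_eqI[of t i] v(1) by simp
      \<comment> \<open>Reflect \<open>t\<close> into \<open>[0, n]\<close>.\<close>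
      define r where "r = (if t < 0 then - t else if t > real n then - t + 2 * of_int (int n) else t)"
      have zr: "zigzag r = v"
      proof -
        have "zigzag (- t + 2 * of_int (int n)) = zigzag (- t)" by (rule zigzag_shift)
        then show ?thesis using zt by (simp add: r_def)
      qed
      have r: "\<bar>r - real n * x\<bar> \<le> \<bar>t - real n * x\<bar>" using nx by (auto simp: r_def)
      then have close: "\<bar>r - real n * x\<bar> < real n * e" using t v(2) by (simp add: dist_real_def)
      have "r \<in> {0..real n}"
      proof -
        have "w \<le> 1" "0 \<le> w" using x(2) zigzag_bounds by auto
        then have "\<bar>t - real n * x\<bar> \<le> 1" using t v(1) by auto
        moreover have "1 \<le> real n" using n by simp
        moreover consider "t < 0" | "real n < t" | "0 \<le> t \<and> t \<le> real n" by linarith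
        then have "r = - t \<and> t < 0 \<or> r = - t + 2 * real n \<and> real n < t \<or> r = t \<and> 0 \<le> t \<and> t \<le> real n"
          unfolding r_def of_int_of_nat_eq by cases auto
        ultimately show ?thesis using nx unfolding atLeastAtMost_iff by linarith
      qed
      then have "r / real n \<in> {0..1}" using n by (auto simp: divide_le_eq)
      moreover have "\<bar>r / real n - x\<bar> < e"
      proof -
        have "r / real n - x = (r - real n * x) / real n" using n by (simp add: field_simps)
        then have "\<bar>r / real n - x\<bar> = \<bar>r - real n * x\<bar> / real n" by simp
        then show ?thesis using close n by (simp add: divide_less_eq mult.commute)
      qed
      ultimately have "r / real n \<in> U" by (rule e(2))
      moreover have "zigzag (real n * (r / real n)) = v" using zr n by simp
      ultimately show ?thesis by (metis (mono_tags, lifting) imageI)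
    qed
    then show "\<exists>e>0. \<forall>v\<in>{0..1}. dist v w < e \<longrightarrow> v \<in> (\<lambda>x. zigzag (real n * x)) ` U"
      using e(1) n by (intro exI[of _ "real n * e"]) auto
  qed
qed

lemma knaster_bonding_factorial_tent: "knaster_bonding factorial_tent"
  unfolding knaster_bonding_def
proof (intro allI conjI)
  fix n
  show "continuous_map unit_interval unit_interval (factorial_tent n)"
    using zigzag_bounds unfolding factorial_tent_def continuous_map_subtopology_eu
    by (auto intro!: continuous_intros)
  show "open_map unit_interval unit_interval (factorial_tent n)"
    unfolding factorial_tent_def using tent_open_map[of "Suc n"] by simp
  show "factorial_tent n 0 = 0" by (simp add: factorial_tent_def)
  show "factorial_tent n ` {0..1} = {0..1}"
  proof
    show "factorial_tent n ` {0..1} \<subseteq> {0..1}"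
      using zigzag_bounds by (auto simp: factorial_tent_def)
    show "{0..1} \<subseteq> factorial_tent n ` {0..1}"
    proof
      fix v :: real assume v: "v \<in> {0..1}"
      then have "v / real (Suc n) \<in> {0..1}" "factorial_tent n (v / real (Suc n)) = v"
        by (auto simp: factorial_tent_def zigzag_unit divide_le_eq simp del: of_nat_Suc)
      then show "v \<in> factorial_tent n ` {0..1}" by (metis imageI)
    qed
  qed
qed

lemma factorial_knaster_cofinal:
  "knaster_cofinal (interval_inverse_limit factorial_tent) fact (\<lambda>k x. x k)"
proof
  let ?Y = "interval_inverse_limit factorial_tent"
  have tent: "factorial_tent k y = zigzag (real (fact (Suc k) div fact k) * y)" for k y
  proof -
    have "(fact (Suc k) :: nat) div fact k = Suc k" by simp
    then show ?thesis by (simp only: factorial_tent_def)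
  qed
  show "compact_space ?Y"
    using knaster_bonding_factorial_tent by (intro compact_interval_inverse_limit) (simp add: knaster_bonding_def)
  show "continuous_map ?Y euclideanreal (\<lambda>x. x k)" for k
    using continuous_map_interval_inverse_limit_proj by (rule continuous_map_into_fulltopology)
  show "x k \<in> {0..1}" "x k = zigzag (real (fact (Suc k) div fact k) * x (Suc k))"
    if "x \<in> topspace ?Y" for x k
    using that unfolding topspace_interval_inverse_limit tent by blast+
  show "x = y" if "\<And>k. x k = y k" for x y :: "nat \<Rightarrow> real"
    by (rule ext) (rule that)
  show "\<exists>x\<in>topspace ?Y. \<forall>k. x k = c k"
    if "\<And>k. c k \<in> {0..1}" "\<And>k. c k = zigzag (real (fact (Suc k) div fact k) * c (Suc k))" for c
    using that unfolding topspace_interval_inverse_limit tent by blast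
  show "\<exists>k. m dvd fact k" if "0 < m" for m :: nat
    using that by (intro exI[of _ m]) (simp add: dvd_fact)
  show "fact 0 = (1 :: nat)" by simp
  show "(fact k :: nat) dvd fact (Suc k)" for k by (rule fact_dvd) simp
  show "0 < (fact k :: nat)" for k by simp
qed

text \<open>Universality provides an open surjection onto the Knaster continuum of the chain of
  factorials, to which \<open>source_cofinal\<close> applies.\<close>

theorem universal_knaster_cofinal:
  assumes "universal_knaster_continuum X"
  shows "\<exists>D p. knaster_cofinal X D p"
proof -
  let ?Y = "interval_inverse_limit factorial_tent"
  have "knaster_continuum X"
    using assms by (simp add: universal_knaster_continuum_def)
  from knaster_continuum_chain[OF this] obtain D p where S: "knaster_chain X D p"
    by (elim exE)
  have Y: "knaster_continuum ?Y"
    unfolding knaster_continuum_def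
    by (intro exI[of _ factorial_tent] conjI knaster_bonding_factorial_tent homeomorphic_space_refl)
  have "\<forall>Y :: (nat \<Rightarrow> real) topology. knaster_continuum Y \<longrightarrow>
      (\<exists>f. continuous_map X Y f \<and> open_map X Y f \<and> f ` topspace X = topspace Y)"
    using assms by (simp add: universal_knaster_continuum_def)
  from this[THEN spec, THEN mp, OF Y] obtain f where
    f: "continuous_map X ?Y f" "open_map X ?Y f" "f ` topspace X = topspace ?Y"
    by (elim exE conjE)
  interpret f: knaster_open_map X D p ?Y fact "\<lambda>k x. x k" f
    using S factorial_knaster_cofinal f by (simp add: knaster_open_map_def knaster_open_map_axioms_def)
  have "knaster_cofinal X D p"
    using S f.source_cofinal by (simp add: knaster_cofinal_def knaster_cofinal_axioms_def)
  then show ?thesis by blast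
qed


section \<open>Homeomorphism groups of compact metric spaces\<close>

lemma homeo_group_carrier:
  "f \<in> carrier (homeo_group X) \<longleftrightarrow> f \<in> Bij (topspace X) \<and> homeomorphic_map X X f"
  by (simp add: homeo_group_def)

lemma homeo_groupI:
  assumes "f \<in> extensional (topspace X)" "continuous_map X X f" "continuous_map X X g"
    and "\<And>x. x \<in> topspace X \<Longrightarrow> g (f x) = x" "\<And>x. x \<in> topspace X \<Longrightarrow> f (g x) = x"
  shows "f \<in> carrier (homeo_group X)"
proof -
  have "homeomorphic_maps X X f g"
    using assms by (simp add: homeomorphic_maps_def)
  then have "homeomorphic_map X X f"
    using homeomorphic_map_maps by blast
  moreover have "bij_betw f (topspace X) (topspace X)"
    using assms continuous_map_image_subset_topspace by (intro bij_betwI[of _ _ _ g]) (auto simp: continuous_map_def)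
  ultimately show ?thesis
    using assms(1) by (simp add: homeo_group_carrier Bij_def)
qed

lemma subgroup_homeo_group:
  "subgroup {f \<in> Bij (topspace X). homeomorphic_map X X f} (BijGroup (topspace X))"
proof (rule group.subgroupI[OF group_BijGroup])
  show "{f \<in> Bij (topspace X). homeomorphic_map X X f} \<subseteq> carrier (BijGroup (topspace X))"
    by (auto simp: BijGroup_def)
  have "homeomorphic_map X X (restrict id (topspace X))"
    using homeomorphic_map_eq[of X X id "restrict id (topspace X)"] by simp
  then show "{f \<in> Bij (topspace X). homeomorphic_map X X f} \<noteq> {}"
    using id_Bij[of "topspace X"] by (auto simp: id_def)
next
  fix f assume f: "f \<in> {f \<in> Bij (topspace X). homeomorphic_map X X f}"
  then obtain g where g: "homeomorphic_maps X X f g"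
    using homeomorphic_map_maps by blast
  have inj: "inj_on f (topspace X)" "f ` topspace X = topspace X"
    using f by (auto simp: Bij_def bij_betw_def)
  have "homeomorphic_map X X (restrict (inv_into (topspace X) f) (topspace X))"
  proof (rule homeomorphic_map_eq[of X X g])
    show "homeomorphic_map X X g"
      using g homeomorphic_maps_sym homeomorphic_map_maps by blast
    fix x assume x: "x \<in> topspace X"
    then have "f (g x) = x" "g x \<in> topspace X"
      using g by (auto simp: homeomorphic_maps_def continuous_map_def)
    then show "g x = restrict (inv_into (topspace X) f) (topspace X) x"
      using x inj(1) inv_into_f_eq[of f "topspace X" "g x" x] by simp
  qed
  then show "inv\<^bsub>BijGroup (topspace X)\<^esub> f \<in> {f \<in> Bij (topspace X). homeomorphic_map X X f}"
    using f by (simp add: inv_BijGroup restrict_inv_into_Bij)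
next
  fix f g assume fg: "f \<in> {f \<in> Bij (topspace X). homeomorphic_map X X f}"
    "g \<in> {f \<in> Bij (topspace X). homeomorphic_map X X f}"
  have "homeomorphic_map X X (compose (topspace X) f g)"
    by (rule homeomorphic_map_eq[of X X "f \<circ> g"])
       (use fg homeomorphic_map_compose in \<open>auto simp: compose_def\<close>)
  then show "f \<otimes>\<^bsub>BijGroup (topspace X)\<^esub> g \<in> {f \<in> Bij (topspace X). homeomorphic_map X X f}"
    using fg by (simp add: BijGroup_def compose_Bij)
qed

lemma group_homeo_group: "group (homeo_group X)"
  unfolding homeo_group_def
  by (rule group.subgroup_imp_group[OF group_BijGroup subgroup_homeo_group])

lemma homeo_group_mult:
  "\<lbrakk>f \<in> carrier (homeo_group X); g \<in> carrier (homeo_group X)\<rbrakk> \<Longrightarrow>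
    f \<otimes>\<^bsub>homeo_group X\<^esub> g = compose (topspace X) f g"
  by (simp add: homeo_group_def BijGroup_def)

lemma homeo_group_one: "\<one>\<^bsub>homeo_group X\<^esub> = (\<lambda>x\<in>topspace X. x)"
  by (simp add: homeo_group_def BijGroup_def)

lemma homeo_group_ext:
  "\<lbrakk>f \<in> carrier (homeo_group X); g \<in> carrier (homeo_group X);
    \<And>x. x \<in> topspace X \<Longrightarrow> f x = g x\<rbrakk> \<Longrightarrow> f = g"
  by (rule extensionalityI[of _ "topspace X"]) (auto simp: homeo_group_carrier Bij_def)

lemma homeo_group_continuous: "f \<in> carrier (homeo_group X) \<Longrightarrow> continuous_map X X f"
  by (simp add: homeo_group_carrier homeomorphic_imp_continuous_map)

lemma homeo_group_in: "f \<in> carrier (homeo_group X) \<Longrightarrow> x \<in> topspace X \<Longrightarrow> f x \<in> topspace X"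
  using homeo_group_continuous by (fastforce simp: continuous_map_def)

lemma homeo_group_inv:
  assumes f: "f \<in> carrier (homeo_group X)"
  shows "inv\<^bsub>homeo_group X\<^esub> f \<in> carrier (homeo_group X)"
    and "x \<in> topspace X \<Longrightarrow> (inv\<^bsub>homeo_group X\<^esub> f) (f x) = x"
    and "x \<in> topspace X \<Longrightarrow> f ((inv\<^bsub>homeo_group X\<^esub> f) x) = x"
proof -
  interpret group "homeo_group X" by (rule group_homeo_group)
  show i: "inv\<^bsub>homeo_group X\<^esub> f \<in> carrier (homeo_group X)" using f by simp
  have "compose (topspace X) (inv\<^bsub>homeo_group X\<^esub> f) f = (\<lambda>x\<in>topspace X. x)"
    "compose (topspace X) f (inv\<^bsub>homeo_group X\<^esub> f) = (\<lambda>x\<in>topspace X. x)"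
    using l_inv[OF f] r_inv[OF f] homeo_group_mult[OF i f] homeo_group_mult[OF f i]
    by (simp_all add: homeo_group_one)
  then show "x \<in> topspace X \<Longrightarrow> (inv\<^bsub>homeo_group X\<^esub> f) (f x) = x"
    "x \<in> topspace X \<Longrightarrow> f ((inv\<^bsub>homeo_group X\<^esub> f) x) = x"
    by (metis compose_eq restrict_apply')+
qed

locale compact_metric = Metric_space +
  assumes compact: "compact_space mtopology" and nonempty: "M \<noteq> {}"
begin

abbreviation "HG \<equiv> homeo_group mtopology"

lemma HG_in: "f \<in> carrier HG \<Longrightarrow> x \<in> M \<Longrightarrow> f x \<in> M"
  using homeo_group_in[of f mtopology x] by simp

lemma HG_mult: "f \<in> carrier HG \<Longrightarrow> g \<in> carrier HG \<Longrightarrow> x \<in> M \<Longrightarrow> (f \<otimes>\<^bsub>HG\<^esub> g) x = f (g x)"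
  by (simp add: homeo_group_mult compose_eq)

lemma HG_inv:
  assumes "f \<in> carrier HG" "x \<in> M"
  shows "(inv\<^bsub>HG\<^esub> f) (f x) = x" "f ((inv\<^bsub>HG\<^esub> f) x) = x" "(inv\<^bsub>HG\<^esub> f) x \<in> M"
  using homeo_group_inv[OF assms(1)] HG_in[of "inv\<^bsub>HG\<^esub> f" x] assms(2) by simp_all

lemma HG_fspace: "carrier HG \<subseteq> fspace M"
proof
  fix f assume f: "f \<in> carrier HG"
  have "f ` M \<subseteq> M" using HG_in[OF f] by blast
  moreover have "mbounded M"
    using compact compactin_imp_mbounded by (simp add: compact_space_def)
  ultimately have "mbounded (f ` M)" using mbounded_subset by blast
  then show "f \<in> fspace M"
    using f \<open>f ` M \<subseteq> M\<close> by (auto simp: fspace_def homeo_group_carrier Bij_def)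
qed

lemma HG_dist_le:
  "f \<in> carrier HG \<Longrightarrow> g \<in> carrier HG \<Longrightarrow> fdist M f g \<le> a \<longleftrightarrow> (\<forall>x\<in>M. d (f x) (g x) \<le> a)"
  using HG_fspace nonempty by (intro funspace_mdist_le) auto

lemma HG_dist_ge: "f \<in> carrier HG \<Longrightarrow> g \<in> carrier HG \<Longrightarrow> x \<in> M \<Longrightarrow> d (f x) (g x) \<le> fdist M f g"
  using HG_dist_le by blast

sublocale H: Metric_space "carrier HG" "fdist M"
  by (rule Metric_space.subspace[OF Metric_space_funspace HG_fspace])

lemma HG_topology: "homeo_group_topology M d = H.mtopology"
  by (simp add: homeo_group_topology_def)

lemma uniformly_continuous_self:
  assumes "continuous_map mtopology mtopology f" "0 < \<epsilon>"
  shows "\<exists>\<delta>>0. \<forall>x\<in>M. \<forall>y\<in>M. d x y < \<delta> \<longrightarrow> d (f x) (f y) < \<epsilon>"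
proof -
  have "compact_space (mtopology_of Self)" using compact by (simp add: mtopology_of_def)
  then have "uniformly_continuous_map Self Self f"
    using continuous_eq_uniformly_continuous_map[of Self Self f] assms(1) by (simp add: mtopology_of_def)
  then have "\<exists>\<delta>>0. \<forall>x\<in>M. \<forall>y\<in>M. d y x < \<delta> \<longrightarrow> d (f y) (f x) < \<epsilon>"
    using assms(2) unfolding uniformly_continuous_map_def by simp
  then show ?thesis by blast
qed

text \<open>Uniform continuity of \<open>f\<close> controls \<open>f \<circ> g\<close> under changes of \<open>g\<close>; and since the supremum over
  \<open>x\<close> equals the supremum over \<open>g x\<close>, the distance of the inverses of \<open>f\<close> and \<open>g\<close> is controlled by
  the uniform continuity of the inverse of \<open>f\<close>.\<close>

lemma topological_group_HG: "topological_group HG H.mtopology"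
  unfolding topological_group_def
proof (intro conjI)
  show "group HG" by (rule group_homeo_group)
  then interpret G: group HG .
  show "topspace H.mtopology = carrier HG" by simp
  show "continuous_map (prod_topology H.mtopology H.mtopology) H.mtopology (\<lambda>(x, y). x \<otimes>\<^bsub>HG\<^esub> y)"
    unfolding H.continuous_map_to_metric
  proof (intro ballI allI impI)
    fix z and \<epsilon> :: real
    assume "z \<in> topspace (prod_topology H.mtopology H.mtopology)" and \<epsilon>: "0 < \<epsilon>"
    then obtain f g where z: "z = (f, g)" "f \<in> carrier HG" "g \<in> carrier HG" by auto
    obtain \<delta> where \<delta>: "\<delta> > 0" "\<And>x y. x \<in> M \<Longrightarrow> y \<in> M \<Longrightarrow> d x y < \<delta> \<Longrightarrow> d (f x) (f y) < \<epsilon> / 3"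
      using uniformly_continuous_self[OF homeo_group_continuous[OF z(2)], of "\<epsilon> / 3"] \<epsilon> by auto
    have "(case w of (x, y) \<Rightarrow> x \<otimes>\<^bsub>HG\<^esub> y) \<in> H.mball (case z of (x, y) \<Rightarrow> x \<otimes>\<^bsub>HG\<^esub> y) \<epsilon>"
      if w': "w \<in> H.mball f (\<epsilon> / 3) \<times> H.mball g \<delta>" for w
    proof -
      obtain f' g' where w: "w = (f', g')" "f' \<in> carrier HG" "g' \<in> carrier HG"
        "fdist M f f' < \<epsilon> / 3" "fdist M g g' < \<delta>"
        using w' by (auto simp: H.in_mball)
      have "d ((f \<otimes>\<^bsub>HG\<^esub> g) x) ((f' \<otimes>\<^bsub>HG\<^esub> g') x) \<le> 2 * \<epsilon> / 3" if x: "x \<in> M" for x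
      proof -
        have gx: "g x \<in> M" "g' x \<in> M" using z w x HG_in by auto
        have "d (g x) (g' x) < \<delta>" using HG_dist_ge[OF z(3) w(3) x] w(5) by simp
        then have "d (f (g x)) (f (g' x)) < \<epsilon> / 3" using \<delta>(2) gx by blast
        moreover have "d (f (g' x)) (f' (g' x)) < \<epsilon> / 3"
          using HG_dist_ge[OF z(2) w(2) gx(2)] w(4) by simp
        moreover have "d (f (g x)) (f' (g' x)) \<le> d (f (g x)) (f (g' x)) + d (f (g' x)) (f' (g' x))"
          using gx z w HG_in by (intro triangle) auto
        ultimately show ?thesis using z w x by (simp add: HG_mult)
      qed
      then have "fdist M (f \<otimes>\<^bsub>HG\<^esub> g) (f' \<otimes>\<^bsub>HG\<^esub> g') \<le> 2 * \<epsilon> / 3"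
        using z w by (subst HG_dist_le) auto
      then show ?thesis using z w \<epsilon> by (simp add: H.in_mball)
    qed
    moreover have "z \<in> H.mball f (\<epsilon> / 3) \<times> H.mball g \<delta>" using z \<epsilon> \<delta>(1) by simp
    moreover have "openin (prod_topology H.mtopology H.mtopology) (H.mball f (\<epsilon> / 3) \<times> H.mball g \<delta>)"
      by (simp add: openin_prod_Times_iff)
    ultimately show "\<exists>U. openin (prod_topology H.mtopology H.mtopology) U \<and> z \<in> U \<and>
        (\<forall>w\<in>U. (case w of (x, y) \<Rightarrow> x \<otimes>\<^bsub>HG\<^esub> y) \<in> H.mball (case z of (x, y) \<Rightarrow> x \<otimes>\<^bsub>HG\<^esub> y) \<epsilon>)"
      by (intro exI[of _ "H.mball f (\<epsilon> / 3) \<times> H.mball g \<delta>"] conjI ballI)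
  qed
  show "continuous_map H.mtopology H.mtopology (\<lambda>x. inv\<^bsub>HG\<^esub> x)"
    unfolding H.continuous_map_to_metric
  proof (intro ballI allI impI)
    fix f and \<epsilon> :: real
    assume "f \<in> topspace H.mtopology" and \<epsilon>: "0 < \<epsilon>"
    then have f: "f \<in> carrier HG" by simp
    have fi: "inv\<^bsub>HG\<^esub> f \<in> carrier HG" using f by simp
    obtain \<delta> where \<delta>: "\<delta> > 0" "\<And>x y. x \<in> M \<Longrightarrow> y \<in> M \<Longrightarrow> d x y < \<delta> \<Longrightarrow>
        d ((inv\<^bsub>HG\<^esub> f) x) ((inv\<^bsub>HG\<^esub> f) y) < \<epsilon> / 2"
      using uniformly_continuous_self[OF homeo_group_continuous[OF fi], of "\<epsilon> / 2"] \<epsilon> by auto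
    have "inv\<^bsub>HG\<^esub> g \<in> H.mball (inv\<^bsub>HG\<^esub> f) \<epsilon>" if "g \<in> H.mball f \<delta>" for g
    proof -
      have g: "g \<in> carrier HG" "fdist M f g < \<delta>" using that by (auto simp: H.in_mball)
      have "d ((inv\<^bsub>HG\<^esub> f) x) ((inv\<^bsub>HG\<^esub> g) x) \<le> \<epsilon> / 2" if x: "x \<in> M" for x
      proof -
        define y where "y = (inv\<^bsub>HG\<^esub> g) x"
        have y: "y \<in> M" "g y = x" using HG_inv[OF g(1) x] by (simp_all add: y_def)
        have "d (g y) (f y) < \<delta>" using HG_dist_ge[OF f g(1) y(1)] g(2) by (simp add: commute)
        then have "d ((inv\<^bsub>HG\<^esub> f) (g y)) ((inv\<^bsub>HG\<^esub> f) (f y)) < \<epsilon> / 2"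
          using y(1) f g(1) HG_in by (intro \<delta>(2)) auto
        then show ?thesis using HG_inv(1)[OF f y(1)] y(2) by (simp add: y_def)
      qed
      then have "fdist M (inv\<^bsub>HG\<^esub> f) (inv\<^bsub>HG\<^esub> g) \<le> \<epsilon> / 2"
        using f g by (subst HG_dist_le) auto
      then show ?thesis using f g \<epsilon> by (simp add: H.in_mball)
    qed
    moreover have "f \<in> H.mball f \<delta>" using f \<delta>(1) by simp
    ultimately show "\<exists>U. openin H.mtopology U \<and> f \<in> U \<and> (\<forall>g\<in>U. inv\<^bsub>HG\<^esub> g \<in> H.mball (inv\<^bsub>HG\<^esub> f) \<epsilon>)"
      by (intro exI[of _ "H.mball f \<delta>"] conjI ballI) auto
  qed
qed

text \<open>Up to a small error, a homeomorphism is determined by a modulus of continuity and by the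
  approximate values on a finite net; there are countably many such data. Choosing one homeomorphism
  for each realizable datum gives a dense set.\<close>

lemma separable_HG: "separable_space H.mtopology"
proof -
  have "mtotally_bounded M"
    using compact compactin_imp_mtotally_bounded by (simp add: compact_space_def)
  then have "\<exists>F. finite F \<and> F \<subseteq> M \<and> M \<subseteq> (\<Union>x\<in>F. mball x (1 / Suc n))" for n
    unfolding mtotally_bounded_def by simp
  then obtain F where F: "\<And>n. finite (F n)" "\<And>n. F n \<subseteq> M" "\<And>n. M \<subseteq> (\<Union>x\<in>F n. mball x (1 / Suc n))"
    by metis
  define P where "P n m c h \<longleftrightarrow> h \<in> carrier HG \<and> (\<forall>x\<in>F n. d (h x) (c x) < 1 / Suc m) \<and>
    (\<forall>x\<in>M. \<forall>y\<in>M. d x y < 1 / Suc n \<longrightarrow> d (h x) (h y) < 1 / Suc m)" for n m c h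
  define \<C> where "\<C> = (\<Union>n m. {(n, m, c) | c. c \<in> F n \<rightarrow>\<^sub>E F m \<and> (\<exists>h. P n m c h)})"
  define S where "S = (\<lambda>(n, m, c). SOME h. P n m c h) ` \<C>"
  have "countable \<C>"
  proof -
    have "finite {(n, m, c) | c. c \<in> F n \<rightarrow>\<^sub>E F m \<and> (\<exists>h. P n m c h)}" for n m
    proof (rule finite_subset)
      show "{(n, m, c) | c. c \<in> F n \<rightarrow>\<^sub>E F m \<and> (\<exists>h. P n m c h)} \<subseteq> (\<lambda>c. (n, m, c)) ` (F n \<rightarrow>\<^sub>E F m)"
        by blast
      show "finite ((\<lambda>c. (n, m, c)) ` (F n \<rightarrow>\<^sub>E F m))"
        using F(1) by (intro finite_imageI finite_PiE)
    qed
    then have "countable {(n, m, c) | c. c \<in> F n \<rightarrow>\<^sub>E F m \<and> (\<exists>h. P n m c h)}" for n m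
      by (rule countable_finite)
    then show ?thesis
      unfolding \<C>_def by (intro countable_UN) simp_all
  qed
  then have "countable S" by (simp add: S_def)
  have S: "\<exists>h\<in>S. P n m c h" if "c \<in> F n \<rightarrow>\<^sub>E F m" "P n m c h" for n m c h
  proof -
    have "(n, m, c) \<in> \<C>" using that by (auto simp: \<C>_def)
    then have "(SOME h. P n m c h) \<in> S" by (force simp: S_def)
    moreover have "P n m c (SOME h. P n m c h)" using someI[of "P n m c", OF that(2)] by simp
    ultimately show ?thesis by blast
  qed
  have SH: "S \<subseteq> carrier HG"
  proof
    fix h assume "h \<in> S"
    then obtain n m c where h: "h = (SOME h. P n m c h)" "\<exists>h. P n m c h"
      by (auto simp: S_def \<C>_def)
    then have "P n m c h" using someI_ex[OF h(2)] by simp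
    then show "h \<in> carrier HG" by (simp add: P_def)
  qed
  have dense: "\<exists>h\<in>S. h \<in> H.mball f \<epsilon>" if f: "f \<in> carrier HG" and \<epsilon>: "0 < \<epsilon>" for f \<epsilon>
  proof -
    obtain m where m: "1 / Suc m < \<epsilon> / 4" using nat_approx_posE[of "\<epsilon> / 4"] \<epsilon> by auto
    obtain \<delta> where \<delta>: "\<delta> > 0" "\<And>x y. x \<in> M \<Longrightarrow> y \<in> M \<Longrightarrow> d x y < \<delta> \<Longrightarrow> d (f x) (f y) < 1 / Suc m"
      using uniformly_continuous_self[OF homeo_group_continuous[OF f], of "1 / Suc m"] by auto
    obtain n where n: "1 / Suc n < \<delta>" using nat_approx_posE[OF \<delta>(1)] by auto
    have "\<exists>y\<in>F m. d (f x) y < 1 / Suc m" if xM: "x \<in> M" for x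
    proof -
      obtain y where "y \<in> F m" "f x \<in> mball y (1 / Suc m)" using F(3)[of m] HG_in[OF f xM] by blast
      then show ?thesis by (auto simp: commute intro!: bexI[of _ y])
    qed
    then obtain c0 where c0: "\<And>x. x \<in> M \<Longrightarrow> c0 x \<in> F m" "\<And>x. x \<in> M \<Longrightarrow> d (f x) (c0 x) < 1 / Suc m"
      by metis
    define c where "c = restrict c0 (F n)"
    have c: "c \<in> F n \<rightarrow>\<^sub>E F m" "\<And>x. x \<in> F n \<Longrightarrow> d (f x) (c x) < 1 / Suc m"
      using c0 F(2)[of n] by (auto simp: c_def)
    have "P n m c f"
      unfolding P_def using f c(2) \<delta>(2) n by (auto intro: less_trans)
    then obtain h where h: "h \<in> S" "P n m c h" using S[OF c(1)] by blast
    have hG: "h \<in> carrier HG" using h(2) by (simp add: P_def)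
    have "d (f y) (h y) \<le> 4 * (1 / Suc m)" if y: "y \<in> M" for y
    proof -
      obtain x where x: "x \<in> F n" "d x y < 1 / Suc n" using F(3)[of n] y by auto
      have xM: "x \<in> M" using x(1) F(2) by blast
      have cM: "c x \<in> M" using c(1) x(1) F(2) by (auto simp: PiE_iff)
      have "d (f y) (f x) < 1 / Suc m" using \<delta>(2)[of y x] x xM y n commute by auto
      moreover have "d (f x) (c x) < 1 / Suc m" using c(2)[OF x(1)] .
      moreover have "d (h x) (c x) < 1 / Suc m" using h(2) x(1) by (simp add: P_def)
      moreover have "d (h x) (h y) < 1 / Suc m" using h(2) x xM y by (simp add: P_def)
      moreover have "d (f y) (h y) \<le> d (f y) (f x) + d (f x) (h y)"
        "d (f x) (h y) \<le> d (f x) (c x) + d (c x) (h y)" "d (c x) (h y) \<le> d (c x) (h x) + d (h x) (h y)"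
        using HG_in[OF f] HG_in[OF hG] xM y cM by (auto intro!: triangle)
      ultimately show ?thesis by (simp add: commute)
    qed
    then have "fdist M f h \<le> 4 * (1 / Suc m)" using f hG by (subst HG_dist_le) auto
    then have "h \<in> H.mball f \<epsilon>" using m f hG by (simp add: H.in_mball)
    then show ?thesis using h(1) by blast
  qed
  have "H.mtopology closure_of S = topspace H.mtopology"
    using dense by (auto simp: H.metric_closure_of)
  then show ?thesis
    unfolding separable_space_def using \<open>countable S\<close> SH by auto
qed

text \<open>The supremum metric is usually incomplete on homeomorphisms; adding the distance of the
  inverses gives a complete metric with the same topology.\<close>

definition "HG_complete_dist f g = fdist M f g + fdist M (inv\<^bsub>HG\<^esub> f) (inv\<^bsub>HG\<^esub> g)"

lemma completely_metrizable_HG: "completely_metrizable_space H.mtopology"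
proof -
  interpret G: group HG by (rule group_homeo_group)
  interpret C: Metric_space "carrier HG" HG_complete_dist
  proof
    fix f g h
    show "0 \<le> HG_complete_dist f g"
      by (simp add: HG_complete_dist_def)
    show "HG_complete_dist f g = HG_complete_dist g f"
      by (simp add: HG_complete_dist_def H.commute)
    assume fgh: "f \<in> carrier HG" "g \<in> carrier HG"
    show "(HG_complete_dist f g = 0) = (f = g)"
      using fgh H.nonneg[of f g] H.nonneg[of "inv\<^bsub>HG\<^esub> f" "inv\<^bsub>HG\<^esub> g"] unfolding HG_complete_dist_def
      by (metis H.zero G.inv_closed add_nonneg_eq_0_iff)
    assume "h \<in> carrier HG"
    then show "HG_complete_dist f h \<le> HG_complete_dist f g + HG_complete_dist g h"
      unfolding HG_complete_dist_def
      using fgh H.triangle[of f g h] H.triangle[of "inv\<^bsub>HG\<^esub> f" "inv\<^bsub>HG\<^esub> g" "inv\<^bsub>HG\<^esub> h"] by simp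
  qed
  have "C.mtopology = H.mtopology"
    unfolding topology_eq
  proof (intro allI iffI)
    fix U assume "openin H.mtopology U"
    then have U: "U \<subseteq> carrier HG" "\<And>f. f \<in> U \<Longrightarrow> \<exists>r>0. H.mball f r \<subseteq> U"
      unfolding H.openin_mtopology by auto
    have "C.mball f r \<subseteq> H.mball f r" for f r
      using H.nonneg by (auto simp: C.in_mball H.in_mball HG_complete_dist_def) (smt (verit) H.nonneg)
    then show "openin C.mtopology U"
      unfolding C.openin_mtopology using U by (meson subset_trans)
  next
    fix U assume "openin C.mtopology U"
    then have U: "U \<subseteq> carrier HG" "\<And>f. f \<in> U \<Longrightarrow> \<exists>r>0. C.mball f r \<subseteq> U"
      unfolding C.openin_mtopology by auto
    show "openin H.mtopology U"
      unfolding H.openin_mtopology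
    proof (intro conjI allI impI)
      fix f assume f: "f \<in> U"
      then obtain r where r: "r > 0" "C.mball f r \<subseteq> U" using U(2) by blast
      have fG: "f \<in> carrier HG" using f U(1) by blast
      have "continuous_map H.mtopology H.mtopology (\<lambda>x. inv\<^bsub>HG\<^esub> x)"
        using topological_group_HG by (simp add: topological_group_def)
      note a = this[unfolded H.metric_continuous_map[OF H.Metric_space_axioms], THEN conjunct2]
      have "\<exists>\<delta>>0. \<forall>x. x \<in> carrier HG \<and> fdist M f x < \<delta> \<longrightarrow>
          fdist M (inv\<^bsub>HG\<^esub> f) (inv\<^bsub>HG\<^esub> x) < r / 2"
        by (rule a[THEN bspec, OF fG, THEN spec, THEN mp]) (use r(1) in simp)
      then obtain \<delta> where \<delta>: "\<delta> > 0" "\<And>x. x \<in> carrier HG \<Longrightarrow> fdist M f x < \<delta> \<Longrightarrow>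
          fdist M (inv\<^bsub>HG\<^esub> f) (inv\<^bsub>HG\<^esub> x) < r / 2"
        by blast
      have "H.mball f (min \<delta> (r / 2)) \<subseteq> C.mball f r"
      proof
        fix x assume "x \<in> H.mball f (min \<delta> (r / 2))"
        then have x: "x \<in> carrier HG" "fdist M f x < \<delta>" "fdist M f x < r / 2" by (auto simp: H.in_mball)
        then show "x \<in> C.mball f r"
          using \<delta>(2)[OF x(1,2)] fG by (simp add: C.in_mball HG_complete_dist_def)
      qed
      then show "\<exists>r>0. H.mball f r \<subseteq> U"
        using \<delta>(1) r by (intro exI[of _ "min \<delta> (r / 2)"]) auto
    qed (use U in auto)
  qed
  moreover have "C.mcomplete"
    unfolding C.mcomplete_def
  proof (intro allI impI)
    fix \<sigma> assume "C.MCauchy \<sigma>"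
    then have \<sigma>: "\<sigma> n \<in> carrier HG"
      and cau: "\<And>\<epsilon>. \<epsilon> > 0 \<Longrightarrow> \<exists>N. \<forall>n n'. N \<le> n \<longrightarrow> N \<le> n' \<longrightarrow> HG_complete_dist (\<sigma> n) (\<sigma> n') < \<epsilon>" for n
      unfolding C.MCauchy_def by auto
    define \<rho> where "\<rho> n = inv\<^bsub>HG\<^esub> (\<sigma> n)" for n
    have \<rho>: "\<rho> n \<in> carrier HG" for n using \<sigma> by (simp add: \<rho>_def)
    have lim: "\<exists>g. continuous_map mtopology mtopology g \<and>
        (\<forall>\<epsilon>>0. \<forall>\<^sub>F n in sequentially. \<forall>x\<in>M. d (s n x) (g x) < \<epsilon>)"
      if s: "\<And>n. s n \<in> carrier HG"
        "\<And>m n. fdist M (s m) (s n) \<le> HG_complete_dist (\<sigma> m) (\<sigma> n)" for s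
    proof -
      have c1: "\<exists>N. \<forall>m n x. N \<le> m \<longrightarrow> N \<le> n \<longrightarrow> x \<in> topspace mtopology \<longrightarrow> d (s m x) (s n x) < \<epsilon>"
        if \<epsilon>: "\<epsilon> > 0" for \<epsilon>
      proof -
        obtain N where N: "\<And>n n'. N \<le> n \<Longrightarrow> N \<le> n' \<Longrightarrow> HG_complete_dist (\<sigma> n) (\<sigma> n') < \<epsilon>"
          using cau[OF \<epsilon>] by blast
        have "d (s m x) (s n x) < \<epsilon>" if "N \<le> m" "N \<le> n" "x \<in> M" for m n x
          using HG_dist_ge[OF s(1) s(1) that(3), of m n] s(2)[of m n] N[OF that(1,2)] by linarith
        then show ?thesis by auto
      qed
      have c2: "\<forall>\<^sub>F n in sequentially. continuous_map mtopology mtopology (s n)"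
        by (intro always_eventually allI homeo_group_continuous s(1))
      show ?thesis
      proof (rule continuous_map_uniformly_Cauchy_limit[OF compact_space_imp_mcomplete[OF compact] c2 c1])
        fix g assume g: "continuous_map mtopology mtopology g"
          "\<And>\<epsilon>. 0 < \<epsilon> \<Longrightarrow> \<forall>\<^sub>F n in sequentially. \<forall>x\<in>topspace mtopology. d (s n x) (g x) < \<epsilon>"
        then show ?thesis by (intro exI[of _ g]) simp
      qed
    qed
    obtain g where g: "continuous_map mtopology mtopology g"
      "\<And>\<epsilon>. \<epsilon> > 0 \<Longrightarrow> \<forall>\<^sub>F n in sequentially. \<forall>x\<in>M. d (\<sigma> n x) (g x) < \<epsilon>"
      using lim[of \<sigma>] \<sigma> H.nonneg by (auto simp: HG_complete_dist_def)
    obtain k where k: "continuous_map mtopology mtopology k"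
      "\<And>\<epsilon>. \<epsilon> > 0 \<Longrightarrow> \<forall>\<^sub>F n in sequentially. \<forall>x\<in>M. d (\<rho> n x) (k x) < \<epsilon>"
      using lim[of \<rho>] \<rho> H.nonneg by (auto simp: HG_complete_dist_def \<rho>_def)
    have gM: "g x \<in> M" "k x \<in> M" if "x \<in> M" for x
      using g(1) k(1) that by (auto simp: continuous_map_def)
    have inverse: "b (a x) = x"
      if a: "continuous_map mtopology mtopology a" "\<And>\<epsilon>. \<epsilon> > 0 \<Longrightarrow> \<forall>\<^sub>F n in sequentially. \<forall>x\<in>M. d (s n x) (a x) < \<epsilon>"
        and b: "continuous_map mtopology mtopology b" "\<And>\<epsilon>. \<epsilon> > 0 \<Longrightarrow> \<forall>\<^sub>F n in sequentially. \<forall>x\<in>M. d (r n x) (b x) < \<epsilon>"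
        and sr: "\<And>n x. x \<in> M \<Longrightarrow> r n (s n x) = x" "\<And>n x. x \<in> M \<Longrightarrow> s n x \<in> M" and x: "x \<in> M" for a b s r x
    proof (rule ccontr)
      assume neq: "b (a x) \<noteq> x"
      have ab: "a x \<in> M" "b (a x) \<in> M" "\<And>y. y \<in> M \<Longrightarrow> b y \<in> M"
        using a(1) b(1) x by (auto simp: continuous_map_def)
      define \<epsilon> where "\<epsilon> = d (b (a x)) x / 2"
      have \<epsilon>: "\<epsilon> > 0" using neq ab x by (simp add: \<epsilon>_def)
      obtain \<delta> where \<delta>: "\<delta> > 0" "\<And>x y. x \<in> M \<Longrightarrow> y \<in> M \<Longrightarrow> d x y < \<delta> \<Longrightarrow> d (b x) (b y) < \<epsilon>"
        using uniformly_continuous_self[OF b(1) \<epsilon>] by blast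
      have "\<forall>\<^sub>F n in sequentially. (\<forall>x\<in>M. d (s n x) (a x) < \<delta>) \<and> (\<forall>x\<in>M. d (r n x) (b x) < \<epsilon>)"
        using a(2)[OF \<delta>(1)] b(2)[OF \<epsilon>] by (rule eventually_conj)
      then obtain n where n: "\<And>x. x \<in> M \<Longrightarrow> d (s n x) (a x) < \<delta>" "\<And>x. x \<in> M \<Longrightarrow> d (r n x) (b x) < \<epsilon>"
        unfolding eventually_sequentially by blast
      have "d (b (s n x)) (b (a x)) < \<epsilon>" using \<delta>(2) n(1) x sr(2) ab(1) by blast
      moreover have "d x (b (s n x)) < \<epsilon>" using n(2)[OF sr(2)[OF x], of n] sr(1)[OF x] by simp
      moreover have "d x (b (a x)) \<le> d x (b (s n x)) + d (b (s n x)) (b (a x))"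
        using x ab sr(2)[OF x] by (intro triangle) auto
      ultimately show False by (simp add: \<epsilon>_def commute)
    qed
    have kg: "k (g x) = x" if "x \<in> M" for x
      by (rule inverse[OF g k _ _ that]) (use HG_inv[OF \<sigma>] HG_in[OF \<sigma>] in \<open>auto simp: \<rho>_def\<close>)
    have gk: "g (k x) = x" if "x \<in> M" for x
      by (rule inverse[OF k g _ _ that]) (use HG_inv[OF \<sigma>] in \<open>auto simp: \<rho>_def\<close>)
    define f where "f = restrict g M"
    have f: "f \<in> carrier HG"
    proof (rule homeo_groupI[of _ _ k])
      show "continuous_map mtopology mtopology f"
        using g(1) by (rule continuous_map_eq) (simp add: f_def)
    qed (use k(1) kg gk gM in \<open>auto simp: f_def\<close>)
    have inv_f: "(inv\<^bsub>HG\<^esub> f) x = k x" if x: "x \<in> M" for x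
    proof -
      have "(inv\<^bsub>HG\<^esub> f) (f (k x)) = k x" using HG_inv(1)[OF f gM(2)[OF x]] .
      then show ?thesis using x gM gk by (simp add: f_def)
    qed
    have "limitin C.mtopology \<sigma> f sequentially"
      unfolding C.limitin_metric
    proof (intro conjI allI impI)
      fix \<epsilon> :: real assume \<epsilon>: "0 < \<epsilon>"
      have "\<forall>\<^sub>F n in sequentially. (\<forall>x\<in>M. d (\<sigma> n x) (g x) < \<epsilon> / 3) \<and> (\<forall>x\<in>M. d (\<rho> n x) (k x) < \<epsilon> / 3)"
        using \<epsilon> by (intro eventually_conj g(2) k(2)) auto
      then show "\<forall>\<^sub>F n in sequentially. \<sigma> n \<in> carrier HG \<and> HG_complete_dist (\<sigma> n) f < \<epsilon>"
      proof (rule eventually_mono)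
        fix n assume n: "(\<forall>x\<in>M. d (\<sigma> n x) (g x) < \<epsilon> / 3) \<and> (\<forall>x\<in>M. d (\<rho> n x) (k x) < \<epsilon> / 3)"
        have "fdist M (\<sigma> n) f \<le> \<epsilon> / 3"
          using n \<sigma> f by (subst HG_dist_le) (auto simp: f_def less_imp_le)
        moreover have "fdist M (\<rho> n) (inv\<^bsub>HG\<^esub> f) \<le> \<epsilon> / 3"
          using n \<rho> f inv_f by (subst HG_dist_le) (auto simp: less_imp_le)
        ultimately show "\<sigma> n \<in> carrier HG \<and> HG_complete_dist (\<sigma> n) f < \<epsilon>"
          using \<sigma> \<epsilon> by (simp add: HG_complete_dist_def \<rho>_def)
      qed
    qed (use f in auto)
    then show "\<exists>f. limitin C.mtopology \<sigma> f sequentially" by blast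
  qed
  ultimately show ?thesis
    using C.completely_metrizable_space_mtopology by simp
qed

end


section \<open>Split extensions of topological groups\<close>

lemma topological_group_mult_continuous:
  assumes "topological_group G \<tau>" "continuous_map Z \<tau> f" "continuous_map Z \<tau> g"
  shows "continuous_map Z \<tau> (\<lambda>z. f z \<otimes>\<^bsub>G\<^esub> g z)"
proof -
  have m: "continuous_map (prod_topology \<tau> \<tau>) \<tau> (\<lambda>(x, y). x \<otimes>\<^bsub>G\<^esub> y)"
    using assms(1) by (simp add: topological_group_def)
  have "continuous_map Z (prod_topology \<tau> \<tau>) (\<lambda>z. (f z, g z))"
    using assms(2,3) by (simp add: continuous_map_pairedI)
  from continuous_map_compose[OF this m] show ?thesis
    by (simp add: o_def)
qed

lemma topological_group_inv_continuous:
  assumes "topological_group G \<tau>" "continuous_map Z \<tau> f"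
  shows "continuous_map Z \<tau> (\<lambda>z. inv\<^bsub>G\<^esub> (f z))"
proof -
  have m: "continuous_map \<tau> \<tau> (\<lambda>x. inv\<^bsub>G\<^esub> x)"
    using assms(1) by (simp add: topological_group_def)
  from continuous_map_compose[OF assms(2) m] show ?thesis
    by (simp add: o_def)
qed

lemma topological_group_subgroup:
  assumes G: "topological_group G \<tau>" and H: "subgroup H G"
  shows "topological_group (G\<lparr>carrier := H\<rparr>) (subtopology \<tau> H)"
proof -
  interpret G: group G using G by (simp add: topological_group_def)
  have ts: "topspace \<tau> = carrier G" using G by (simp add: topological_group_def)
  have HG: "H \<subseteq> carrier G" using H by (rule subgroup.subset)
  have id: "continuous_map (subtopology \<tau> H) \<tau> (\<lambda>x. x)"
    using continuous_map_from_subtopology[OF continuous_map_id[unfolded id_def]] by blast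
  let ?T = "subtopology \<tau> H"
  have "continuous_map (prod_topology ?T ?T) \<tau> (\<lambda>z. fst z \<otimes>\<^bsub>G\<^esub> snd z)"
    using continuous_map_compose[OF continuous_map_fst id] continuous_map_compose[OF continuous_map_snd id]
    by (intro topological_group_mult_continuous[OF G]) (simp_all add: o_def)
  then have "continuous_map (prod_topology ?T ?T) ?T (\<lambda>z. fst z \<otimes>\<^bsub>G\<^esub> snd z)"
    using subgroup.m_closed[OF H] by (intro continuous_map_into_subtopology) auto
  moreover have "continuous_map ?T ?T (\<lambda>x. inv\<^bsub>G\<^esub> x)"
    using topological_group_inv_continuous[OF G id] subgroup.m_inv_closed[OF H]
    by (intro continuous_map_into_subtopology) auto
  then have "continuous_map ?T ?T (\<lambda>x. inv\<^bsub>G\<lparr>carrier := H\<rparr>\<^esub> x)"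
    by (rule continuous_map_eq) (use HG ts G.m_inv_consistent[OF H] in auto)
  ultimately show ?thesis
    unfolding topological_group_def
    using G.subgroup_imp_group[OF H] HG ts by (auto simp: case_prod_unfold)
qed

text \<open>A continuous split surjection onto a discrete group. The action on the kernel is conjugation
  by the section, and \<open>g \<mapsto> (g * inv (s (q g)), q g)\<close> is the isomorphism to the semidirect product;
  its continuity comes from that of \<open>q\<close>, because every map on a discrete space is continuous.\<close>

locale split_topological_extension = G: group G + F: group F + q: group_hom G F q + s: group_hom F G s
  for G :: "('g, 'm) monoid_scheme" and F :: "('f, 'n) monoid_scheme" and q s +
  fixes \<tau> :: "'g topology"
  assumes G_top: "topological_group G \<tau>"
    and q_continuous: "continuous_map \<tau> (discrete_topology (carrier F)) q"
    and q_s: "a \<in> carrier F \<Longrightarrow> q (s a) = a"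
begin

definition "ker = kernel G F q"
definition "U = G\<lparr>carrier := ker\<rparr>"
definition "\<tau>U = subtopology \<tau> ker"
definition "\<phi> = (\<lambda>a. \<lambda>u\<in>ker. s a \<otimes>\<^bsub>G\<^esub> u \<otimes>\<^bsub>G\<^esub> inv\<^bsub>G\<^esub> (s a))"

abbreviation "\<sigma> \<equiv> discrete_topology (carrier F)"

lemma ts: "topspace \<tau> = carrier G" using G_top by (simp add: topological_group_def)

lemma ker_iff: "u \<in> ker \<longleftrightarrow> u \<in> carrier G \<and> q u = \<one>\<^bsub>F\<^esub>"
  by (auto simp: ker_def kernel_def)

lemma ker_subgroup: "subgroup ker G"
  unfolding ker_def by (rule q.subgroup_kernel)

lemma U_carrier: "carrier U = ker" and U_mult: "x \<otimes>\<^bsub>U\<^esub> y = x \<otimes>\<^bsub>G\<^esub> y"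
  by (simp_all add: U_def)

lemma topspace_U: "topspace \<tau>U = ker"
  by (auto simp: \<tau>U_def ts ker_iff)

lemma ker_open: "openin \<tau> ker"
proof -
  have "openin \<tau> {x \<in> topspace \<tau>. q x \<in> {\<one>\<^bsub>F\<^esub>}}"
    by (rule openin_continuous_map_preimage[OF q_continuous]) simp
  moreover have "{x \<in> topspace \<tau>. q x \<in> {\<one>\<^bsub>F\<^esub>}} = ker" by (auto simp: ts ker_iff)
  ultimately show ?thesis by simp
qed

lemma topological_group_U: "topological_group U \<tau>U"
  unfolding U_def \<tau>U_def by (rule topological_group_subgroup[OF G_top ker_subgroup])

lemma cancel: "x \<in> carrier G \<Longrightarrow> y \<in> carrier G \<Longrightarrow> inv\<^bsub>G\<^esub> x \<otimes>\<^bsub>G\<^esub> (x \<otimes>\<^bsub>G\<^esub> y) = y"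
  "x \<in> carrier G \<Longrightarrow> y \<in> carrier G \<Longrightarrow> x \<otimes>\<^bsub>G\<^esub> (inv\<^bsub>G\<^esub> x \<otimes>\<^bsub>G\<^esub> y) = y"
  by (simp_all add: G.m_assoc[symmetric])

lemma \<phi>_apply: "u \<in> ker \<Longrightarrow> \<phi> a u = s a \<otimes>\<^bsub>G\<^esub> u \<otimes>\<^bsub>G\<^esub> inv\<^bsub>G\<^esub> (s a)"
  by (simp add: \<phi>_def)

lemma \<phi>_in: "a \<in> carrier F \<Longrightarrow> u \<in> ker \<Longrightarrow> \<phi> a u \<in> ker"
  by (simp add: \<phi>_apply ker_iff)

lemma \<phi>_hom: "a \<in> carrier F \<Longrightarrow> u \<in> ker \<Longrightarrow> v \<in> ker \<Longrightarrow> \<phi> a (u \<otimes>\<^bsub>G\<^esub> v) = \<phi> a u \<otimes>\<^bsub>G\<^esub> \<phi> a v"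
  using subgroup.m_closed[OF ker_subgroup, of u v]
  by (simp add: \<phi>_apply ker_iff G.m_assoc cancel)

lemma \<phi>_compose:
  "a \<in> carrier F \<Longrightarrow> b \<in> carrier F \<Longrightarrow> u \<in> ker \<Longrightarrow> \<phi> (a \<otimes>\<^bsub>F\<^esub> b) u = \<phi> a (\<phi> b u)"
  using \<phi>_in[of b u] by (simp add: \<phi>_apply ker_iff G.m_assoc G.inv_mult_group)

lemma \<phi>_one: "u \<in> ker \<Longrightarrow> \<phi> \<one>\<^bsub>F\<^esub> u = u"
  by (simp add: \<phi>_apply ker_iff)

lemma \<phi>_Bij: assumes a: "a \<in> carrier F" shows "\<phi> a \<in> Bij ker"
proof -
  have "bij_betw (\<phi> a) ker ker"
    using a \<phi>_in \<phi>_compose[of a "inv\<^bsub>F\<^esub> a"] \<phi>_compose[of "inv\<^bsub>F\<^esub> a" a] \<phi>_one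
    by (intro bij_betwI[of _ _ _ "\<phi> (inv\<^bsub>F\<^esub> a)"]) auto
  then show ?thesis by (simp add: Bij_def \<phi>_def)
qed

lemma continuous_s: "continuous_map (discrete_topology (carrier F)) \<tau> s"
  by (auto simp: ts continuous_map_from_discrete_topology Pi_iff)

lemma continuous_action: "continuous_automorphism_action F \<sigma> U \<tau>U \<phi>"
  unfolding continuous_automorphism_action_def
proof (intro conjI homI)
  fix a b assume a: "a \<in> carrier F"
  have "\<phi> a \<in> hom U U"
    by (rule homI) (use a \<phi>_in \<phi>_hom in \<open>auto simp: U_carrier U_mult\<close>)
  then show "\<phi> a \<in> carrier (AutoGroup U)"
    using \<phi>_Bij[OF a] by (simp add: AutoGroup_def auto_def U_carrier)
  assume b: "b \<in> carrier F"
  have "\<phi> (a \<otimes>\<^bsub>F\<^esub> b) = compose ker (\<phi> a) (\<phi> b)"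
  proof
    fix u show "\<phi> (a \<otimes>\<^bsub>F\<^esub> b) u = compose ker (\<phi> a) (\<phi> b) u"
      using \<phi>_compose[OF a b, of u] by (cases "u \<in> ker") (auto simp: compose_def \<phi>_def)
  qed
  then show "\<phi> (a \<otimes>\<^bsub>F\<^esub> b) = \<phi> a \<otimes>\<^bsub>AutoGroup U\<^esub> \<phi> b"
    using \<phi>_Bij[OF a] \<phi>_Bij[OF b] by (simp add: AutoGroup_def BijGroup_def U_carrier)
next
  let ?Z = "prod_topology \<sigma> \<tau>U"
  have s: "continuous_map ?Z \<tau> (\<lambda>z. s (fst z))"
    using continuous_map_compose[OF continuous_map_fst continuous_s] by (simp add: o_def)
  have u: "continuous_map ?Z \<tau> snd"
    using continuous_map_snd[of \<sigma> \<tau>U] by (simp add: \<tau>U_def continuous_map_in_subtopology)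
  have "continuous_map ?Z \<tau> (\<lambda>z. s (fst z) \<otimes>\<^bsub>G\<^esub> snd z \<otimes>\<^bsub>G\<^esub> inv\<^bsub>G\<^esub> (s (fst z)))"
    by (intro topological_group_mult_continuous[OF G_top] topological_group_inv_continuous[OF G_top] s u)
  then have "continuous_map ?Z \<tau> (\<lambda>(a, u). \<phi> a u)"
    by (rule continuous_map_eq) (auto simp: topspace_U \<phi>_apply)
  then show "continuous_map ?Z \<tau>U (\<lambda>(a, u). \<phi> a u)"
    unfolding \<tau>U_def by (rule continuous_map_into_subtopology) (use \<phi>_in topspace_U in \<open>auto simp flip: \<tau>U_def\<close>)
qed

lemma isomorphic: "topological_group_isomorphic G \<tau> (semidirect_product U F \<phi>) (prod_topology \<tau>U \<sigma>)"
proof -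
  define h where "h g = (g \<otimes>\<^bsub>G\<^esub> inv\<^bsub>G\<^esub> (s (q g)), q g)" for g
  define k where "k = (\<lambda>(u, a). u \<otimes>\<^bsub>G\<^esub> s a)"
  have h_in: "h g \<in> ker \<times> carrier F" if "g \<in> carrier G" for g
    using that q_s by (simp add: h_def ker_iff)
  have k_in: "k z \<in> carrier G" if "z \<in> ker \<times> carrier F" for z
    using that by (auto simp: k_def ker_iff)
  have kh: "k (h g) = g" if "g \<in> carrier G" for g
    using that by (simp add: k_def h_def G.m_assoc)
  have hk: "h (k z) = z" if "z \<in> ker \<times> carrier F" for z
    using that q_s by (auto simp: k_def h_def ker_iff G.m_assoc)
  have cont_h: "continuous_map \<tau> (prod_topology \<tau>U \<sigma>) h"
  proof -
    have sq: "continuous_map \<tau> \<tau> (\<lambda>g. s (q g))"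
      using continuous_map_compose[OF q_continuous continuous_s] by (simp add: o_def)
    have id: "continuous_map \<tau> \<tau> (\<lambda>g. g)" by simp
    have "continuous_map \<tau> \<tau> (\<lambda>g. g \<otimes>\<^bsub>G\<^esub> inv\<^bsub>G\<^esub> (s (q g)))"
      by (intro topological_group_mult_continuous[OF G_top] topological_group_inv_continuous[OF G_top] sq id)
    then have "continuous_map \<tau> \<tau>U (\<lambda>g. g \<otimes>\<^bsub>G\<^esub> inv\<^bsub>G\<^esub> (s (q g)))"
      unfolding \<tau>U_def using h_in ts by (intro continuous_map_into_subtopology) (auto simp: h_def)
    then show ?thesis
      unfolding h_def using q_continuous by (simp add: continuous_map_pairedI)
  qed
  have cont_k: "continuous_map (prod_topology \<tau>U \<sigma>) \<tau> k"
  proof -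
    let ?Z = "prod_topology \<tau>U \<sigma>"
    have s: "continuous_map ?Z \<tau> (\<lambda>z. s (snd z))"
      using continuous_map_compose[OF continuous_map_snd continuous_s] by (simp add: o_def)
    have u: "continuous_map ?Z \<tau> fst"
      using continuous_map_fst[of \<tau>U \<sigma>] by (simp add: \<tau>U_def continuous_map_in_subtopology)
    show ?thesis
      unfolding k_def case_prod_unfold by (intro topological_group_mult_continuous[OF G_top] s u)
  qed
  have maps: "homeomorphic_maps \<tau> (prod_topology \<tau>U \<sigma>) h k"
    unfolding homeomorphic_maps_def using cont_h cont_k kh hk by (auto simp: ts topspace_U)
  have "h \<in> hom G (semidirect_product U F \<phi>)"
  proof (rule homI)
    fix x y assume xy: "x \<in> carrier G" "y \<in> carrier G"
    show "h x \<in> carrier (semidirect_product U F \<phi>)"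
      using h_in[OF xy(1)] by (simp add: semidirect_product_def U_carrier)
    have "\<phi> (q x) (y \<otimes>\<^bsub>G\<^esub> inv\<^bsub>G\<^esub> (s (q y))) =
        s (q x) \<otimes>\<^bsub>G\<^esub> (y \<otimes>\<^bsub>G\<^esub> inv\<^bsub>G\<^esub> (s (q y))) \<otimes>\<^bsub>G\<^esub> inv\<^bsub>G\<^esub> (s (q x))"
      using h_in[OF xy(2)] by (intro \<phi>_apply) (simp add: h_def)
    then show "h (x \<otimes>\<^bsub>G\<^esub> y) = h x \<otimes>\<^bsub>semidirect_product U F \<phi>\<^esub> h y"
      using xy by (simp add: h_def semidirect_product_def U_mult G.m_assoc cancel G.inv_mult_group)
  qed
  moreover have "bij_betw h (carrier G) (carrier (semidirect_product U F \<phi>))"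
  proof (rule bij_betwI[of _ _ _ k])
    show "h \<in> carrier G \<rightarrow> carrier (semidirect_product U F \<phi>)"
      using h_in by (simp add: semidirect_product_def U_carrier)
    show "k \<in> carrier (semidirect_product U F \<phi>) \<rightarrow> carrier G"
      using k_in by (simp add: semidirect_product_def U_carrier Pi_iff)
  qed (use kh hk in \<open>auto simp: semidirect_product_def U_carrier\<close>)
  ultimately have "h \<in> iso G (semidirect_product U F \<phi>)"
    by (simp add: iso_def)
  then show ?thesis
    unfolding topological_group_isomorphic_def using maps homeomorphic_map_maps by blast
qed

end


section \<open>Reflected homeomorphisms of the interval\<close>

text \<open>The increasing homeomorphisms of the unit interval, extended to the line by reflection at the
  integers. On the line they form a group under composition, and they commute with \<open>zigzag\<close>.\<close>

definition periodic_homeo :: "(real \<Rightarrow> real) \<Rightarrow> bool"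
  where "periodic_homeo b \<longleftrightarrow>
    strict_mono b \<and> surj b \<and> (\<forall>t. b (- t) = - b t) \<and> (\<forall>t. b (t + 2) = b t + 2)"

lemma periodic_homeoD:
  assumes "periodic_homeo b"
  shows "strict_mono b" "surj b" "b (- t) = - b t" "b (t + 2) = b t + 2"
  using assms by (simp_all add: periodic_homeo_def)

lemma periodic_homeo_shift:
  assumes b: "periodic_homeo b" shows "b (t + 2 * of_int i) = b t + 2 * of_int i"
proof (induction i rule: int_induct[of _ 0])
  case (step1 i)
  have "b (t + 2 * of_int i + 2) = b (t + 2 * of_int i) + 2"
    by (rule periodic_homeoD(4)[OF b])
  then show ?case using step1 by (simp add: algebra_simps)
next
  case (step2 i)
  have "b (t + 2 * of_int (i - 1) + 2) = b (t + 2 * of_int (i - 1)) + 2"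
    by (rule periodic_homeoD(4)[OF b])
  then show ?case using step2 by (simp add: algebra_simps)
qed simp

lemma periodic_homeo_0: "periodic_homeo b \<Longrightarrow> b 0 = 0"
  using periodic_homeoD(3)[of b 0] by simp

lemma periodic_homeo_1: "periodic_homeo b \<Longrightarrow> b 1 = 1"
  using periodic_homeoD(3)[of b 1] periodic_homeoD(4)[of b "-1"] by simp

lemma periodic_homeo_bij: assumes "periodic_homeo b" shows "bij b"
  unfolding bij_def
  using strict_mono_imp_inj_on[OF periodic_homeoD(1)[OF assms]] periodic_homeoD(2)[OF assms] by simp

lemma periodic_homeo_continuous:
  assumes "periodic_homeo b" shows "continuous_on A b"
proof -
  have "continuous_on UNIV b"
  proof (rule continuous_onI_mono)
    show "open (b ` UNIV)" using periodic_homeoD(2)[OF assms] by simp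
    show "b x \<le> b y" if "x \<le> y" for x y
      using that strict_mono_mono[OF periodic_homeoD(1)[OF assms]] monoD by blast
  qed
  then show ?thesis by (rule continuous_on_subset) simp
qed

lemma periodic_homeo_compose:
  assumes "periodic_homeo a" "periodic_homeo b" shows "periodic_homeo (\<lambda>t. a (b t))"
  unfolding periodic_homeo_def
proof (intro conjI allI)
  show "strict_mono (\<lambda>t. a (b t))"
    using periodic_homeoD(1)[OF assms(1)] periodic_homeoD(1)[OF assms(2)] by (simp add: strict_mono_def)
  show "surj (\<lambda>t. a (b t))"
    using comp_surj[OF periodic_homeoD(2)[OF assms(2)] periodic_homeoD(2)[OF assms(1)]] by (simp add: o_def)
qed (simp_all add: periodic_homeoD[OF assms(1)] periodic_homeoD[OF assms(2)])

lemma periodic_homeo_inv: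
  assumes b: "periodic_homeo b"
  shows "periodic_homeo (inv_into UNIV b)" "b (inv_into UNIV b t) = t" "inv_into UNIV b (b t) = t"
proof -
  note bij = periodic_homeo_bij[OF b]
  have 1: "b (inv_into UNIV b t) = t" for t using bij by (simp add: bij_is_surj surj_f_inv_f)
  have 2: "inv_into UNIV b (b t) = t" for t using bij by (simp add: bij_is_inj)
  have less: "b x < b y \<longleftrightarrow> x < y" for x y
    using periodic_homeoD(1)[OF b] by (rule strict_mono_less)
  show "periodic_homeo (inv_into UNIV b)"
    unfolding periodic_homeo_def
  proof (intro conjI allI)
    show "strict_mono (inv_into UNIV b)"
    proof (rule strict_monoI)
      fix x y :: real assume "x < y"
      then show "inv_into UNIV b x < inv_into UNIV b y" using less[of "inv_into UNIV b x" "inv_into UNIV b y"] by (simp add: 1)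
    qed
    show "surj (inv_into UNIV b)" using bij by (simp add: bij_imp_bij_inv bij_is_surj)
    show "inv_into UNIV b (- t) = - inv_into UNIV b t" for t
      using 2[of "- inv_into UNIV b t"] periodic_homeoD(3)[OF b, of "inv_into UNIV b t"] by (simp add: 1)
    show "inv_into UNIV b (t + 2) = inv_into UNIV b t + 2" for t
      using 2[of "inv_into UNIV b t + 2"] periodic_homeoD(4)[OF b, of "inv_into UNIV b t"] by (simp add: 1)
  qed
  show "b (inv_into UNIV b t) = t" "inv_into UNIV b (b t) = t" by (fact 1 2)+
qed

lemma periodic_homeo_unit:
  assumes b: "periodic_homeo b" shows "0 < b t \<longleftrightarrow> 0 < t" "b t < 1 \<longleftrightarrow> t < 1"
  using strict_mono_less[OF periodic_homeoD(1)[OF b], of 0 t] strict_mono_less[OF periodic_homeoD(1)[OF b], of t 1]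
  by (simp_all add: periodic_homeo_0[OF b] periodic_homeo_1[OF b])

lemma periodic_homeo_nearby:
  assumes b: "periodic_homeo b" and "\<And>t. t \<in> {0..1} \<Longrightarrow> \<bar>b t - t\<bar> \<le> \<epsilon>"
  shows "\<bar>b t - t\<bar> \<le> \<epsilon>"
proof -
  define i where "i = round (t / 2)"
  define s where "s = t - 2 * of_int i"
  have s: "\<bar>s\<bar> \<le> 1"
    using of_int_round_abs_le[of "t / 2"] unfolding s_def i_def by linarith
  have t: "t = s + 2 * of_int i" by (simp add: s_def)
  have "\<bar>b t - t\<bar> = \<bar>b s - s\<bar>"
    unfolding t periodic_homeo_shift[OF b] by simp
  also have "\<dots> = \<bar>b \<bar>s\<bar> - \<bar>s\<bar>\<bar>"
    using periodic_homeoD(3)[OF b, of s] by (simp add: abs_if)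
  also have "\<dots> \<le> \<epsilon>" using s by (intro assms(2)) simp
  finally show ?thesis .
qed

lemma periodic_homeo_displacement: "periodic_homeo b \<Longrightarrow> \<bar>b t - t\<bar> \<le> 1"
proof (rule periodic_homeo_nearby)
  fix t :: real assume b: "periodic_homeo b" and t: "t \<in> {0..1}"
  have m: "mono b" using strict_mono_mono[OF periodic_homeoD(1)[OF b]] .
  have "b 0 \<le> b t" "b t \<le> b 1" using t by (auto intro: monoD[OF m])
  then have "0 \<le> b t" "b t \<le> 1" by (simp_all add: periodic_homeo_0[OF b] periodic_homeo_1[OF b])
  moreover have "0 \<le> t" "t \<le> 1" using t by simp_all
  ultimately show "\<bar>b t - t\<bar> \<le> 1" by linarith
qed

text \<open>A monotone map that fixes the points \<open>l / k\<close> maps every interval between neighbouring grid points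
  to itself.\<close>

lemma periodic_homeo_fixes_grid:
  assumes b: "periodic_homeo b" and k: "0 < k" and fixed: "\<And>l. l \<in> {1..<k} \<Longrightarrow> b (real l / real k) = real l / real k"
  shows "\<bar>b t - t\<bar> \<le> 1 / real k"
proof (rule periodic_homeo_nearby[OF b])
  fix t :: real assume t: "t \<in> {0..1}"
  have m: "mono b" using strict_mono_mono[OF periodic_homeoD(1)[OF b]] .
  have grid: "b (real l / real k) = real l / real k" if lk: "l \<le> k" for l
  proof -
    consider "l = 0" | "l = k" | "l \<in> {1..<k}" using lk by (cases "l = 0 \<or> l = k") auto
    then show ?thesis
      using k by cases (simp_all add: fixed periodic_homeo_0[OF b] periodic_homeo_1[OF b])
  qed
  show "\<bar>b t - t\<bar> \<le> 1 / real k"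
  proof (cases "t = 1")
    case True
    then show ?thesis by (simp add: periodic_homeo_1[OF b])
  next
    case False
    \<comment> \<open>The grid interval that contains \<open>t\<close>.\<close>
    define l where "l = nat \<lfloor>t * real k\<rfloor>"
    have "real l = of_int \<lfloor>t * real k\<rfloor>" using t by (simp add: l_def)
    then have l: "real l \<le> t * real k" "t * real k < real l + 1" by linarith+
    have "t * real k < real k" using t False k by simp
    then have "Suc l \<le> k" using l by linarith
    have lt: "real l / real k \<le> t" "t \<le> real (Suc l) / real k"
      using l k by (simp_all add: field_simps)
    have "real l / real k \<le> b t"
      using monoD[OF m lt(1)] grid[of l] \<open>Suc l \<le> k\<close> by simp
    moreover have "b t \<le> real (Suc l) / real k"
      using monoD[OF m lt(2)] grid[of "Suc l"] \<open>Suc l \<le> k\<close> by simp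
    moreover have "real (Suc l) / real k = real l / real k + 1 / real k" by (simp add: add_divide_distrib)
    ultimately show ?thesis using lt by linarith
  qed
qed

text \<open>A homeomorphism of one factor induces a homeomorphism of every later factor of the inverse
  limit; \<open>r\<close> is the degree of the tent map in between.\<close>

lemma periodic_homeo_rescale:
  assumes b: "periodic_homeo b" and r: "0 < r"
  shows "periodic_homeo (\<lambda>t. b (real r * t) / real r)"
  unfolding periodic_homeo_def
proof (intro conjI allI)
  show "strict_mono (\<lambda>t. b (real r * t) / real r)"
    using periodic_homeoD(1)[OF b] r by (auto simp: strict_mono_def divide_strict_right_mono)
  show "surj (\<lambda>t. b (real r * t) / real r)"
  proof (rule surjI)
    show "b (real r * (inv_into UNIV b (real r * t) / real r)) / real r = t" for t
      using r periodic_homeo_inv(2)[OF b] by simp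
  qed
  show "b (real r * - t) / real r = - (b (real r * t) / real r)" for t
    using periodic_homeoD(3)[OF b] by simp
  show "b (real r * (t + 2)) / real r = b (real r * t) / real r + 2" for t
    using periodic_homeo_shift[OF b, of "real r * t" "int r"] r by (simp add: algebra_simps add_divide_distrib)
qed

text \<open>This is the compatibility of the induced homeomorphisms with the bonding maps.\<close>

lemma periodic_homeo_zigzag:
  assumes b: "periodic_homeo b" and r: "0 < r"
  shows "zigzag (b (real r * zigzag y) / real r) = zigzag (b (real r * y) / real r)"
proof -
  note b' = periodic_homeo_rescale[OF b r]
  obtain i where i: "zigzag y = \<bar>y - 2 * of_int i\<bar>" using zigzag_nearest by blast
  then have "zigzag y = y + 2 * of_int (- i) \<or> zigzag y = - y + 2 * of_int i" by auto
  then show ?thesis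
  proof
    assume "zigzag y = y + 2 * of_int (- i)"
    then have "b (real r * zigzag y) / real r = b (real r * y) / real r + 2 * of_int (- i)"
      using periodic_homeo_shift[OF b', of y "- i"] by simp
    then show ?thesis by (simp only: zigzag_shift)
  next
    assume "zigzag y = - y + 2 * of_int i"
    then have "b (real r * zigzag y) / real r = - (b (real r * y) / real r) + 2 * of_int i"
      using periodic_homeo_shift[OF b', of "- y" i] periodic_homeoD(3)[OF b', of y] by simp
    then show ?thesis by (simp only: zigzag_shift zigzag_minus)
  qed
qed

lemma increasing_homeo_extends:
  assumes c: "increasing_homeo c"
  shows "\<exists>b. periodic_homeo b \<and> (\<forall>t\<in>{0..1}. b t = c t)"
proof -
  have c0: "c 0 = 0" "c 1 = 1" and sm: "\<And>x y. 0 \<le> x \<Longrightarrow> x < y \<Longrightarrow> y \<le> 1 \<Longrightarrow> c x < c y"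
    using c by (auto simp: increasing_homeo_def strict_mono_on_def)
  have c_in: "0 \<le> c x" "c x \<le> 1" if "0 \<le> x" "x \<le> 1" for x
    using increasing_homeo_image[OF c] that by (auto simp: image_subset_iff set_eq_subset)
  define co where "co s = (if 0 \<le> s then c s else - c (- s))" for s
  have co_minus: "co (- s) = - co s" for s using c0 by (simp add: co_def)
  have co1: "co 1 = 1" "co (-1) = -1" using c0 by (simp_all add: co_def)
  have co_less: "co s < co t" if "- 1 \<le> s" "s < t" "t \<le> 1" for s t
  proof -
    consider "0 \<le> s" | "s < 0" "0 \<le> t" | "t < 0" by linarith
    then show ?thesis
    proof cases
      case 1 then show ?thesis using sm[of s t] that by (simp add: co_def)
    next
      case 2
      then show ?thesis using sm[of 0 "- s"] c_in(1)[of t] c0 that by (simp add: co_def)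
    next
      case 3
      then show ?thesis using sm[of "- t" "- s"] that by (simp add: co_def)
    qed
  qed
  have co_le: "co s \<le> 1" "- 1 \<le> co s" if "- 1 \<le> s" "s \<le> 1" for s
    using co_less[of s 1] co_less[of "-1" s] that co1 by (cases "s = 1"; cases "s = -1"; simp)+
  define b where "b t = 2 * of_int (round (t / 2)) + co (t - 2 * of_int (round (t / 2)))" for t
  have near: "\<bar>t - 2 * of_int (round (t / 2))\<bar> \<le> 1" for t :: real
    using of_int_round_abs_le[of "t / 2"] by linarith
  have b_eq: "b t = 2 * of_int i + co (t - 2 * of_int i)" if "\<bar>t - 2 * of_int i\<bar> \<le> 1" for t i
  proof -
    define j where "j = round (t / 2)"
    have j: "\<bar>t - 2 * of_int j\<bar> \<le> 1" unfolding j_def by (rule near)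
    have "\<bar>real_of_int i - real_of_int j\<bar> \<le> 1" using j that by linarith
    then consider "i = j" | "i = j + 1" | "j = i + 1" by linarith
    then have "2 * of_int j + co (t - 2 * of_int j) = 2 * of_int i + co (t - 2 * of_int i)"
    proof cases
      case 2
      then have "t = 2 * of_int j + 1" using j that by simp
      then show ?thesis using 2 co1 by simp
    next
      case 3
      then have "t = 2 * of_int i + 1" using j that by simp
      then show ?thesis using 3 co1 by simp
    qed simp
    then show ?thesis by (simp add: b_def j_def)
  qed
  have "periodic_homeo b"
    unfolding periodic_homeo_def
  proof (intro conjI allI)
    show "strict_mono b"
    proof (rule strict_monoI)
      fix s t :: real assume st: "s < t"
      define i where "i = round (s / 2)"
      define j where "j = round (t / 2)"
      have ij: "\<bar>s - 2 * of_int i\<bar> \<le> 1" "\<bar>t - 2 * of_int j\<bar> \<le> 1" unfolding i_def j_def by (rule near)+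
      have "i \<le> j" unfolding i_def j_def using st by (intro round_mono) simp
      show "b s < b t"
      proof (cases "i = j")
        case True
        then show ?thesis
          using co_less[of "s - 2 * of_int j" "t - 2 * of_int j"] ij st by (simp add: b_eq)
      next
        case False
        then have "real_of_int i + 1 \<le> real_of_int j" using \<open>i \<le> j\<close> by linarith
        moreover have "s - 2 * of_int i < 1 \<or> - 1 < t - 2 * of_int j \<or> real_of_int i + 1 < real_of_int j"
          using st ij by linarith
        moreover have "s - 2 * of_int i < 1 \<Longrightarrow> co (s - 2 * of_int i) < 1"
          using co_less[of "s - 2 * of_int i" 1] ij co1 by simp
        moreover have "- 1 < t - 2 * of_int j \<Longrightarrow> - 1 < co (t - 2 * of_int j)"
          using co_less[of "-1" "t - 2 * of_int j"] ij co1 by simp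
        moreover have "co (s - 2 * of_int i) \<le> 1" "- 1 \<le> co (t - 2 * of_int j)"
          using co_le[of "s - 2 * of_int i"] co_le[of "t - 2 * of_int j"] ij by auto
        ultimately show ?thesis unfolding b_eq[OF ij(1)] b_eq[OF ij(2)] by linarith
      qed
    qed
    show "surj b"
    proof (rule surjI)
      fix y :: real
      define i where "i = round (y / 2)"
      define v where "v = y - 2 * of_int i"
      have v: "\<bar>v\<bar> \<le> 1" unfolding v_def i_def by (rule near)
      have "\<exists>s. \<bar>s\<bar> \<le> 1 \<and> co s = v"
      proof (cases "0 \<le> v")
        case True
        then have "v \<in> c ` {0..1}" using increasing_homeo_image[OF c] v by simp
        then obtain s where "s \<in> {0..1}" "c s = v" by blast
        then show ?thesis by (intro exI[of _ s]) (simp add: co_def)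
      next
        case False
        then have "- v \<in> c ` {0..1}" using increasing_homeo_image[OF c] v by simp
        then obtain s where "s \<in> {0..1}" "c s = - v" by (metis imageE)
        then show ?thesis using co_minus[of s] by (intro exI[of _ "- s"]) (simp add: co_def)
      qed
      then have "\<exists>s. \<bar>s\<bar> \<le> 1 \<and> y = 2 * of_int i + co s" unfolding v_def by (auto simp: algebra_simps)
      then have "\<exists>x. b x = y"
      proof (elim exE conjE)
        fix s assume s: "\<bar>s\<bar> \<le> 1" "y = 2 * of_int i + co s"
        have "b (2 * of_int i + s) = 2 * of_int i + co s"
          using b_eq[of "2 * of_int i + s" i] s(1) by simp
        then show ?thesis using s(2) by blast
      qed
      then show "b (SOME x. b x = y) = y" by (rule someI_ex)
    qed
    show "b (- t) = - b t" for t
    proof -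
      define i where "i = round (t / 2)"
      have i: "\<bar>t - 2 * of_int i\<bar> \<le> 1" unfolding i_def by (rule near)
      then have "\<bar>- t - 2 * of_int (- i)\<bar> \<le> 1" by simp
      from b_eq[OF this] b_eq[OF i] show ?thesis
        using co_minus[of "t - 2 * of_int i"] by simp
    qed
    show "b (t + 2) = b t + 2" for t
    proof -
      define i where "i = round (t / 2)"
      have i: "\<bar>t - 2 * of_int i\<bar> \<le> 1" unfolding i_def by (rule near)
      then have "\<bar>t + 2 - 2 * of_int (i + 1)\<bar> \<le> 1" by simp
      from b_eq[OF this] b_eq[OF i] show ?thesis by simp
    qed
  qed
  moreover have "b t = c t" if "t \<in> {0..1}" for t
    using b_eq[of t 0] that by (simp add: co_def)
  ultimately show ?thesis by blast
qed

text \<open>Interpolate linearly up to the smallest points of \<open>A\<close> and \<open>A'\<close> and continue with the remaining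
  points.\<close>

lemma increasing_map_matching:
  fixes l r l' r' :: real
  assumes "l < r" "l' < r'" "finite A" "A \<subseteq> {l<..<r}" "finite A'" "A' \<subseteq> {l'<..<r'}" "card A = card A'"
  shows "\<exists>c. continuous_on {l..r} c \<and> strict_mono_on {l..r} c \<and> c l = l' \<and> c r = r' \<and> c ` A = A'"
  using assms
proof (induction "card A" arbitrary: l l' A A')
  case 0
  define \<kappa> where "\<kappa> = (r' - l') / (r - l)"
  have \<kappa>: "0 < \<kappa>" "(r - l) * \<kappa> = r' - l'" using 0 by (simp_all add: \<kappa>_def)
  define c where "c x = l' + (x - l) * \<kappa>" for x
  have "continuous_on {l..r} c" unfolding c_def by (intro continuous_intros)
  moreover have "strict_mono_on {l..r} c"
    using \<kappa> by (simp add: strict_mono_on_def c_def)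
  moreover have "c l = l'" "c r = r'" using \<kappa> by (simp_all add: c_def)
  moreover have "c ` A = A'" using 0 by simp
  ultimately show ?case by blast
next
  case (Suc n)
  then have ne: "A \<noteq> {}" "A' \<noteq> {}" by auto
  define a a' where "a = Min A" and "a' = Min A'"
  have a: "a \<in> A" "a' \<in> A'" using ne Suc.prems by (simp_all add: a_def a'_def)
  have ar: "l < a" "a < r" "l' < a'" "a' < r'" using a Suc.prems by auto
  have gt: "x > a" if "x \<in> A - {a}" for x
    using Min_le[of A x] Suc.prems(3) that unfolding a_def by (simp add: order_less_le)
  have sub: "A - {a} \<subseteq> {a<..<r}"
  proof
    fix x assume x: "x \<in> A - {a}"
    then have "x \<in> {l<..<r}" using Suc.prems(4) by blast
    then show "x \<in> {a<..<r}" using gt[OF x] by simp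
  qed
  have gt': "x > a'" if "x \<in> A' - {a'}" for x
    using Min_le[of A' x] Suc.prems(5) that unfolding a'_def by (simp add: order_less_le)
  have sub': "A' - {a'} \<subseteq> {a'<..<r'}"
  proof
    fix x assume x: "x \<in> A' - {a'}"
    then have "x \<in> {l'<..<r'}" using Suc.prems(6) by blast
    then show "x \<in> {a'<..<r'}" using gt'[OF x] by simp
  qed
  have "n = card (A - {a})" "card (A - {a}) = card (A' - {a'})"
    using Suc.hyps(2) Suc.prems a by simp_all
  from Suc.hyps(1)[OF this(1) ar(2) ar(4) _ sub _ sub' this(2)] Suc.prems(3,5)
  obtain c where c: "continuous_on {a..r} c" "strict_mono_on {a..r} c" "c a = a'" "c r = r'"
    "c ` (A - {a}) = A' - {a'}"
    by auto
  define \<kappa> where "\<kappa> = (a' - l') / (a - l)"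
  have \<kappa>: "0 < \<kappa>" "(a - l) * \<kappa> = a' - l'" using ar by (simp_all add: \<kappa>_def)
  define c1 where "c1 x = l' + (x - l) * \<kappa>" for x
  have c1: "c1 l = l'" "c1 a = a'" using \<kappa> by (simp_all add: c1_def)
  have c1_less: "c1 x < c1 y" if "x < y" for x y
    using that \<kappa> by (simp add: c1_def)
  define g where "g x = (if x \<le> a then c1 x else c x)" for x
  have "continuous_on ({l..a} \<union> {a..r}) g"
    unfolding g_def
  proof (rule continuous_on_cases)
    show "continuous_on {l..a} c1" unfolding c1_def by (intro continuous_intros)
  qed (use c c1 in auto)
  moreover have "{l..a} \<union> {a..r} = {l..r}" using ar by auto
  moreover have "g x < g y" if xy: "x \<in> {l..r}" "y \<in> {l..r}" "x < y" for x y
  proof -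
    consider "y \<le> a" | "x \<le> a" "a < y" | "a < x" by linarith
    then show ?thesis
    proof cases
      case 1 then show ?thesis using c1_less xy by (simp add: g_def)
    next
      case 2
      have "c1 x \<le> a'" using c1_less[of x a] c1 2 by (cases "x = a") auto
      moreover have "a' < c y" using strict_mono_onD[OF c(2), of a y] c(3) 2 xy by auto
      ultimately show ?thesis using 2 by (simp add: g_def)
    next
      case 3 then show ?thesis using strict_mono_onD[OF c(2), of x y] xy by (simp add: g_def)
    qed
  qed
  moreover have "g l = l'" "g r = r'" using ar c c1 by (simp_all add: g_def)
  moreover have "g ` A = A'"
  proof -
    have "g ` (A - {a}) = c ` (A - {a})"
    proof (rule image_cong[OF refl])
      fix x assume "x \<in> A - {a}"
      then have "a < x" by (rule gt)
      then show "g x = c x" by (simp add: g_def)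
    qed
    moreover have "g a = a'" using c1 by (simp add: g_def)
    moreover have "A = insert a (A - {a})" "A' = insert a' (A' - {a'})" using a by auto
    ultimately show ?thesis using c(5) by (metis image_insert)
  qed
  ultimately show ?case
    by (intro exI[of _ g]) (auto simp: strict_mono_on_def)
qed

lemma periodic_homeo_matching:
  assumes "finite A" "A \<subseteq> {0<..<1}" "finite A'" "A' \<subseteq> {0<..<1}" "card A = card A'"
  shows "\<exists>b. periodic_homeo b \<and> b ` A = A'"
proof -
  obtain c where c: "continuous_on {0..1} c" "strict_mono_on {0..1} c" "c 0 = 0" "c 1 = 1" "c ` A = A'"
    using increasing_map_matching[of 0 1 0 1 A A'] assms by auto
  then have "increasing_homeo c" by (simp add: increasing_homeo_def)
  then obtain b where b: "periodic_homeo b" "\<forall>t\<in>{0..1}. b t = c t"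
    using increasing_homeo_extends by blast
  have "b ` A = c ` A" using b(2) assms(2) by (intro image_cong) auto
  then show ?thesis using b(1) c(5) by blast
qed

lemma strict_mono_finite_self_map:
  fixes f :: "'a::linorder \<Rightarrow> 'a"
  assumes "finite S" "strict_mono f" "f ` S = S" "x \<in> S"
  shows "f x = x"
proof (rule ccontr)
  assume neq: "f x \<noteq> x"
  define T where "T = {x \<in> S. f x \<noteq> x}"
  define m where "m = Min T"
  have T: "finite T" "T \<noteq> {}" using assms neq by (auto simp: T_def)
  then have m: "m \<in> S" "f m \<noteq> m" using Min_in[OF T] by (auto simp: m_def T_def)
  have below: "f y = y" if "y \<in> S" "y < m" for y
    using Min_le[OF T(1), of y] that unfolding m_def T_def by fastforce
  have less: "f y < f z \<longleftrightarrow> y < z" for y z using assms(2) by (rule strict_mono_less)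
  have "m < f m"
  proof (rule ccontr)
    assume "\<not> m < f m"
    then have fm: "f m < m" using m(2) by simp
    have "f (f m) = f m" using below[of "f m"] fm m(1) assms(3) by blast
    then show False using less[of "f m" m] fm by simp
  qed
  obtain y where y: "y \<in> S" "f y = m" using m(1) assms(3) by (metis imageE)
  then show False
    using below[of y] less[of m y] \<open>m < f m\<close> m(2) by (cases y m rule: linorder_cases) auto
qed


section \<open>Homeomorphisms of the universal Knaster continuum\<close>

text \<open>The universal Knaster continuum with a metric. Its homeomorphism group is studied through the
  lifts of homeomorphisms to the line.\<close>

locale knaster_metric = Metric_space M d + knaster_cofinal "Metric_space.mtopology M d" D p
  for M :: "'a set" and d :: "'a \<Rightarrow> 'a \<Rightarrow> real" and D p
begin

sublocale compact_metric M d
proof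
  show "compact_space mtopology" by (rule compact)
  show "M \<noteq> {}" using ray(1) by auto
qed

lemma ray_in: "ray t \<in> M"
  using ray(1) by simp

definition lifted :: "('a \<Rightarrow> 'a) \<Rightarrow> (real \<Rightarrow> real) \<Rightarrow> bool"
  where "lifted h A \<longleftrightarrow> continuous_on UNIV A \<and> (\<forall>t. A (- t) = - A t) \<and> mono A \<and>
    (\<forall>t. h (ray t) = ray (A t))"

lemma liftedD:
  assumes "lifted h A"
  shows "continuous_on S A" "A (- t) = - A t" "mono A" "h (ray t) = ray (A t)" "A 0 = 0"
    "0 \<le> t \<Longrightarrow> 0 \<le> A t"
proof -
  show "continuous_on S A" using assms continuous_on_subset by (auto simp: lifted_def)
  show "A (- t) = - A t" "mono A" "h (ray t) = ray (A t)" using assms by (simp_all add: lifted_def)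
  have "A (- 0) = - A 0" using assms unfolding lifted_def by blast
  then show 0: "A 0 = 0" by simp
  show "0 \<le> A t" if "0 \<le> t" using monoD[OF \<open>mono A\<close> that] 0 by simp
qed

lemma lifted_unique:
  assumes A: "lifted h A" and B: "lifted h B" shows "A = B"
proof
  fix t
  have pos: "A t = B t" if "0 \<le> t" for t
  proof -
    have "ray (A t) = ray (B t)" using liftedD(4)[OF A] liftedD(4)[OF B] by metis
    then show ?thesis using ray_eq_iff[of "A t" "B t"] liftedD(6)[OF A that] liftedD(6)[OF B that] by simp
  qed
  show "A t = B t"
  proof (cases "0 \<le> t")
    case False
    then have "A (- t) = B (- t)" by (intro pos) simp
    then show ?thesis by (simp add: liftedD(2)[OF A] liftedD(2)[OF B])
  qed (rule pos)
qed

text \<open>A homeomorphism is an open surjection of the continuum onto itself, so the results on lifts of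
  open maps apply with the same chain on both sides.\<close>

lemma homeo_lifted:
  assumes h: "h \<in> carrier HG"
  shows "\<exists>A r. lifted h A \<and> 0 < r \<and> has_slope A r \<and>
    (\<forall>n. \<forall>\<epsilon>>0. \<exists>N k::nat. r * real (D N) = real (D n) * real k \<and>
    (\<forall>t (j::int). \<bar>A (t + 2 * real (D N) * of_int j) - A t - 2 * (real (D n) * real k) * of_int j\<bar> \<le> \<epsilon>))"
proof -
  have hm: "homeomorphic_map mtopology mtopology h"
    using h by (simp add: homeo_group_carrier)
  interpret f: knaster_open_map mtopology D p mtopology D p h
  proof
    show "continuous_map mtopology mtopology h" "open_map mtopology mtopology h"
      using hm by (simp_all add: homeomorphic_imp_continuous_map homeomorphic_imp_open_map)
    show "h ` topspace mtopology = topspace mtopology"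
      using hm by (rule homeomorphic_imp_surjective_map)
  qed
  obtain A where A: "f.lifts A" using f.ex_lifts by (elim exE)
  have "lifted h A" using A by (simp add: lifted_def f.lifts_def)
  moreover from f.lifts_slope[OF A] obtain r where "0 < r" "has_slope A r"
    "\<forall>n. \<forall>\<epsilon>>0. \<exists>N k::nat. r * real (D N) = real (D n) * real k \<and>
    (\<forall>t (j::int). \<bar>A (t + 2 * real (D N) * of_int j) - A t - 2 * (real (D n) * real k) * of_int j\<bar> \<le> \<epsilon>)"
    by (elim exE conjE)
  ultimately show ?thesis by (intro exI[of _ A] exI[of _ r] conjI)
qed

definition lift :: "('a \<Rightarrow> 'a) \<Rightarrow> real \<Rightarrow> real"
  where "lift h = (THE A. lifted h A)"

definition deg :: "('a \<Rightarrow> 'a) \<Rightarrow> real"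
  where "deg h = (THE r. has_slope (lift h) r)"

lemma lift_eqI: "lifted h A \<Longrightarrow> lift h = A"
  unfolding lift_def by (rule the_equality) (auto intro: lifted_unique)

lemma lifted_lift: "h \<in> carrier HG \<Longrightarrow> lifted h (lift h)"
  using homeo_lifted lift_eqI by metis

lemmas lift = liftedD[OF lifted_lift]

lemma deg_eqI: "has_slope (lift h) r \<Longrightarrow> deg h = r"
  unfolding deg_def by (rule the_equality) (auto intro: has_slope_unique)

lemma deg:
  assumes h: "h \<in> carrier HG"
  shows "0 < deg h" "has_slope (lift h) (deg h)"
    "0 < \<epsilon> \<Longrightarrow> \<exists>N k::nat. deg h * real (D N) = real (D n) * real k \<and>
    (\<forall>t (j::int). \<bar>lift h (t + 2 * real (D N) * of_int j) - lift h t - 2 * (real (D n) * real k) * of_int j\<bar> \<le> \<epsilon>)"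
proof -
  obtain A r where A: "lifted h A" and r: "0 < r" "has_slope A r" and
    q: "\<forall>n. \<forall>\<epsilon>>0. \<exists>N k::nat. r * real (D N) = real (D n) * real k \<and>
    (\<forall>t (j::int). \<bar>A (t + 2 * real (D N) * of_int j) - A t - 2 * (real (D n) * real k) * of_int j\<bar> \<le> \<epsilon>)"
    using homeo_lifted[OF h] by (elim exE conjE)
  have lA: "lift h = A" using A by (rule lift_eqI)
  have dr: "deg h = r" by (rule deg_eqI) (simp add: lA r)
  show "0 < deg h" "has_slope (lift h) (deg h)" using r by (simp_all add: lA dr)
  show "\<exists>N k::nat. deg h * real (D N) = real (D n) * real k \<and>
    (\<forall>t (j::int). \<bar>lift h (t + 2 * real (D N) * of_int j) - lift h t - 2 * (real (D n) * real k) * of_int j\<bar> \<le> \<epsilon>)"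
    if "0 < \<epsilon>" unfolding lA dr by (rule q[THEN spec, THEN spec, THEN mp, OF that])
qed

lemma homeo_ray: "h \<in> carrier HG \<Longrightarrow> h (ray t) = ray (lift h t)"
  by (rule lift(4))

lemma HG_mult_closed: "g \<in> carrier HG \<Longrightarrow> h \<in> carrier HG \<Longrightarrow> g \<otimes>\<^bsub>HG\<^esub> h \<in> carrier HG"
  using group_homeo_group[of mtopology] by (simp add: group.is_monoid monoid.m_closed)

lemma HG_inv_closed: "h \<in> carrier HG \<Longrightarrow> inv\<^bsub>HG\<^esub> h \<in> carrier HG"
  by (rule homeo_group_inv(1))

lemma HG_one_closed: "\<one>\<^bsub>HG\<^esub> \<in> carrier HG"
  using group_homeo_group[of mtopology] by (simp add: group.is_monoid monoid.one_closed)

lemma lift_mult: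
  assumes g: "g \<in> carrier HG" and h: "h \<in> carrier HG"
  shows "lift (g \<otimes>\<^bsub>HG\<^esub> h) = (\<lambda>t. lift g (lift h t))"
proof (rule lift_eqI)
  show "lifted (g \<otimes>\<^bsub>HG\<^esub> h) (\<lambda>t. lift g (lift h t))"
    unfolding lifted_def
  proof (intro conjI allI)
    show "continuous_on UNIV (\<lambda>t. lift g (lift h t))"
      by (rule continuous_on_compose2[OF lift(1)[OF g, of UNIV] lift(1)[OF h]]) simp
    show "mono (\<lambda>t. lift g (lift h t))"
      by (intro monoI monoD[OF lift(3)[OF g]] monoD[OF lift(3)[OF h]])
    show "(g \<otimes>\<^bsub>HG\<^esub> h) (ray t) = ray (lift g (lift h t))" for t
      using HG_mult[OF g h ray_in] homeo_ray[OF g] homeo_ray[OF h] by simp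
  qed (simp add: lift(2)[OF g] lift(2)[OF h])
qed

lemma lift_one: "lift \<one>\<^bsub>HG\<^esub> = (\<lambda>t. t)"
  by (rule lift_eqI) (simp add: lifted_def homeo_group_one ray_in mono_def)

lemma lift_inv:
  assumes h: "h \<in> carrier HG"
  shows "lift (inv\<^bsub>HG\<^esub> h) (lift h t) = t" "lift h (lift (inv\<^bsub>HG\<^esub> h) t) = t"
proof -
  interpret G: group HG by (rule group_homeo_group)
  show "lift (inv\<^bsub>HG\<^esub> h) (lift h t) = t" "lift h (lift (inv\<^bsub>HG\<^esub> h) t) = t"
    using lift_mult[OF HG_inv_closed[OF h] h] lift_mult[OF h HG_inv_closed[OF h]] lift_one h
    by (metis G.l_inv G.r_inv)+
qed

lemma lift_strict_mono: assumes h: "h \<in> carrier HG" shows "strict_mono (lift h)"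
proof (rule strict_monoI)
  fix s t :: real assume st: "s < t"
  then have "lift h s \<le> lift h t" using monoD[OF lift(3)[OF h], of s t] by simp
  moreover have "lift h s \<noteq> lift h t"
    using lift_inv(1)[OF h, of s] lift_inv(1)[OF h, of t] st by auto
  ultimately show "lift h s < lift h t" by simp
qed

lemma homeo_eqI:
  assumes g: "g \<in> carrier HG" and h: "h \<in> carrier HG" and eq: "lift g = lift h"
  shows "g = h"
proof (rule homeo_group_ext[OF g h])
  fix x assume x: "x \<in> topspace mtopology"
  have "x \<in> {x \<in> topspace mtopology. g x = h x}"
  proof (rule ray_dense[OF _ _ x])
    show "closedin mtopology {x \<in> topspace mtopology. g x = h x}"
      using Hausdorff homeo_group_continuous[OF g] homeo_group_continuous[OF h]
      by (rule closedin_continuous_maps_eq)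
    show "ray t \<in> {x \<in> topspace mtopology. g x = h x}" for t
      using homeo_ray[OF g] homeo_ray[OF h] ray(1) by (simp add: eq)
  qed
  then show "g x = h x" by simp
qed

lemma deg_mult:
  assumes "g \<in> carrier HG" "h \<in> carrier HG" shows "deg (g \<otimes>\<^bsub>HG\<^esub> h) = deg g * deg h"
  by (rule deg_eqI) (simp add: lift_mult assms has_slope_compose deg)

lemma deg_of_linear: "lift h = (\<lambda>t. q * t) \<Longrightarrow> deg h = q"
  by (rule deg_eqI) (simp add: has_slope_linear)

lemma lift_close:
  assumes g: "g \<in> carrier HG" and h: "h \<in> carrier HG"
    and close: "\<And>x. x \<in> M \<Longrightarrow> \<bar>p 0 (g x) - p 0 (h x)\<bar> < 1 / 8"
  shows "\<bar>lift g t - lift h t\<bar> \<le> 1 / 2"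
proof -
  have p0: "p 0 (f (ray t)) = zigzag (lift f t)" if "f \<in> carrier HG" for f t
    using homeo_ray[OF that] ray(2)[of 0] by (simp add: D_0)
  have pos: "\<bar>lift g t - lift h t\<bar> \<le> 4 * (1 / 8)" if t: "0 \<le> t" for t
  proof (rule mono_lifts_close[OF lift(1)[OF g] lift(1)[OF h] lift(3)[OF g] lift(3)[OF h] _ _ _ _ _ t])
    show "\<bar>zigzag (lift g t) - zigzag (lift h t)\<bar> < 1 / 8" for t
      using close[OF ray_in] p0[OF g] p0[OF h] by simp
  qed (simp_all add: lift(5)[OF g] lift(5)[OF h])
  show ?thesis
  proof (cases "0 \<le> t")
    case False
    have "\<bar>lift g t - lift h t\<bar> = \<bar>lift g (- t) - lift h (- t)\<bar>"
      using lift(2)[OF g, of t] lift(2)[OF h, of t] by simp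
    then show ?thesis using pos[of "- t"] False by simp
  qed (use pos in simp)
qed

lemma p_uniformly_continuous:
  assumes "0 < \<epsilon>" shows "\<exists>\<delta>>0. \<forall>x\<in>M. \<forall>y\<in>M. d x y < \<delta> \<longrightarrow> \<bar>p k x - p k y\<bar> < \<epsilon>"
proof -
  have "uniformly_continuous_map Self euclidean_metric (p k)"
    using continuous_eq_uniformly_continuous_map[of Self euclidean_metric "p k"] compact p_continuous[of k]
    by (simp add: mtopology_of_def)
  then have "\<exists>\<delta>>0. \<forall>x\<in>M. \<forall>y\<in>M. d y x < \<delta> \<longrightarrow> dist (p k y) (p k x) < \<epsilon>"
    using assms unfolding uniformly_continuous_map_def by simp
  then show ?thesis unfolding dist_real_def by blast
qed

text \<open>Lifts of uniformly close homeomorphisms have bounded distance, by \<open>mono_lifts_close\<close> in the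
  coordinate \<open>p 0\<close>, and hence the same slope.\<close>

lemma deg_locally_constant:
  assumes h: "h \<in> carrier HG"
  shows "\<exists>\<delta>>0. \<forall>g\<in>carrier HG. fdist M h g < \<delta> \<longrightarrow> deg g = deg h"
proof -
  obtain \<delta> where \<delta>: "\<delta> > 0" "\<And>x y. x \<in> M \<Longrightarrow> y \<in> M \<Longrightarrow> d x y < \<delta> \<Longrightarrow> \<bar>p 0 x - p 0 y\<bar> < 1 / 8"
    using p_uniformly_continuous[of "1 / 8" 0] by auto
  have "deg g = deg h" if g: "g \<in> carrier HG" "fdist M h g < \<delta>" for g
  proof (rule deg_eqI)
    have "\<bar>lift h t - lift g t\<bar> \<le> 1 / 2" for t
    proof (rule lift_close[OF h g(1)])
      fix x assume x: "x \<in> M"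
      show "\<bar>p 0 (h x) - p 0 (g x)\<bar> < 1 / 8"
        using HG_dist_ge[OF h g(1) x] g(2) HG_in[OF h x] HG_in[OF g(1) x] by (intro \<delta>(2)) auto
    qed
    then show "has_slope (lift g) (deg h)"
      by (rule has_slope_bounded_diff[OF deg(2)[OF h]])
  qed
  then show ?thesis using \<delta>(1) by blast
qed

text \<open>The quantities \<open>w k (x, y) = D k * \<bar>p k x - p k y\<bar>\<close> increase with \<open>k\<close>, since tent maps expand
  by at most their degree, and on the ray they are bounded by the distance of the parameters. On the
  compact set of pairs at distance at least \<open>\<eta>\<close>, one \<open>w k\<close> is bounded away from 0.\<close>

lemma ray_uniformly_continuous:
  assumes \<eta>: "0 < \<eta>"
  shows "\<exists>\<delta>>0. \<forall>s t. \<bar>s - t\<bar> \<le> \<delta> \<longrightarrow> d (ray s) (ray t) < \<eta>"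
proof -
  let ?Z = "prod_topology mtopology mtopology"
  define S where "S = {z \<in> topspace ?Z. d (fst z) (snd z) \<in> {\<eta>..}}"
  define w where "w k z = real (D k) * \<bar>p k (fst z) - p k (snd z)\<bar>" for k z
  define A where "A k = {z \<in> topspace ?Z. w k z - 1 / real (Suc k) \<in> {0<..}}" for k
  have cont_d: "continuous_map ?Z euclideanreal (\<lambda>z. d (fst z) (snd z))"
    using continuous_map_mdist[of ?Z Self fst snd] by (simp add: mtopology_of_def continuous_map_fst continuous_map_snd)
  have cont_w: "continuous_map ?Z euclideanreal (w k)" for k
  proof -
    have "continuous_map ?Z euclideanreal (\<lambda>z. p k (fst z))" "continuous_map ?Z euclideanreal (\<lambda>z. p k (snd z))"
      using continuous_map_compose[OF continuous_map_fst p_continuous] continuous_map_compose[OF continuous_map_snd p_continuous]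
      by (simp_all add: o_def)
    then show ?thesis
      unfolding w_def by (intro continuous_map_real_mult continuous_map_real_abs continuous_map_diff) auto
  qed
  have w_mono: "w k z \<le> w (Suc k) z" if "z \<in> topspace ?Z" for k z
  proof -
    obtain x y where z: "z = (x, y)" "x \<in> M" "y \<in> M" using \<open>z \<in> topspace ?Z\<close> by auto
    define r where "r = real (D (Suc k)) / real (D k)"
    have r: "0 < r" "real (D k) * r = real (D (Suc k))" using D_pos by (simp_all add: r_def)
    have "\<bar>p k x - p k y\<bar> \<le> \<bar>r * p (Suc k) x - r * p (Suc k) y\<bar>"
      using p_le[of x k "Suc k"] p_le[of y k "Suc k"] z zigzag_Lipschitz by (simp add: r_def)
    also have "\<dots> = r * \<bar>p (Suc k) x - p (Suc k) y\<bar>"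
      using r(1) by (simp add: abs_mult flip: right_diff_distrib)
    finally have "real (D k) * \<bar>p k x - p k y\<bar> \<le> real (D k) * (r * \<bar>p (Suc k) x - p (Suc k) y\<bar>)"
      by (intro mult_left_mono) auto
    also have "\<dots> = real (D (Suc k)) * \<bar>p (Suc k) x - p (Suc k) y\<bar>"
      using r(2) by (simp add: mult.assoc[symmetric])
    finally show ?thesis by (simp add: w_def z)
  qed
  have "closedin ?Z S"
    unfolding S_def using cont_d by (rule closedin_continuous_map_preimage) simp
  then have "compactin ?Z S"
    using closedin_compact_space compact compact_space_prod_topology by blast
  moreover have "openin ?Z (A k)" for k
  proof -
    have "continuous_map ?Z euclideanreal (\<lambda>z. w k z - 1 / real (Suc k))"
      by (intro continuous_map_diff cont_w) simp
    then show ?thesis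
      unfolding A_def by (rule openin_continuous_map_preimage) simp
  qed
  moreover have "A k \<subseteq> A (Suc k)" for k
  proof
    fix z assume z: "z \<in> A k"
    have "1 / real (Suc (Suc k)) \<le> 1 / real (Suc k)" by (simp add: frac_le)
    then show "z \<in> A (Suc k)" using z w_mono[of z k] by (simp add: A_def)
  qed
  moreover have "S \<subseteq> (\<Union>k. A k)"
  proof
    fix z assume z: "z \<in> S"
    then have zZ: "z \<in> topspace ?Z" by (simp add: S_def)
    then have xy: "fst z \<in> M" "snd z \<in> M" by auto
    then have "fst z \<noteq> snd z" using z \<eta> by (auto simp: S_def)
    then obtain j where "p j (fst z) \<noteq> p j (snd z)" using p_inj xy by (metis topspace_mtopology)
    then have c: "0 < w j z" using D_pos[of j] by (simp add: w_def)
    obtain m where m: "1 / real (Suc m) < w j z" using nat_approx_posE[OF c] by auto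
    define k where "k = max j m"
    have "w j z \<le> w k z"
      using w_mono[OF zZ] lift_Suc_mono_le[of "\<lambda>k. w k z" j k] by (simp add: k_def)
    moreover have "1 / real (Suc k) \<le> 1 / real (Suc m)" by (simp add: k_def frac_le)
    ultimately have "z \<in> A k" using m zZ by (simp add: A_def)
    then show "z \<in> (\<Union>k. A k)" by blast
  qed
  ultimately have "\<exists>k. S \<subseteq> A k"
    by (rule compactin_increasing_cover)
  then obtain k where k: "S \<subseteq> A k" ..
  have "d (ray s) (ray t) < \<eta>" if st: "\<bar>s - t\<bar> \<le> 1 / real (Suc k)" for s t
  proof (rule ccontr)
    assume "\<not> d (ray s) (ray t) < \<eta>"
    then have "(ray s, ray t) \<in> S" using ray_in by (simp add: S_def)
    then have "(ray s, ray t) \<in> A k" using k by blast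
    then have "1 / real (Suc k) < w k (ray s, ray t)" by (simp add: A_def)
    also have "\<dots> \<le> real (D k) * \<bar>s / real (D k) - t / real (D k)\<bar>"
      unfolding w_def fst_conv snd_conv ray(2) using zigzag_Lipschitz by (intro mult_left_mono) auto
    also have "\<dots> = \<bar>s - t\<bar>"
      using D_pos[of k] by (simp flip: diff_divide_distrib add: abs_mult)
    finally show False using st by simp
  qed
  then show ?thesis by (intro exI[of _ "1 / real (Suc k)"]) simp
qed

text \<open>Uniformly small displacement on the line forces closeness to the identity in the group, since
  the ray is uniformly continuous and dense. In this form neighbourhoods of the identity enter the
  proof of extreme amenability.\<close>

lemma small_lift_displacement:
  assumes \<eta>: "0 < \<eta>"
  shows "\<exists>\<delta>>0. \<forall>h\<in>carrier HG. (\<forall>t. \<bar>lift h t - t\<bar> \<le> \<delta>) \<longrightarrow> fdist M \<one>\<^bsub>HG\<^esub> h < \<eta>"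
proof -
  obtain \<delta> where \<delta>: "\<delta> > 0" "\<And>s t. \<bar>s - t\<bar> \<le> \<delta> \<Longrightarrow> d (ray s) (ray t) < \<eta> / 2"
    using ray_uniformly_continuous[of "\<eta> / 2"] \<eta> by auto
  have "fdist M \<one>\<^bsub>HG\<^esub> h < \<eta>" if h: "h \<in> carrier HG" "\<And>t. \<bar>lift h t - t\<bar> \<le> \<delta>" for h
  proof -
    let ?C = "{x \<in> topspace mtopology. d x (h x) \<in> {..\<eta> / 2}}"
    have "continuous_map mtopology euclideanreal (\<lambda>x. d x (h x))"
      using continuous_map_mdist[of mtopology Self "\<lambda>x. x" h] homeo_group_continuous[OF h(1)]
      by (simp add: mtopology_of_def)
    then have cl: "closedin mtopology ?C" by (rule closedin_continuous_map_preimage) simp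
    have "ray t \<in> ?C" for t
      using \<delta>(2)[of "lift h t" t] h(2) homeo_ray[OF h(1)] ray_in by (simp add: commute less_imp_le)
    then have "x \<in> ?C" if "x \<in> M" for x using ray_dense[OF cl] that by simp
    then have "d x (h x) \<le> \<eta> / 2" if "x \<in> M" for x using that by simp
    then have "\<forall>x\<in>M. d (\<one>\<^bsub>HG\<^esub> x) (h x) \<le> \<eta> / 2"
      by (simp add: homeo_group_one)
    then have "fdist M \<one>\<^bsub>HG\<^esub> h \<le> \<eta> / 2"
      using HG_dist_le[OF HG_one_closed h(1)] by blast
    then show ?thesis using \<eta> by simp
  qed
  then show ?thesis using \<delta>(1) by blast
qed

lemma lifted_homeo:
  assumes h: "h \<in> extensional M" and c: "continuous_map mtopology mtopology h"
    and A: "lifted h A" and g: "continuous_map mtopology mtopology g" "\<And>t. g (ray t) = ray (B t)"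
    and AB: "\<And>t. A (B t) = t" "\<And>t. B (A t) = t"
  shows "h \<in> carrier HG" "lift h = A"
proof -
  have inv: "b (a x) = x" if a: "continuous_map mtopology mtopology a"
    and b: "continuous_map mtopology mtopology b" and ab: "\<And>t. b (a (ray t)) = ray t"
    and x: "x \<in> topspace mtopology" for a b x
  proof -
    have "x \<in> {x \<in> topspace mtopology. b (a x) = x}"
    proof (rule ray_dense[OF _ _ x])
      show "closedin mtopology {x \<in> topspace mtopology. b (a x) = x}"
        using continuous_map_compose[OF a b] by (intro closedin_continuous_maps_eq[OF Hausdorff]) (simp_all add: o_def)
    qed (simp add: ab ray_in)
    then show ?thesis by simp
  qed
  show "h \<in> carrier HG"
    by (rule homeo_groupI[OF _ c g(1)])
       (use h inv[OF c g(1)] inv[OF g(1) c] liftedD(4)[OF A] g(2) AB in auto)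
  show "lift h = A" using A by (rule lift_eqI)
qed

text \<open>Prescribing the coordinates from level \<open>n\<close> on is enough, because they determine the
  lower ones.\<close>

lemma exists_self_map:
  assumes \<theta>: "\<And>x k. x \<in> M \<Longrightarrow> k \<ge> n \<Longrightarrow> zigzag (\<theta> x k) = zigzag (D (Suc k) / D k * \<theta> x (Suc k))"
    and cont: "\<And>k. k \<ge> n \<Longrightarrow> continuous_map mtopology euclideanreal (\<lambda>x. zigzag (\<theta> x k))"
  shows "\<exists>f. f \<in> extensional M \<and> continuous_map mtopology mtopology f \<and>
    (\<forall>x\<in>M. \<forall>k\<ge>n. p k (f x) = zigzag (\<theta> x k))"
proof -
  have "\<exists>y\<in>topspace mtopology. \<forall>k\<ge>n. p k y = zigzag (\<theta> x k)" if x: "x \<in> M" for x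
  proof -
    \<comment> \<open>Below level \<open>n\<close> the angles are those imposed by level \<open>n\<close>.\<close>
    define \<theta>' where "\<theta>' k = (if k < n then D n / D k * \<theta> x n else \<theta> x k)" for k
    have "\<exists>y\<in>topspace mtopology. \<forall>k. p k y = zigzag (\<theta>' k)"
    proof (rule exists_point)
      fix k
      show "zigzag (\<theta>' k) = zigzag (D (Suc k) / D k * \<theta>' (Suc k))"
      proof (cases "k < n")
        case True
        then have "\<theta>' (Suc k) = D n / D (Suc k) * \<theta> x n"
          using D_pos[of n] by (cases "Suc k = n") (auto simp: \<theta>'_def)
        then have e1: "D (Suc k) / D k * \<theta>' (Suc k) = D n / D k * \<theta> x n"
          using D_pos[of "Suc k"] by simp
        have e2: "\<theta>' k = D n / D k * \<theta> x n" using True by (simp add: \<theta>'_def)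
        show ?thesis by (simp only: e1 e2)
      next
        case False
        then show ?thesis using \<theta>[OF x, of k] by (simp add: \<theta>'_def)
      qed
    qed
    then obtain y where "y \<in> topspace mtopology" "\<And>k. p k y = zigzag (\<theta>' k)" by blast
    then show ?thesis by (intro bexI[of _ y]) (simp_all add: \<theta>'_def)
  qed
  then obtain f0 where f0: "\<And>x. x \<in> M \<Longrightarrow> f0 x \<in> topspace mtopology"
    "\<And>x k. x \<in> M \<Longrightarrow> k \<ge> n \<Longrightarrow> p k (f0 x) = zigzag (\<theta> x k)"
    by metis
  define f where "f = restrict f0 M"
  have f: "f x \<in> topspace mtopology" "\<And>k. k \<ge> n \<Longrightarrow> p k (f x) = zigzag (\<theta> x k)" if "x \<in> M" for x
    using f0 that by (simp_all add: f_def)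
  have "continuous_map mtopology mtopology f"
  proof (rule continuous_map_into)
    show "f \<in> topspace mtopology \<rightarrow> topspace mtopology" using f(1) by simp
    fix k
    have hi: "continuous_map mtopology euclideanreal (\<lambda>x. p k (f x))" if "k \<ge> n" for k
      using cont[OF that] by (rule continuous_map_eq) (simp add: f(2)[OF _ that])
    show "continuous_map mtopology euclideanreal (\<lambda>x. p k (f x))"
    proof -
      let ?m = "max k n"
      have "continuous_map euclideanreal euclideanreal (\<lambda>t. zigzag (D ?m / D k * t))"
        using D_pos[of k] by (auto intro!: continuous_intros)
      from continuous_map_compose[OF hi[of ?m] this]
      have "continuous_map mtopology euclideanreal (\<lambda>x. zigzag (D ?m / D k * p ?m (f x)))"
        by (simp add: o_def)
      then show ?thesis
        by (rule continuous_map_eq) (use p_le[of _ k ?m] f(1) in simp)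
    qed
  qed
  moreover have "f \<in> extensional M" by (simp add: f_def)
  ultimately show ?thesis using f(2) by blast
qed

text \<open>Multiplication by \<open>a\<close> on every coordinate is a continuous self-map. It is injective because some
  later degree is a multiple of \<open>a * D n\<close>, so that \<open>p n x\<close> can be recovered from \<open>a\<close> times a later
  coordinate; it is onto because its image is compact and contains the ray.\<close>

lemma scaling_homeo:
  assumes a: "0 < a"
  shows "\<exists>h\<in>carrier HG. lift h = (\<lambda>t. real a * t)"
proof -
  have pz: "continuous_map mtopology euclideanreal (\<lambda>x. zigzag (real a * p k x))" for k
  proof -
    have "continuous_map euclideanreal euclideanreal (\<lambda>t. zigzag (real a * t))"
      by (auto intro!: continuous_intros)
    from continuous_map_compose[OF p_continuous this] show ?thesis by (simp add: o_def)
  qed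
  have "\<exists>f. f \<in> extensional M \<and> continuous_map mtopology mtopology f \<and>
    (\<forall>x\<in>M. \<forall>k\<ge>0. p k (f x) = zigzag (real a * p k x))"
  proof (rule exists_self_map[where n = 0 and \<theta> = "\<lambda>x k. real a * p k x"])
    fix x k assume x: "x \<in> M"
    have "zigzag (real a * p k x) = zigzag (real a * zigzag (D (Suc k) / D k * p (Suc k) x))"
      using p_le[of x k "Suc k"] x by simp
    then show "zigzag (real a * p k x) = zigzag (D (Suc k) / D k * (real a * p (Suc k) x))"
      by (simp add: zigzag_mult_nat mult_ac)
  qed (rule pz)
  then obtain f where f: "f \<in> extensional M" "continuous_map mtopology mtopology f"
    "\<And>x k. x \<in> M \<Longrightarrow> p k (f x) = zigzag (real a * p k x)"
    by auto
  have fM: "f x \<in> M" if "x \<in> M" for x using f(2) that by (auto simp: continuous_map_def)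
  have fray: "f (ray t) = ray (real a * t)" for t
    by (rule eq_rayI[of _ 0]) (simp_all add: fM ray_in f(3) ray(2) zigzag_mult_nat)
  have inj: "inj_on f M"
  proof (rule inj_onI)
    fix x y assume xy: "x \<in> M" "y \<in> M" "f x = f y"
    have "p n z = zigzag (real j * p k (f z))"
      if "z \<in> M" "k \<ge> n" "D k = a * D n * j" for n k j z
    proof -
      have "D k / D n = real j * real a" using that(3) D_pos[of n] by simp
      then have "p n z = zigzag (real j * (real a * p k z))"
        using p_le[of z n k] that by (simp add: mult_ac)
      then show ?thesis using f(3)[OF that(1)] by (simp add: zigzag_mult_nat)
    qed
    moreover have "\<exists>k j. n \<le> k \<and> D k = a * D n * j" for n
      using cofinal_ge[of "a * D n" n] a D_pos[of n] by (auto simp: dvd_def)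
    ultimately have "p n x = p n y" for n using xy by metis
    then show "x = y" using p_inj xy by simp
  qed
  have surj: "f ` M = M"
  proof
    show "f ` M \<subseteq> M" using fM by blast
    show "M \<subseteq> f ` M"
    proof
      fix x assume x: "x \<in> M"
      show "x \<in> f ` M"
      proof (rule ray_dense)
        have "compactin mtopology (f ` topspace mtopology)"
          using compact f(2) image_compactin by (auto simp: compact_space_def)
        then show "closedin mtopology (f ` M)"
          using compactin_imp_closedin[OF Hausdorff] by simp
        show "ray t \<in> f ` M" for t
          using fray[of "t / real a"] a ray_in by (metis imageI nonzero_mult_div_cancel_left of_nat_0_less_iff order_less_irrefl times_divide_eq_right)
      qed (use x in simp)
    qed
  qed
  have "homeomorphic_map mtopology mtopology f"
    using continuous_imp_homeomorphic_map[OF f(2) compact Hausdorff] surj inj by simp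
  then have "f \<in> carrier HG"
    using f(1) surj inj by (simp add: homeo_group_carrier Bij_def bij_betw_def)
  moreover have "lifted f (\<lambda>t. real a * t)"
    unfolding lifted_def using fray by (auto intro!: continuous_intros monoI mult_left_mono)
  ultimately show ?thesis using lift_eqI by blast
qed

text \<open>A reflected homeomorphism of the factor of level \<open>n\<close> acts on all later factors by
  \<open>periodic_homeo_rescale\<close> and \<open>periodic_homeo_zigzag\<close>.\<close>

lemma periodic_homeo_extends:
  assumes b: "periodic_homeo b"
  shows "\<exists>h\<in>carrier HG. lift h = (\<lambda>t. real (D n) * b (t / real (D n)))"
proof -
  have ex: "\<exists>f. f \<in> extensional M \<and> continuous_map mtopology mtopology f \<and>
      (\<forall>t. f (ray t) = ray (real (D n) * b (t / real (D n))))" if b: "periodic_homeo b" for b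
  proof -
    define r where "r k = D k div D n" for k
    have r: "0 < r k" "real (r k) = D k / D n" if "k \<ge> n" for k
      using D_dvd[OF that] D_pos[of k] D_pos[of n] real_D_div[OF that] D_mono[OF that]
      by (simp_all add: r_def div_greater_zero_iff)
    have "\<exists>f. f \<in> extensional M \<and> continuous_map mtopology mtopology f \<and>
      (\<forall>x\<in>M. \<forall>k\<ge>n. p k (f x) = zigzag (b (real (r k) * p k x) / real (r k)))"
    proof (rule exists_self_map[where \<theta> = "\<lambda>x k. b (real (r k) * p k x) / real (r k)"])
      fix x k assume x: "x \<in> M" and k: "n \<le> k"
      define \<rho> where "\<rho> = real (D (Suc k)) / real (D k)"
      have \<rho>: "real (r (Suc k)) = real (r k) * \<rho>" "0 < \<rho>"
        using r(2)[OF k] r(2)[of "Suc k"] k D_pos[of k] D_pos[of "Suc k"] by (simp_all add: \<rho>_def)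
      have "p k x = zigzag (\<rho> * p (Suc k) x)" using p_le[of x k "Suc k"] x by (simp add: \<rho>_def)
      then have "zigzag (b (real (r k) * p k x) / real (r k)) = zigzag (b (real (r k) * (\<rho> * p (Suc k) x)) / real (r k))"
        using periodic_homeo_zigzag[OF b r(1)[OF k]] by simp
      also have "b (real (r k) * (\<rho> * p (Suc k) x)) / real (r k) =
          \<rho> * (b (real (r (Suc k)) * p (Suc k) x) / real (r (Suc k)))"
        using \<rho> r(1)[OF k] by (simp add: mult_ac)
      finally show "zigzag (b (real (r k) * p k x) / real (r k)) =
          zigzag (D (Suc k) / D k * (b (real (r (Suc k)) * p (Suc k) x) / real (r (Suc k))))"
        unfolding \<rho>_def .
    next
      fix k assume k: "n \<le> k"
      have "continuous_on UNIV (\<lambda>t. zigzag (b (real (r k) * t) / real (r k)))"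
        using r(1)[OF k] by (intro continuous_intros continuous_on_compose2[OF periodic_homeo_continuous[OF b, of UNIV]]) auto
      then have "continuous_map euclideanreal euclideanreal (\<lambda>t. zigzag (b (real (r k) * t) / real (r k)))"
        by simp
      from continuous_map_compose[OF p_continuous this]
      show "continuous_map mtopology euclideanreal (\<lambda>x. zigzag (b (real (r k) * p k x) / real (r k)))"
        by (simp add: o_def)
    qed
    then obtain f where f: "f \<in> extensional M" "continuous_map mtopology mtopology f"
      "\<And>x k. x \<in> M \<Longrightarrow> k \<ge> n \<Longrightarrow> p k (f x) = zigzag (b (real (r k) * p k x) / real (r k))"
      by blast
    have fM: "f x \<in> M" if "x \<in> M" for x using f(2) that by (auto simp: continuous_map_def)
    have "f (ray t) = ray (real (D n) * b (t / real (D n)))" for t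
    proof (rule eq_rayI[of _ n])
      fix k assume k: "n \<le> k"
      have "p k (f (ray t)) = zigzag (b (real (r k) * (t / D k)) / real (r k))"
        using f(3)[OF ray_in k] periodic_homeo_zigzag[OF b r(1)[OF k]] by (simp add: ray(2))
      also have "real (r k) * (t / D k) = t / D n"
        using r(2)[OF k] D_pos[of k] by simp
      also have "b (t / D n) / real (r k) = real (D n) * b (t / real (D n)) / D k"
        using r(2)[OF k] by simp
      finally show "p k (f (ray t)) = zigzag (real (D n) * b (t / real (D n)) / D k)" .
    qed (simp add: fM ray_in)
    then show ?thesis using f(1,2) by blast
  qed
  obtain f where f: "f \<in> extensional M" "continuous_map mtopology mtopology f"
    "\<And>t. f (ray t) = ray (real (D n) * b (t / real (D n)))"
    using ex[OF b] by blast
  obtain g where g: "continuous_map mtopology mtopology g"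
    "\<And>t. g (ray t) = ray (real (D n) * inv_into UNIV b (t / real (D n)))"
    using ex[OF periodic_homeo_inv(1)[OF b]] by blast
  have Dn: "0 < real (D n)" using D_pos by simp
  have "lifted f (\<lambda>t. real (D n) * b (t / real (D n)))"
    unfolding lifted_def
  proof (intro conjI allI)
    show "continuous_on UNIV (\<lambda>t. real (D n) * b (t / real (D n)))"
      using Dn by (intro continuous_intros continuous_on_compose2[OF periodic_homeo_continuous[OF b, of UNIV]]) auto
    show "mono (\<lambda>t. real (D n) * b (t / real (D n)))"
    proof (rule monoI)
      fix s t :: real assume "s \<le> t"
      then have "s / D n \<le> t / D n" by (simp add: divide_right_mono)
      then have "b (s / D n) \<le> b (t / D n)"
        by (rule monoD[OF strict_mono_mono[OF periodic_homeoD(1)[OF b]]])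
      then show "D n * b (s / D n) \<le> real (D n) * b (t / real (D n))" by (simp add: mult_left_mono)
    qed
  qed (simp_all add: f(3) periodic_homeoD(3)[OF b])
  from lifted_homeo[OF f(1,2) this g] show ?thesis
    using Dn by (intro bexI[of _ f]) (simp_all add: periodic_homeo_inv(2,3)[OF b])
qed

lemma deg_periodic:
  assumes b: "periodic_homeo b" and h: "lift h = (\<lambda>t. real (D n) * b (t / real (D n)))"
  shows "deg h = 1"
proof (rule deg_eqI)
  have "\<bar>real (D n) * b (t / real (D n)) - 1 * t\<bar> \<le> D n" for t
  proof -
    have "real (D n) * b (t / real (D n)) - 1 * t = D n * (b (t / D n) - t / D n)"
      using D_pos[of n] by (simp add: right_diff_distrib)
    also have "\<bar>\<dots>\<bar> \<le> real (D n) * 1"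
      unfolding abs_mult using periodic_homeo_displacement[OF b] by (intro mult_mono) auto
    finally show ?thesis by simp
  qed
  then show "has_slope (lift h) 1"
    unfolding has_slope_def h by blast
qed

text \<open>A lift \<open>A\<close> of slope 1 nearly commutes with the translation by \<open>2 * L\<close> for some \<open>L = D N\<close>; as
  \<open>A\<close> is odd, \<open>A L\<close> is then close to \<open>L\<close>. Restrict \<open>A\<close> to \<open>[0, L]\<close>, rescale its range to \<open>[0, L]\<close>
  and extend by reflection.\<close>

lemma approximate_by_periodic:
  assumes u: "u \<in> carrier HG" and deg1: "deg u = 1" and \<epsilon>: "0 < \<epsilon>"
  shows "\<exists>n0. \<forall>n\<ge>n0. \<exists>b. periodic_homeo b \<and> (\<forall>t. \<bar>lift u t - real (D n) * b (t / real (D n))\<bar> \<le> \<epsilon>)"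
proof -
  obtain N k where "deg u * real (D N) = real (D 0) * real k" and
    q: "\<forall>t (j::int). \<bar>lift u (t + 2 * real (D N) * of_int j) - lift u t - 2 * (real (D 0) * real k) * of_int j\<bar> \<le> \<epsilon> / 2"
    using deg(3)[OF u, of "\<epsilon> / 2" 0] \<epsilon> by auto
  then have per: "\<bar>lift u (t + 2 * real (D N) * of_int j) - lift u t - 2 * real (D N) * of_int j\<bar> \<le> \<epsilon> / 2" for t and j :: int
    using deg1 by simp
  define L where "L = real (D N)"
  have L: "0 < L" using D_pos by (simp add: L_def)
  note um = lift_strict_mono[OF u] and u0 = lift(5)[OF u] and uodd = lift(2)[OF u]
  \<comment> \<open>Near periodicity at \<open>- L\<close> together with oddness gives \<open>2 * E\<close> close to \<open>2 * L\<close>.\<close>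
  define E where "E = lift u L"
  have E: "0 < E" using strict_mono_less[OF um, of 0 L] u0 L by (simp add: E_def)
  have EL: "\<bar>E - L\<bar> \<le> \<epsilon> / 4"
  proof -
    have "\<bar>2 * E - 2 * L\<bar> \<le> \<epsilon> / 2"
      using per[of "- L" 1] uodd[of L] by (simp add: E_def L_def)
    then show ?thesis by linarith
  qed
  define c where "c t = lift u (L * t) / E" for t
  have "increasing_homeo c"
    unfolding increasing_homeo_def
  proof (intro conjI)
    show "continuous_on {0..1} c"
      unfolding c_def using E by (intro continuous_intros continuous_on_compose2[OF lift(1)[OF u, of UNIV]]) auto
    show "strict_mono_on {0..1} c"
      using strict_mono_less[OF um] L E by (simp add: strict_mono_on_def c_def divide_strict_right_mono)
  qed (use u0 E in \<open>simp_all add: c_def E_def\<close>)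
  then obtain b where b: "periodic_homeo b" "\<And>t. t \<in> {0..1} \<Longrightarrow> b t = c t"
    using increasing_homeo_extends by blast
  have close01: "\<bar>lift u t - L * b (t / L)\<bar> \<le> \<epsilon> / 4" if t: "0 \<le> t" "t \<le> L" for t
  proof -
    have "b (t / L) = lift u t / E" using b(2)[of "t / L"] t L by (simp add: c_def)
    then have "lift u t - L * b (t / L) = lift u t * (1 - L / E)" by (simp add: algebra_simps)
    also have "\<dots> = lift u t / E * (E - L)" using E by (simp add: field_simps)
    also have "\<bar>\<dots>\<bar> \<le> 1 * (\<epsilon> / 4)"
      unfolding abs_mult
    proof (rule mult_mono)
      have "lift u t \<le> E" "0 \<le> lift u t"
        using strict_mono_less_eq[OF um, of t L] strict_mono_less_eq[OF um, of 0 t] t u0 by (simp_all add: E_def)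
      then show "\<bar>lift u t / E\<bar> \<le> 1" using E by simp
    qed (use EL in auto)
    finally show ?thesis by simp
  qed
  have close: "\<bar>lift u t - L * b (t / L)\<bar> \<le> \<epsilon>" for t
  proof -
    define i where "i = round (t / L / 2)"
    define s where "s = t - 2 * L * of_int i"
    have "\<bar>of_int i - t / L / 2\<bar> \<le> 1 / 2" unfolding i_def by (rule of_int_round_abs_le)
    then have "- (1/2) \<le> of_int i - t / L / 2" "of_int i - t / L / 2 \<le> 1 / 2" by linarith+
    then have s: "\<bar>s\<bar> \<le> L" using L by (simp add: s_def field_simps abs_le_iff)
    have t: "t = s + 2 * L * of_int i" by (simp add: s_def)
    have "t / L = s / L + 2 * of_int i" using L by (simp add: t field_simps)
    then have bt: "L * b (t / L) = L * b (s / L) + 2 * L * of_int i"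
      using periodic_homeo_shift[OF b(1), of "s / L" i] by (simp add: algebra_simps)
    have ss: "\<bar>lift u s - L * b (s / L)\<bar> \<le> \<epsilon> / 4"
    proof (cases "0 \<le> s")
      case True then show ?thesis using close01[of s] s by simp
    next
      case False
      have "lift u s - L * b (s / L) = - (lift u (- s) - L * b (- s / L))"
        using uodd[of s] periodic_homeoD(3)[OF b(1), of "s / L"] by simp
      then have "\<bar>lift u s - L * b (s / L)\<bar> = \<bar>lift u (- s) - L * b (- s / L)\<bar>"
        by (simp only: abs_minus_cancel)
      also have "\<dots> \<le> \<epsilon> / 4" using s False by (intro close01) auto
      finally show ?thesis .
    qed
    have "\<bar>lift u t - lift u s - 2 * L * of_int i\<bar> \<le> \<epsilon> / 2"
      using per[of s i] by (simp add: t L_def)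
    then show ?thesis using ss bt \<epsilon> by linarith
  qed
  show ?thesis
  proof (intro exI[of _ N] allI impI)
    fix n assume n: "N \<le> n"
    define r where "r = D n div D N"
    have r: "0 < r" "real r = D n / D N"
      using D_dvd[OF n] D_pos[of n] D_pos[of N] real_D_div[OF n] D_mono[OF n]
      by (simp_all add: r_def div_greater_zero_iff)
    have "D n * (b (real r * (t / D n)) / real r) = L * b (t / L)" for t
      using r(2) D_pos[of n] D_pos[of N] by (simp add: L_def)
    then show "\<exists>b. periodic_homeo b \<and> (\<forall>t. \<bar>lift u t - real (D n) * b (t / real (D n))\<bar> \<le> \<epsilon>)"
      using periodic_homeo_rescale[OF b(1) r(1)] close
      by (intro exI[of _ "\<lambda>t. b (real r * t) / real r"]) simp
  qed
qed

end


section \<open>Extreme amenability of the degree one homeomorphisms\<close>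

context knaster_metric
begin

definition degree_one :: "('a \<Rightarrow> 'a) set"
  where "degree_one = {h \<in> carrier HG. deg h = 1}"

lemma degree_oneD: "h \<in> degree_one \<Longrightarrow> h \<in> carrier HG" "h \<in> degree_one \<Longrightarrow> deg h = 1"
  by (simp_all add: degree_one_def)

lemma degree_one_mult: "g \<in> degree_one \<Longrightarrow> h \<in> degree_one \<Longrightarrow> g \<otimes>\<^bsub>HG\<^esub> h \<in> degree_one"
  by (simp add: degree_one_def HG_mult_closed deg_mult)

lemma degree_one_one: "\<one>\<^bsub>HG\<^esub> \<in> degree_one"
  using deg_of_linear[of "\<one>\<^bsub>HG\<^esub>" 1] by (simp add: degree_one_def HG_one_closed lift_one)

text \<open>Suppose no point is fixed. Every \<open>x\<close> then has an open neighbourhood \<open>O' x\<close> that some group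
  element \<open>g x\<close> moves off itself, and a smaller neighbourhood \<open>W x\<close> that stays in \<open>O' x\<close> under all
  group elements of displacement at most \<open>\<delta> x\<close>. Finitely many \<open>W x\<close> cover the space. It suffices to
  find \<open>x\<close> among them and a group element \<open>h\<close> such that both \<open>h\<close> and \<open>g x h\<close> move a base point
  \<open>x0\<close> into \<open>O' x\<close>.

  Replace each \<open>g x\<close> by a homeomorphism of a common factor. For a finite set \<open>A\<close> with as many points
  as the grid \<open>S\<close>, let \<open>\<gamma> A\<close> be an increasing homeomorphism that maps \<open>S\<close> to \<open>A\<close>, and colour \<open>A\<close> by
  an index \<open>x\<close> for which the inverse of \<open>\<gamma> A\<close> moves \<open>x0\<close> into \<open>W x\<close>. Another homeomorphism whose
  inverse maps \<open>S\<close> to \<open>A\<close> differs from the inverse of \<open>\<gamma> A\<close> by a left factor that fixes \<open>S\<close>, hence of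
  small displacement, and so moves \<open>x0\<close> into \<open>O' x\<close>. Ramsey's theorem provides a set \<open>Y\<close> all of
  whose subsets of the right size have the same colour \<open>x\<close>. The inverse images of \<open>S\<close> under the
  identity and under \<open>g x\<close> form a finite set \<open>B\<close>; if \<open>\<beta>\<close> maps \<open>B\<close> into \<open>Y\<close>, the inverse of \<open>\<beta>\<close> is the
  desired \<open>h\<close>.\<close>

lemma extremely_amenable_degree_one:
  assumes X: "compact_space X" "Hausdorff_space X" "topspace X \<noteq> {}"
    and act: "continuous_action (HG\<lparr>carrier := degree_one\<rparr>) (subtopology H.mtopology degree_one) X \<phi>"
  shows "\<exists>x\<in>topspace X. \<forall>g\<in>degree_one. \<phi> g x = x"
proof (rule ccontr)
  assume no_fixed: "\<not> (\<exists>x\<in>topspace X. \<forall>g\<in>degree_one. \<phi> g x = x)"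
  let ?G = "HG\<lparr>carrier := degree_one\<rparr>" and ?T = "subtopology H.mtopology degree_one"
  interpret A: group_action ?G "topspace X" \<phi>
    using act by (simp add: continuous_action_def)
  have ts: "topspace ?T = degree_one"
    using degree_oneD(1) by auto
  have in_X: "\<phi> g x \<in> topspace X" if "g \<in> degree_one" "x \<in> topspace X" for g x
    using A.element_image[of g x "\<phi> g x"] that by simp
  have comp: "\<phi> (g \<otimes>\<^bsub>HG\<^esub> h) x = \<phi> g (\<phi> h x)"
    if "g \<in> degree_one" "h \<in> degree_one" "x \<in> topspace X" for g h x
    using A.composition_rule[of x g h] that by simp
  have one: "\<phi> \<one>\<^bsub>HG\<^esub> x = x" if "x \<in> topspace X" for x
    using fun_cong[OF A.id_eq_one, of x] that by simp
  define good where "good x g O' W \<delta> \<longleftrightarrow> g \<in> degree_one \<and> (\<forall>y\<in>O'. \<phi> g y \<notin> O') \<and> openin X W \<and> x \<in> W \<and>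
    0 < \<delta> \<and> (\<forall>w\<in>degree_one. (\<forall>t. \<bar>lift w t - t\<bar> \<le> \<delta>) \<longrightarrow> (\<forall>y\<in>W. \<phi> w y \<in> O'))"
    for x g O' W and \<delta> :: real
  have "\<exists>g O' W \<delta>. good x g O' W \<delta>" if x: "x \<in> topspace X" for x
  proof -
    obtain g where g: "g \<in> degree_one" "\<phi> g x \<noteq> x" using no_fixed x by blast
    obtain P Q where PQ: "openin X P" "openin X Q" "x \<in> P" "\<phi> g x \<in> Q" "disjnt P Q"
      using X(2) x in_X[OF g(1) x] g(2) unfolding Hausdorff_space_def by metis
    have "continuous_map X X (\<phi> g)"
      using continuous_action_translate[OF act] ts g(1) by simp
    then have "openin X {y \<in> topspace X. \<phi> g y \<in> Q}"
      using PQ(2) by (rule openin_continuous_map_preimage)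
    define O' where "O' = P \<inter> {y \<in> topspace X. \<phi> g y \<in> Q}"
    have O': "openin X O'" "x \<in> O'"
      using \<open>openin X {y \<in> topspace X. \<phi> g y \<in> Q}\<close> PQ x by (auto simp: O'_def)
    have moved: "\<forall>y\<in>O'. \<phi> g y \<notin> O'"
      using PQ(5) by (auto simp: O'_def disjnt_iff)
    have "continuous_map (prod_topology ?T X) X (\<lambda>(g, x). \<phi> g x)"
      using act by (simp add: continuous_action_def)
    then have "openin (prod_topology ?T X) {z \<in> topspace (prod_topology ?T X). (case z of (g, x) \<Rightarrow> \<phi> g x) \<in> O'}"
      using O'(1) by (rule openin_continuous_map_preimage)
    moreover have "(\<one>\<^bsub>HG\<^esub>, x) \<in> {z \<in> topspace (prod_topology ?T X). (case z of (g, x) \<Rightarrow> \<phi> g x) \<in> O'}"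
      using degree_one_one HG_one_closed x one[OF x] O'(2) by simp
    ultimately obtain V W where VW: "openin ?T V" "openin X W" "\<one>\<^bsub>HG\<^esub> \<in> V" "x \<in> W"
      "V \<times> W \<subseteq> {z \<in> topspace (prod_topology ?T X). (case z of (g, x) \<Rightarrow> \<phi> g x) \<in> O'}"
      unfolding openin_prod_topology_alt by meson
    obtain V' where V': "openin H.mtopology V'" "V = V' \<inter> degree_one"
      using VW(1) unfolding openin_subtopology by blast
    then obtain \<eta> where \<eta>: "0 < \<eta>" "H.mball \<one>\<^bsub>HG\<^esub> \<eta> \<subseteq> V'"
      using VW(3) unfolding H.openin_mtopology by blast
    obtain \<delta> where \<delta>: "0 < \<delta>" "\<And>h. h \<in> carrier HG \<Longrightarrow> (\<And>t. \<bar>lift h t - t\<bar> \<le> \<delta>) \<Longrightarrow> fdist M \<one>\<^bsub>HG\<^esub> h < \<eta>"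
      using small_lift_displacement[OF \<eta>(1)] by blast
    have "\<phi> w y \<in> O'" if w: "w \<in> degree_one" "\<And>t. \<bar>lift w t - t\<bar> \<le> \<delta>" and y: "y \<in> W" for w y
    proof -
      have "w \<in> H.mball \<one>\<^bsub>HG\<^esub> \<eta>"
        using \<delta>(2)[of w] w degree_oneD(1)[OF w(1)] HG_one_closed by (simp add: H.in_mball)
      then have "(w, y) \<in> V \<times> W" using \<eta>(2) V'(2) w(1) y by blast
      from subsetD[OF VW(5) this] show ?thesis by simp
    qed
    then have "good x g O' W \<delta>"
      unfolding good_def using g(1) moved VW(2,4) \<delta>(1) by blast
    then show ?thesis by blast
  qed
  then have "\<exists>z. good x (fst z) (fst (snd z)) (fst (snd (snd z))) (snd (snd (snd z)))"
    if "x \<in> topspace X" for x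
    using that by (metis fst_conv snd_conv)
  then have "\<forall>x\<in>topspace X. \<exists>z. good x (fst z) (fst (snd z)) (fst (snd (snd z))) (snd (snd (snd z)))"
    by (intro ballI)
  from bchoice[OF this] obtain z where
    z: "\<forall>x\<in>topspace X. good x (fst (z x)) (fst (snd (z x))) (fst (snd (snd (z x)))) (snd (snd (snd (z x))))"
    by blast
  define g where "g x = fst (z x)" for x
  define O' where "O' x = fst (snd (z x))" for x
  define W where "W x = fst (snd (snd (z x)))" for x
  define \<delta> where "\<delta> x = snd (snd (snd (z x)))" for x
  have good: "good x (g x) (O' x) (W x) (\<delta> x)" if "x \<in> topspace X" for x
    using z that by (simp add: g_def O'_def W_def \<delta>_def)
  have "\<exists>F. finite F \<and> F \<subseteq> topspace X \<and> topspace X \<subseteq> (\<Union>x\<in>F. W x)"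
  proof -
    have "compactin X (topspace X)" using X(1) by (simp add: compact_space_def)
    moreover have "\<And>U. U \<in> W ` topspace X \<Longrightarrow> openin X U" using good by (auto simp: good_def)
    moreover have "topspace X \<subseteq> \<Union> (W ` topspace X)" using good by (auto simp: good_def)
    ultimately obtain \<F> where "finite \<F>" "\<F> \<subseteq> W ` topspace X" "topspace X \<subseteq> \<Union>\<F>"
      unfolding compactin_def by meson
    then show ?thesis using finite_subset_image[of \<F> W "topspace X"] by metis
  qed
  then obtain F where F: "finite F" "F \<subseteq> topspace X" "topspace X \<subseteq> (\<Union>x\<in>F. W x)" by blast
  obtain x0 where x0: "x0 \<in> topspace X" using X(3) by blast
  have Fne: "F \<noteq> {}" using F(3) x0 by blast
  \<comment> \<open>Half of the smallest \<open>\<delta>\<close>, because two errors add up: the approximation of \<open>g x\<close> and the mesh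
    of the grid.\<close>
  define \<epsilon> where "\<epsilon> = Min (\<delta> ` F) / 2"
  have \<epsilon>: "0 < \<epsilon>" "2 * \<epsilon> \<le> \<delta> x" if "x \<in> F" for x
  proof -
    have "Min (\<delta> ` F) \<in> \<delta> ` F" using F(1) Fne by (intro Min_in) auto
    then show "0 < \<epsilon>" using good F(2) unfolding \<epsilon>_def good_def by fastforce
    show "2 * \<epsilon> \<le> \<delta> x" using F(1) that by (simp add: \<epsilon>_def)
  qed
  have \<epsilon>0: "0 < \<epsilon>" using \<epsilon>(1) Fne by blast
  have "\<exists>n0. \<forall>n\<ge>n0. \<exists>b. periodic_homeo b \<and> (\<forall>t. \<bar>lift (g x) t - real (D n) * b (t / real (D n))\<bar> \<le> \<epsilon>)"
    if "x \<in> F" for x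
  proof -
    have "g x \<in> degree_one" using good[of x] F(2) that by (auto simp: good_def)
    then show ?thesis using approximate_by_periodic[OF _ _ \<epsilon>0] degree_oneD by blast
  qed
  then obtain n0 where n0: "\<And>x n. x \<in> F \<Longrightarrow> n0 x \<le> n \<Longrightarrow>
    \<exists>b. periodic_homeo b \<and> (\<forall>t. \<bar>lift (g x) t - real (D n) * b (t / real (D n))\<bar> \<le> \<epsilon>)"
    by metis
  define n where "n = Max (n0 ` F)"
  define L where "L = real (D n)"
  have L: "0 < L" using D_pos by (simp add: L_def)
  have "n0 x \<le> n" if "x \<in> F" for x using F(1) that by (simp add: n_def)
  then have "\<exists>b. periodic_homeo b \<and> (\<forall>t. \<bar>lift (g x) t - L * b (t / L)\<bar> \<le> \<epsilon>)" if "x \<in> F" for x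
    using n0[OF that] that by (simp add: L_def)
  then obtain b where b: "\<And>x. x \<in> F \<Longrightarrow> periodic_homeo (b x)"
    "\<And>x t. x \<in> F \<Longrightarrow> \<bar>lift (g x) t - L * b x (t / L)\<bar> \<le> \<epsilon>"
    by metis
  have "\<exists>h\<in>degree_one. lift h = (\<lambda>t. L * c (t / L))" if c: "periodic_homeo c" for c
    using periodic_homeo_extends[OF c, of n] deg_periodic[OF c, of _ n] unfolding L_def degree_one_def by blast
  then obtain Hm where Hm: "\<And>c. periodic_homeo c \<Longrightarrow> Hm c \<in> degree_one"
    "\<And>c. periodic_homeo c \<Longrightarrow> lift (Hm c) = (\<lambda>t. L * c (t / L))"
    by metis
  obtain k :: nat where k: "L / \<epsilon> < real k" using reals_Archimedean2 by blast
  have k0: "0 < k"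
  proof -
    have "0 < L / \<epsilon>" using L \<epsilon>0 by simp
    then show ?thesis using k by linarith
  qed
  have Lk: "L * (1 / real k) \<le> \<epsilon>" using k \<epsilon>0 k0 by (simp add: field_simps)
  \<comment> \<open>The interior points of a grid of mesh \<open>1 / k\<close>, which is at most \<open>\<epsilon>\<close> on the scale of the ray.\<close>
  define S where "S = (\<lambda>l. real l / real k) ` {1..<k}"
  have S: "finite S" "S \<subseteq> {0<..<1}" using k0 by (auto simp: S_def)
  define \<gamma> where "\<gamma> A = (SOME c. periodic_homeo c \<and> c ` S = A)" for A
  have \<gamma>: "periodic_homeo (\<gamma> A)" "\<gamma> A ` S = A" if "A \<subseteq> {0<..<1}" "finite A" "card A = card S" for A
    using someI_ex[OF periodic_homeo_matching[OF S that(2,1) that(3)[symmetric]]] by (simp_all add: \<gamma>_def)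
  obtain e :: "nat \<Rightarrow> _" where e: "bij_betw e {..<card F} F"
    using ex_bij_betw_nat_finite[OF F(1)] by (auto simp: atLeast0LessThan)
  define colour where "colour A = (SOME j. j < card F \<and> \<phi> (Hm (inv_into UNIV (\<gamma> A))) x0 \<in> W (e j))" for A
  have colour: "colour A < card F" "\<phi> (Hm (inv_into UNIV (\<gamma> A))) x0 \<in> W (e (colour A))"
    if A: "A \<subseteq> {0<..<1}" "finite A" "card A = card S" for A
  proof -
    have "\<phi> (Hm (inv_into UNIV (\<gamma> A))) x0 \<in> topspace X"
      by (intro in_X Hm(1) periodic_homeo_inv(1) \<gamma>(1) A x0)
    then obtain x where x: "x \<in> F" "\<phi> (Hm (inv_into UNIV (\<gamma> A))) x0 \<in> W x" using F(3) by blast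
    then have "\<exists>j. j < card F \<and> e j = x" using e by (metis bij_betw_iff_bijections lessThan_iff)
    then have "\<exists>j. j < card F \<and> \<phi> (Hm (inv_into UNIV (\<gamma> A))) x0 \<in> W (e j)" using x(2) by blast
    from someI_ex[OF this]
    show "colour A < card F" "\<phi> (Hm (inv_into UNIV (\<gamma> A))) x0 \<in> W (e (colour A))"
      by (simp_all add: colour_def)
  qed
  have "infinite {0<..<1::real}" by (simp add: infinite_Ioo)
  moreover have "\<forall>A. A \<subseteq> {0<..<1::real} \<and> finite A \<and> card A = card S \<longrightarrow> colour A < card F"
    using colour(1) by blast
  ultimately have "\<exists>Y j. Y \<subseteq> {0<..<1::real} \<and> infinite Y \<and> j < card F \<and>
      (\<forall>A. A \<subseteq> Y \<and> finite A \<and> card A = card S \<longrightarrow> colour A = j)"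
    by (rule Ramsey)
  then obtain Y j where Y: "Y \<subseteq> {0<..<1::real}" "infinite Y" "j < card F"
    and mono: "\<And>A. A \<subseteq> Y \<Longrightarrow> finite A \<Longrightarrow> card A = card S \<Longrightarrow> colour A = j"
    by blast
  define x where "x = e j"
  have xF: "x \<in> F" using Y(3) bij_betwE[OF e] by (simp add: x_def)
  then have xX: "x \<in> topspace X" using F(2) by blast
  note gx = good[OF xX, unfolded good_def]
  have gN: "g x \<in> degree_one" using gx by blast
  \<comment> \<open>A group element \<open>u\<close> that is close to a homeomorphism \<open>a\<close> of the chosen factor moves \<open>x0\<close>
    into \<open>O' x\<close> as soon as \<open>a\<close> pulls the grid back into \<open>Y\<close>.\<close>
  have homogeneous: "\<phi> u x0 \<in> O' x"
    if u: "u \<in> degree_one" and a: "periodic_homeo a" and ua: "\<And>t. \<bar>lift u t - L * a (t / L)\<bar> \<le> \<epsilon>"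
      and AY: "inv_into UNIV a ` S \<subseteq> Y" for u a
  proof -
    define A where "A = inv_into UNIV a ` S"
    note ai = periodic_homeo_inv[OF a]
    have inj: "inj_on (inv_into UNIV a) S"
      by (rule inj_on_subset[OF bij_is_inj[OF periodic_homeo_bij[OF ai(1)]]]) simp
    have A: "A \<subseteq> Y" "finite A" "card A = card S" "A \<subseteq> {0<..<1}"
      using AY S(1) card_image[OF inj] Y(1) by (auto simp: A_def)
    note \<gamma>A = \<gamma>[OF A(4,2,3)]
    note \<gamma>i = periodic_homeo_inv[OF \<gamma>A(1)]
    define v where "v = Hm (inv_into UNIV (\<gamma> A))"
    define w where "w = u \<otimes>\<^bsub>HG\<^esub> Hm (\<gamma> A)"
    have vN: "v \<in> degree_one" unfolding v_def by (rule Hm(1)[OF \<gamma>i(1)])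
    have wN: "w \<in> degree_one" unfolding w_def by (intro degree_one_mult u Hm(1) \<gamma>A(1))
    have lw: "lift w = (\<lambda>t. lift u (L * \<gamma> A (t / L)))"
      unfolding w_def using lift_mult[OF degree_oneD(1)[OF u] degree_oneD(1)[OF Hm(1)[OF \<gamma>A(1)]]] Hm(2)[OF \<gamma>A(1)]
      by simp
    have c: "periodic_homeo (\<lambda>t. a (\<gamma> A t))" by (rule periodic_homeo_compose[OF a \<gamma>A(1)])
    have "(\<lambda>t. a (\<gamma> A t)) ` S = a ` A" using \<gamma>A(2) by (metis image_image)
    also have "\<dots> = S" unfolding A_def image_image ai(2) by simp
    finally have "(\<lambda>t. a (\<gamma> A t)) ` S = S" .
    from strict_mono_finite_self_map[OF S(1) periodic_homeoD(1)[OF c] this]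
    have "a (\<gamma> A (real l / real k)) = real l / real k" if "l \<in> {1..<k}" for l
      using that unfolding S_def by blast
    from periodic_homeo_fixes_grid[OF c k0 this]
    have grid: "\<bar>a (\<gamma> A t) - t\<bar> \<le> 1 / real k" for t by blast
    have "\<bar>lift w t - t\<bar> \<le> \<delta> x" for t
    proof -
      have "\<bar>lift w t - L * a (\<gamma> A (t / L))\<bar> \<le> \<epsilon>"
        using ua[of "L * \<gamma> A (t / L)"] L by (simp add: lw)
      moreover have "\<bar>L * a (\<gamma> A (t / L)) - t\<bar> \<le> \<epsilon>"
      proof -
        have "L * a (\<gamma> A (t / L)) - t = L * (a (\<gamma> A (t / L)) - t / L)"
          using L by (simp add: right_diff_distrib)
        also have "\<bar>\<dots>\<bar> \<le> L * (1 / real k)"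
          unfolding abs_mult using L grid[of "t / L"] by (intro mult_mono) auto
        finally show ?thesis using Lk by linarith
      qed
      ultimately show ?thesis using \<epsilon>(2)[OF xF] by linarith
    qed
    moreover have "\<phi> v x0 \<in> W x"
      using colour(2)[OF A(4,2,3)] mono[OF A(1-3)] by (simp add: v_def x_def)
    ultimately have "\<phi> w (\<phi> v x0) \<in> O' x"
      using gx wN by blast
    moreover have "w \<otimes>\<^bsub>HG\<^esub> v = u"
    proof (rule homeo_eqI)
      show "w \<otimes>\<^bsub>HG\<^esub> v \<in> carrier HG" "u \<in> carrier HG"
        using degree_oneD(1) degree_one_mult wN vN u by blast+
      have "lift (w \<otimes>\<^bsub>HG\<^esub> v) = (\<lambda>t. lift w (lift v t))"
        by (rule lift_mult[OF degree_oneD(1)[OF wN] degree_oneD(1)[OF vN]])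
      also have "\<dots> = lift u"
        using L by (simp add: fun_eq_iff lw v_def Hm(2)[OF \<gamma>i(1)] \<gamma>i(2))
      finally show "lift (w \<otimes>\<^bsub>HG\<^esub> v) = lift u" .
    qed
    ultimately show ?thesis using comp[OF wN vN x0] by simp
  qed
  note bi = periodic_homeo_inv[OF b(1)[OF xF]]
  define B where "B = S \<union> inv_into UNIV (b x) ` S"
  have B: "finite B" "B \<subseteq> {0<..<1}"
    using S periodic_homeo_unit[OF bi(1)] by (auto simp: B_def)
  obtain B' where B': "B' \<subseteq> Y" "finite B'" "card B' = card B"
    using infinite_arbitrarily_large[OF Y(2)] by blast
  obtain \<beta> where \<beta>: "periodic_homeo \<beta>" "\<beta> ` B = B'"
    using periodic_homeo_matching[OF B B'(2) _ B'(3)[symmetric]] B'(1) Y(1) by blast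
  note \<beta>i = periodic_homeo_inv[OF \<beta>(1)]
  define h where "h = Hm (inv_into UNIV \<beta>)"
  have hN: "h \<in> degree_one" unfolding h_def by (rule Hm(1)[OF \<beta>i(1)])
  have lh: "lift h = (\<lambda>t. L * inv_into UNIV \<beta> (t / L))" unfolding h_def by (rule Hm(2)[OF \<beta>i(1)])
  have inv_inv: "inv_into UNIV (inv_into UNIV \<beta>) = \<beta>"
    using periodic_homeo_bij[OF \<beta>(1)] by (rule inv_inv_eq)
  have "\<phi> h x0 \<in> O' x"
  proof (rule homogeneous[OF hN \<beta>i(1)])
    show "\<bar>lift h t - L * inv_into UNIV \<beta> (t / L)\<bar> \<le> \<epsilon>" for t using \<epsilon>0 by (simp add: lh)
    show "inv_into UNIV (inv_into UNIV \<beta>) ` S \<subseteq> Y"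
      unfolding inv_inv using \<beta>(2) B'(1) by (auto simp: B_def)
  qed
  moreover have "\<phi> (g x) (\<phi> h x0) \<in> O' x"
  proof -
    have a: "periodic_homeo (\<lambda>t. b x (inv_into UNIV \<beta> t))"
      by (rule periodic_homeo_compose[OF b(1)[OF xF] \<beta>i(1)])
    have inv_a: "inv_into UNIV (\<lambda>t. b x (inv_into UNIV \<beta> t)) s = \<beta> (inv_into UNIV (b x) s)" for s
    proof -
      have "inv_into UNIV (\<lambda>t. b x (inv_into UNIV \<beta> t)) (b x (inv_into UNIV \<beta> (\<beta> (inv_into UNIV (b x) s)))) =
          \<beta> (inv_into UNIV (b x) s)"
        by (rule periodic_homeo_inv(3)[OF a])
      then show ?thesis by (simp add: \<beta>i bi)
    qed
    have "\<phi> (g x \<otimes>\<^bsub>HG\<^esub> h) x0 \<in> O' x"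
    proof (rule homogeneous[OF degree_one_mult[OF gN hN] a])
      show "\<bar>lift (g x \<otimes>\<^bsub>HG\<^esub> h) t - L * b x (inv_into UNIV \<beta> (t / L))\<bar> \<le> \<epsilon>" for t
        using b(2)[OF xF, of "L * inv_into UNIV \<beta> (t / L)"] L
        by (simp add: lift_mult[OF degree_oneD(1)[OF gN] degree_oneD(1)[OF hN]] lh)
      show "inv_into UNIV (\<lambda>t. b x (inv_into UNIV \<beta> t)) ` S \<subseteq> Y"
        using \<beta>(2) B'(1) by (auto simp: inv_a B_def)
    qed
    then show ?thesis using comp[OF gN hN x0] by simp
  qed
  ultimately show False using gx by blast
qed

end


section \<open>The degree homomorphism and its splitting\<close>

definition nth_prime :: "nat \<Rightarrow> nat"
  where "nth_prime = enumerate {p. prime p}"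

lemma nth_prime: "prime (nth_prime i)" "prime p \<Longrightarrow> \<exists>i. nth_prime i = p"
  "nth_prime i = nth_prime j \<longleftrightarrow> i = j"
proof -
  have bij: "bij_betw nth_prime UNIV {p. prime p}"
    unfolding nth_prime_def using primes_infinite by (rule bij_enumerate)
  show "prime (nth_prime i)" using bij_betwE[OF bij] by simp
  show "prime p \<Longrightarrow> \<exists>i. nth_prime i = p" using bij by (metis bij_betw_iff_bijections mem_Collect_eq)
  show "nth_prime i = nth_prime j \<longleftrightarrow> i = j"
    using bij_betw_imp_inj_on[OF bij] by (simp add: inj_eq)
qed

text \<open>The isomorphism of the free abelian group on the natural numbers with the positive rationals,
  the generators being mapped to the primes.\<close>

definition prime_ratio :: "(nat \<Rightarrow>\<^sub>0 int) \<Rightarrow> real"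
  where "prime_ratio c = (\<Prod>i\<in>Poly_Mapping.keys c. real (nth_prime i) powi (Poly_Mapping.lookup c i))"

lemma nth_prime_pos: "0 < real (nth_prime i)"
  using nth_prime(1)[of i] prime_gt_0_nat by simp

lemma prime_ratio_superset:
  assumes "finite I" "Poly_Mapping.keys c \<subseteq> I"
  shows "prime_ratio c = (\<Prod>i\<in>I. real (nth_prime i) powi (Poly_Mapping.lookup c i))"
  unfolding prime_ratio_def
  by (rule prod.mono_neutral_left[OF assms]) (simp add: in_keys_iff)

lemma prime_ratio_add: "prime_ratio (a + b) = prime_ratio a * prime_ratio b"
proof -
  let ?I = "Poly_Mapping.keys a \<union> Poly_Mapping.keys b"
  have "prime_ratio (a + b) = (\<Prod>i\<in>?I. real (nth_prime i) powi (Poly_Mapping.lookup (a + b) i))"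
    by (rule prime_ratio_superset) (simp_all add: Poly_Mapping.keys_add)
  also have "\<dots> = (\<Prod>i\<in>?I. real (nth_prime i) powi (Poly_Mapping.lookup a i) * real (nth_prime i) powi (Poly_Mapping.lookup b i))"
    using nth_prime_pos by (intro prod.cong refl) (simp add: lookup_add power_int_add less_imp_neq[symmetric])
  also have "\<dots> = prime_ratio a * prime_ratio b"
    by (simp add: prod.distrib prime_ratio_superset[of ?I a] prime_ratio_superset[of ?I b])
  finally show ?thesis .
qed

lemma prime_ratio_0: "prime_ratio 0 = 1"
  by (simp add: prime_ratio_def)

lemma prime_ratio_single: "prime_ratio (Poly_Mapping.single i 1) = real (nth_prime i)"
  by (simp add: prime_ratio_def)

text \<open>Separating positive and negative exponents gives a fraction of natural numbers.\<close>

lemma prime_ratio_fraction: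
  "prime_ratio c * real (\<Prod>i\<in>Poly_Mapping.keys c. nth_prime i ^ nat (- Poly_Mapping.lookup c i)) =
    real (\<Prod>i\<in>Poly_Mapping.keys c. nth_prime i ^ nat (Poly_Mapping.lookup c i))"
proof -
  have "x powi m * x ^ nat (- m) = x ^ nat m" if "0 < x" for x :: real and m
    using that by (cases "0 \<le> m") (simp_all add: power_int_def field_simps)
  then show ?thesis
    unfolding prime_ratio_def of_nat_prod of_nat_power prod.distrib[symmetric]
    using nth_prime_pos by (intro prod.cong refl) blast
qed

lemma prime_ratio_pos: "0 < prime_ratio c"
  unfolding prime_ratio_def using nth_prime_pos by (intro prod_pos) (simp add: zero_less_power_int)

text \<open>A prime dividing one side of the equation between numerator and denominator divides the other
  side, but no prime occurs in both.\<close>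

lemma prime_ratio_eq_1:
  assumes "prime_ratio c = 1" shows "c = 0"
proof -
  let ?K = "Poly_Mapping.keys c" and ?c = "Poly_Mapping.lookup c"
  have eq: "(\<Prod>i\<in>?K. nth_prime i ^ nat (- ?c i)) = (\<Prod>i\<in>?K. nth_prime i ^ nat (?c i))"
    using prime_ratio_fraction[of c] assms by (simp only: mult_1 of_nat_eq_iff)
  have key: "e i = 0 \<or> e' i \<noteq> 0"
    if i: "i \<in> ?K" and ee': "(\<Prod>i\<in>?K. nth_prime i ^ e i) = (\<Prod>i\<in>?K. nth_prime i ^ e' i)" for i and e e' :: "nat \<Rightarrow> nat"
  proof (rule ccontr)
    assume neg: "\<not> (e i = 0 \<or> e' i \<noteq> 0)"
    then have "nth_prime i dvd nth_prime i ^ e i" by (simp add: dvd_power)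
    also have "\<dots> dvd (\<Prod>i\<in>?K. nth_prime i ^ e i)"
      using dvd_prodI[OF finite_keys i, of "\<lambda>i. nth_prime i ^ e i"] by simp
    finally have "nth_prime i dvd (\<Prod>i\<in>?K. nth_prime i ^ e' i)" by (simp only: ee')
    then obtain j where j: "nth_prime i dvd nth_prime j ^ e' j"
      using prime_dvd_prod_iff[OF _ nth_prime(1)[of i], of ?K "\<lambda>i. nth_prime i ^ e' i"] by auto
    then have "nth_prime i dvd nth_prime j" using nth_prime(1) prime_dvd_power by blast
    then have "nth_prime i = nth_prime j" by (rule primes_dvd_imp_eq[OF nth_prime(1) nth_prime(1)])
    then have ij: "i = j" by (simp only: nth_prime(3))
    have "nth_prime i dvd 1" using j neg unfolding ij[symmetric] by simp
    then show False using not_prime_unit[of "nth_prime i"] nth_prime(1)[of i] by blast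
  qed
  have "?c i = 0" for i
  proof (rule ccontr)
    assume "?c i \<noteq> 0"
    then have "i \<in> ?K" by (simp add: in_keys_iff)
    from key[OF this eq] key[OF this eq[symmetric]] \<open>?c i \<noteq> 0\<close> show False by auto
  qed
  then show ?thesis by (intro poly_mapping_eqI) simp
qed

lemma prime_ratio_uminus: "prime_ratio (- c) = 1 / prime_ratio c"
  using prime_ratio_add[of c "- c"] prime_ratio_pos[of c] by (simp add: prime_ratio_0 field_simps)

lemma prime_ratio_inj: "prime_ratio a = prime_ratio b \<Longrightarrow> a = b"
  using prime_ratio_eq_1[of "a + - b"] prime_ratio_add[of a "- b"] prime_ratio_pos[of b]
  by (simp add: prime_ratio_uminus)

lemma prime_ratio_nat: "0 < n \<Longrightarrow> \<exists>c. prime_ratio c = real n"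
proof (induction n rule: prime_divisors_induct)
  case (unit x)
  then show ?case using prime_ratio_0 by (intro exI[of _ 0]) simp
next
  case (factor p x)
  then obtain c where c: "prime_ratio c = real x" by auto
  obtain i where "nth_prime i = p" using nth_prime(2) factor by blast
  then show ?case
    using prime_ratio_add[of "Poly_Mapping.single i 1" c] prime_ratio_single[of i] c
    by (intro exI[of _ "Poly_Mapping.single i 1 + c"]) simp
qed simp

context knaster_metric
begin

text \<open>Multiplications by positive rationals are quotients of those by positive integers.\<close>

lemma prime_ratio_homeo: "\<exists>h\<in>carrier HG. lift h = (\<lambda>t. prime_ratio c * t)"
proof -
  define a where "a = (\<Prod>i\<in>Poly_Mapping.keys c. nth_prime i ^ nat (Poly_Mapping.lookup c i))"
  define b where "b = (\<Prod>i\<in>Poly_Mapping.keys c. nth_prime i ^ nat (- Poly_Mapping.lookup c i))"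
  have pos: "0 < a" "0 < b"
    using nth_prime_pos by (simp_all add: a_def b_def prod_pos)
  have ab: "prime_ratio c * real b = real a" unfolding a_def b_def by (rule prime_ratio_fraction)
  obtain f g where f: "f \<in> carrier HG" "lift f = (\<lambda>t. real a * t)"
    and g: "g \<in> carrier HG" "lift g = (\<lambda>t. real b * t)"
    using scaling_homeo[OF pos(1)] scaling_homeo[OF pos(2)] by blast
  have "lift (inv\<^bsub>HG\<^esub> g) t = t / real b" for t
    using lift_inv(2)[OF g(1), of t] pos(2) by (simp add: g(2) field_simps)
  then have "lift (f \<otimes>\<^bsub>HG\<^esub> inv\<^bsub>HG\<^esub> g) t = prime_ratio c * t" for t
    using ab pos(2) by (simp add: lift_mult[OF f(1) HG_inv_closed[OF g(1)]] f(2) field_simps flip: ab)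
  then show ?thesis
    using HG_mult_closed[OF f(1) HG_inv_closed[OF g(1)]] by (intro bexI[of _ "f \<otimes>\<^bsub>HG\<^esub> inv\<^bsub>HG\<^esub> g"]) auto
qed

definition scaling :: "(nat \<Rightarrow>\<^sub>0 int) \<Rightarrow> 'a \<Rightarrow> 'a"
  where "scaling c = (SOME h. h \<in> carrier HG \<and> lift h = (\<lambda>t. prime_ratio c * t))"

lemma scaling: "scaling c \<in> carrier HG" "lift (scaling c) = (\<lambda>t. prime_ratio c * t)"
proof -
  have "\<exists>h. h \<in> carrier HG \<and> lift h = (\<lambda>t. prime_ratio c * t)" using prime_ratio_homeo[of c] by blast
  from someI_ex[OF this] show "scaling c \<in> carrier HG" "lift (scaling c) = (\<lambda>t. prime_ratio c * t)"
    unfolding scaling_def by blast+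
qed

definition exponents :: "('a \<Rightarrow> 'a) \<Rightarrow> nat \<Rightarrow>\<^sub>0 int"
  where "exponents h = (THE c. prime_ratio c = deg h)"

text \<open>The slope is a quotient of natural numbers, so it is the value of \<open>prime_ratio\<close> at a difference.\<close>

lemma exponents: assumes h: "h \<in> carrier HG" shows "prime_ratio (exponents h) = deg h"
proof -
  obtain N k :: nat where Nk: "deg h * real (D N) = real (D 0) * real k"
    using deg(3)[OF h, of 1 0] by auto
  then have q: "deg h = real k / real (D N)" using D_pos[of N] by (simp add: D_0 field_simps)
  then have "0 < k" using deg(1)[OF h] D_pos[of N] by (simp add: zero_less_divide_iff)
  then obtain a where a: "prime_ratio a = real k" using prime_ratio_nat by blast
  obtain b where b: "prime_ratio b = real (D N)" using prime_ratio_nat D_pos by blast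
  have "prime_ratio (a + - b) = deg h"
    using a b by (simp only: prime_ratio_add prime_ratio_uminus q) simp
  then have "\<exists>!c. prime_ratio c = deg h" using prime_ratio_inj by metis
  then show ?thesis unfolding exponents_def by (rule theI')
qed

lemma exponents_eqI: "h \<in> carrier HG \<Longrightarrow> deg h = prime_ratio c \<Longrightarrow> exponents h = c"
  using exponents prime_ratio_inj by metis

lemma continuous_exponents:
  "continuous_map H.mtopology (discrete_topology (carrier (free_Abelian_group (UNIV :: nat set)))) exponents"
  unfolding continuous_map_def
proof (intro conjI allI impI)
  fix V
  show "openin H.mtopology {h \<in> topspace H.mtopology. exponents h \<in> V}"
    unfolding H.openin_mtopology
  proof (intro conjI allI impI)
    fix h assume "h \<in> {h \<in> topspace H.mtopology. exponents h \<in> V}"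
    then have h: "h \<in> carrier HG" "exponents h \<in> V" by simp_all
    obtain \<delta> where \<delta>: "0 < \<delta>" "\<forall>g\<in>carrier HG. fdist M h g < \<delta> \<longrightarrow> deg g = deg h"
      using deg_locally_constant[OF h(1)] by blast
    have "H.mball h \<delta> \<subseteq> {h \<in> topspace H.mtopology. exponents h \<in> V}"
    proof
      fix g assume "g \<in> H.mball h \<delta>"
      then have g: "g \<in> carrier HG" "deg g = deg h" using \<delta>(2) by (auto simp: H.in_mball)
      then have "exponents g = exponents h" by (simp add: exponents_def)
      then show "g \<in> {h \<in> topspace H.mtopology. exponents h \<in> V}" using g(1) h(2) by simp
    qed
    then show "\<exists>r>0. H.mball h r \<subseteq> {h \<in> topspace H.mtopology. exponents h \<in> V}" using \<delta>(1) by blast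
  qed auto
qed auto

sublocale split: split_topological_extension HG "free_Abelian_group (UNIV :: nat set)" exponents scaling H.mtopology
proof -
  let ?F = "free_Abelian_group (UNIV :: nat set)"
  have G: "group HG" by (rule group_homeo_group)
  have q: "exponents \<in> hom HG ?F"
  proof (rule homI)
    fix g h assume gh: "g \<in> carrier HG" "h \<in> carrier HG"
    have "exponents (g \<otimes>\<^bsub>HG\<^esub> h) = exponents g + exponents h"
      by (rule exponents_eqI[OF HG_mult_closed[OF gh]])
         (simp add: prime_ratio_add exponents[OF gh(1)] exponents[OF gh(2)] deg_mult[OF gh])
    then show "exponents (g \<otimes>\<^bsub>HG\<^esub> h) = exponents g \<otimes>\<^bsub>?F\<^esub> exponents h" by simp
  qed simp
  have s: "scaling \<in> hom ?F HG"
  proof (rule homI)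
    fix a b :: "nat \<Rightarrow>\<^sub>0 int"
    have "scaling (a + b) = scaling a \<otimes>\<^bsub>HG\<^esub> scaling b"
      by (rule homeo_eqI) (simp_all add: scaling HG_mult_closed lift_mult prime_ratio_add mult.assoc)
    then show "scaling (a \<otimes>\<^bsub>?F\<^esub> b) = scaling a \<otimes>\<^bsub>HG\<^esub> scaling b" by simp
  qed (rule scaling)
  have qs: "exponents (scaling a) = a" for a
    by (rule exponents_eqI[OF scaling(1) deg_of_linear[OF scaling(2)]])
  show "split_topological_extension HG ?F exponents scaling H.mtopology"
    unfolding split_topological_extension_def split_topological_extension_axioms_def group_hom_def group_hom_axioms_def
    using G q s qs topological_group_HG continuous_exponents by simp
qed

lemma split_ker: "split.ker = degree_one"
proof -
  have "exponents h = 0 \<longleftrightarrow> deg h = 1" if "h \<in> carrier HG" for h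
    using exponents[OF that] exponents_eqI[OF that, of 0] prime_ratio_0 by auto
  then show ?thesis by (auto simp: split.ker_iff degree_one_def)
qed

lemma polish_group_U: "polish_group split.U split.\<tau>U"
  unfolding polish_group_def
proof (intro conjI)
  show "topological_group split.U split.\<tau>U" by (rule split.topological_group_U)
  show "separable_space split.\<tau>U"
    unfolding split.\<tau>U_def by (rule separable_space_open_subset[OF separable_HG split.ker_open])
  show "completely_metrizable_space split.\<tau>U"
    unfolding split.\<tau>U_def by (rule completely_metrizable_space_openin[OF completely_metrizable_HG split.ker_open])
qed

lemma extremely_amenable_U: "extremely_amenable split.U split.\<tau>U"
  unfolding extremely_amenable_def split.U_carrier split_ker
  unfolding split.U_def split.\<tau>U_def split_ker
  using extremely_amenable_degree_one by blast

end

theorem theorem1p1: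
  fixes K :: "'a set" and d :: "'a \<Rightarrow> 'a \<Rightarrow> real"
  assumes "Metric_space K d"
    and "universal_knaster_continuum (Metric_space.mtopology K d)"
  shows "\<exists>(U :: ('a \<Rightarrow> 'a) monoid) \<tau> \<phi>.
    let F = free_Abelian_group (UNIV :: nat set);
        \<sigma> = discrete_topology (carrier F)
    in polish_group U \<tau> \<and> extremely_amenable U \<tau> \<and>
       continuous_automorphism_action F \<sigma> U \<tau> \<phi> \<and>
       topological_group_isomorphic
         (homeo_group (Metric_space.mtopology K d)) (homeo_group_topology K d)
         (semidirect_product U F \<phi>) (prod_topology \<tau> \<sigma>)"
proof -
  obtain D p where "knaster_cofinal (Metric_space.mtopology K d) D p"
    using universal_knaster_cofinal[OF assms(2)] by (elim exE)
  then interpret knaster_metric K d D p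
    using assms(1) by (simp add: knaster_metric_def)
  show ?thesis
    unfolding Let_def HG_topology
    by (intro exI[of _ split.U] exI[of _ split.\<tau>U] exI[of _ split.\<phi>] conjI
        polish_group_U extremely_amenable_U split.continuous_action split.isomorphic)
qed

end
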